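(* Let $H$ and $\mathscr{H}$ be real Hilbert spaces, $E$ a real Banach space, $0<T<\infty$, and write $L^2(H):=L^2(0,T;H)$. Assume that $\mathscr{H}$ is continuously and densely included in $L^2(H)$, and let $W$ be an $\mathscr{H}$-isonormal process. Let $A$ generate a $C_0$-semigroup $(S(t))_{t\ge 0}$ on $E$ and let $B\in\mathscr{L}(H,E)$. Suppose that the function $\Phi:=S(T-\cdot)B:(0,T)\to\mathscr{L}(H,E)$ is stochastically integrable with respect to $W$, and let $\mathscr{G}_T$ be the reproducing kernel Hilbert space associated with the centred Gaussian random variable $\int_0^T S(T-t)B\,dW(t)$. Then the following assertions are equivalent: (i) $S(T)E\subseteq \mathscr{G}_T$; (ii) for all $x_0\in E$ the problem $x'=Ax+Bf$, $x(0)=x_0$, is null controllable in time $T$ with a control $f\in\mathscr{H}^\star$, i.e. for every $x_0\in E$ there is $f\in \mathscr{H}^\star$ such that the mild solution at time $T$ satisfies $x(T)=S(T)x_0+Rf=0$; (iii) the laws on $E$, for $x_0$ ranging over $E$, of the mild solutions at time $T$, $X^{x_0}(T)=S(T)x_0+\int_0^T S(T-t)B\,dW(t)$, of the stochastic evolution equation $dX(t)=AX(t)\,dt+B\,dW$, $X(0)=x_0$, are mutually absolutely continuous.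
   Context: An $\mathscr{H}$-isonormal process on a probability space $(\Omega,\mathscr{F},\mathbb{P})$ is a bounded linear map $W:\mathscr{H}\to L^2(\Omega)$ such that each $W(h)$ is centred Gaussian and $\mathbb{E}\,W(h_1)W(h_2)=[h_1,h_2]_{\mathscr{H}}$ for all $h_1,h_2\in\mathscr{H}$. $\gamma(\mathscr{H},E)$ (the $\gamma$-radonifying operators) is the completion of $\mathscr{H}\otimes E$ with respect to the norm $\|\sum_{n=1}^N h_n\otimes x_n\|^2_{\gamma(\mathscr{H},E)}=\mathbb{E}\|\sum_{n=1}^N\gamma_n x_n\|^2$, where $(h_n)_{n=1}^N$ is orthonormal in $\mathscr{H}$, $x_n\in E$, and $(\gamma_n)$ are independent standard real Gaussians; it is identified with a subspace of $\mathscr{L}(\mathscr{H},E)$. The map $W$ extends to an isometry $W:\gamma(\mathscr{H},E)\to L^2(\Omega;E)$ with $W(h\otimes x)=W(h)\otimes x$, and $\langle W(R),x^*\rangle=W(R^*x^* )$. $\Phi^*(t)=(\Phi(t))^*:E^*\to H$ denotes the adjoint of $\Phi(t):H\to E$ via the Riesz identification of $H$ with its dual. It is a standing assumption that the orbits $\Phi^*x^*:t\mapsto\Phi^*(t)x^*$ belong to $L^2(H)$ for all $x^*\in E^*$. $\Phi$ is called stochastically integrable with respect to $W$ if $\Phi^* x^*$ belongs to $\mathscr{H}$ for all $x^*\in E^*$ and there exists $R_\Phi\in\gamma(\mathscr{H},E)$ such that $R_\Phi^*x^*=\Phi^*x^*$ for all $x^*\in E^*$, where $R_\Phi^*:E^*\to\mathscr{H}$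 is the adjoint via the Riesz identification of $\mathscr{H}$ with its dual. Then $\int_0^T\Phi\,dW:=W(R_\Phi)$. $\mathscr{H}^\star$ denotes the dual of $\mathscr{H}$ relative to the $L^2(H)$-duality, so that $\mathscr{H}\hookrightarrow L^2(H)\hookrightarrow\mathscr{H}^\star$ continuously and densely and $\langle h,f\rangle_{\langle\mathscr{H},\mathscr{H}^\star\rangle}=\int_0^T[h(t),f(t)]_H\,dt$ for $h\in\mathscr{H}$, $f\in L^2(H)$. The operator $R:\mathscr{H}^\star\to E$ is the bounded operator determined by $\langle Rf,x^*\rangle=\langle\Phi^*x^*,f\rangle_{\langle\mathscr{H},\mathscr{H}^\star\rangle}$ for $x^*\in E^*$, $f\in\mathscr{H}^\star$, with $\Phi=S(T-\cdot)B$ (a priori it takes values in $E^{**}$; it is known that it takes values in $E$). For $f\in L^2(H)$ one has $Rf=\int_0^TS(T-t)Bf(t)\,dt$. For $f\in\mathscr{H}^\star$ the mild solution at time $T$ of $x'=Ax+Bf$, $x(0)=x_0$, is by definition $x(T)=S(T)x_0+Rf$. The reproducing kernel Hilbert space associated with a centred Gaussian $E$-valued random variable with covariance operator $Q\in\mathscr{L}(E^*,E)$ is the completion of $\{Qx^*:x^*\in E^*\}$ with respect to the inner product $[Qx^*,Qy^*]=\langle Qx^*,y^*\rangle$, viewed as a subspace of $E$ by continuous extension of the inclusion map. *)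

theory Defs
  imports "HOL-Probability.Probability"
begin

text \<open>
  Elements of Bochner \<open>L\<^sup>2\<close>-spaces are represented by functions, and equality of classes by almost
  everywhere equality. Neither the Hilbert spaces nor the Banach space is assumed separable, so
  measurability of vector-valued functions means strong measurability.
\<close>

definition strongly_measurable :: "'a measure \<Rightarrow> ('a \<Rightarrow> 'b::real_normed_vector) \<Rightarrow> bool" where
  "strongly_measurable M f \<longleftrightarrow>
     (\<exists>s. (\<forall>n::nat. simple_function M (s n)) \<and> (AE x in M. (\<lambda>n. s n x) \<longlonglongrightarrow> f x))"

definition in_L2 :: "'a measure \<Rightarrow> ('a \<Rightarrow> 'b::real_normed_vector) \<Rightarrow> bool" where
  "in_L2 M f \<longleftrightarrow> strongly_measurable M f \<and> (\<integral>\<^sup>+x. ennreal ((norm (f x))\<^sup>2) \<partial>M) < \<infinity>"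

definition L2_norm :: "'a measure \<Rightarrow> ('a \<Rightarrow> 'b::real_normed_vector) \<Rightarrow> real" where
  "L2_norm M f = sqrt (enn2real (\<integral>\<^sup>+x. ennreal ((norm (f x))\<^sup>2) \<partial>M))"

abbreviation time_measure :: "real \<Rightarrow> real measure" where
  "time_measure T \<equiv> lebesgue_on {0<..<T}"

text \<open>
  The space \<open>\<H>\<close> is a type \<open>'k\<close> together with the inclusion map \<open>j\<close> into \<open>L\<^sup>2(0,T;H)\<close>.
\<close>

definition continuous_dense_inclusion ::
  "real \<Rightarrow> ('k::{real_inner,complete_space} \<Rightarrow> real \<Rightarrow> 'h::{real_inner,complete_space}) \<Rightarrow> bool" where
  "continuous_dense_inclusion T j \<longleftrightarrow>
     (\<forall>k. in_L2 (time_measure T) (j k)) \<and>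
     (\<forall>a b k l. AE t in time_measure T. j (a *\<^sub>R k + b *\<^sub>R l) t = a *\<^sub>R j k t + b *\<^sub>R j l t) \<and>
     (\<forall>k. (AE t in time_measure T. j k t = 0) \<longrightarrow> k = 0) \<and>
     (\<exists>C. \<forall>k. L2_norm (time_measure T) (j k) \<le> C * norm k) \<and>
     (\<forall>f. in_L2 (time_measure T) f \<longrightarrow>
        (\<forall>\<epsilon>>0. \<exists>k. L2_norm (time_measure T) (\<lambda>t. f t - j k t) < \<epsilon>))"

text \<open>Dirac measure at 0 counts as a (degenerate) centred Gaussian law.\<close>

definition centred_gaussian :: "'w measure \<Rightarrow> ('w \<Rightarrow> real) \<Rightarrow> bool" where
  "centred_gaussian M X \<longleftrightarrow> X \<in> borel_measurable M \<and>
     (distr M borel X = return borel 0 \<or>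
      (\<exists>\<sigma>>0. distr M borel X = density lborel (\<lambda>x. ennreal (normal_density 0 \<sigma> x))))"

definition isonormal_process ::
  "'w measure \<Rightarrow> ('k::{real_inner,complete_space} \<Rightarrow> 'w \<Rightarrow> real) \<Rightarrow> bool" where
  "isonormal_process M W \<longleftrightarrow>
     (\<forall>a b h k. AE \<omega> in M. W (a *\<^sub>R h + b *\<^sub>R k) \<omega> = a * W h \<omega> + b * W k \<omega>) \<and>
     (\<exists>C. \<forall>h. L2_norm M (W h) \<le> C * norm h) \<and>
     (\<forall>h. centred_gaussian M (W h)) \<and>
     (\<forall>h k. (\<integral>\<omega>. W h \<omega> * W k \<omega> \<partial>M) = h \<bullet> k)"

definition C0_semigroup :: "(real \<Rightarrow> 'e::banach \<Rightarrow>\<^sub>L 'e) \<Rightarrow> bool" where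
  "C0_semigroup S \<longleftrightarrow>
     S 0 = id_blinfun \<and>
     (\<forall>s\<ge>0. \<forall>t\<ge>0. S (s + t) = S s o\<^sub>L S t) \<and>
     (\<forall>x. ((\<lambda>t. S t x) \<longlongrightarrow> x) (at_right 0))"

text \<open>\<open>A\<close> is an unbounded operator with domain \<open>D\<close>; its values outside \<open>D\<close> are irrelevant.\<close>

definition generates_C0_semigroup ::
  "'e::banach set \<Rightarrow> ('e \<Rightarrow> 'e) \<Rightarrow> (real \<Rightarrow> 'e \<Rightarrow>\<^sub>L 'e) \<Rightarrow> bool" where
  "generates_C0_semigroup D A S \<longleftrightarrow>
     C0_semigroup S \<and>
     D = {x. \<exists>y. ((\<lambda>t. (S t x - x) /\<^sub>R t) \<longlongrightarrow> y) (at_right 0)} \<and>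
     (\<forall>x\<in>D. ((\<lambda>t. (S t x - x) /\<^sub>R t) \<longlongrightarrow> A x) (at_right 0))"

text \<open>The adjoint of an operator from a Hilbert space to \<open>E\<close>, via the Riesz identification.\<close>

definition riesz_adjoint ::
  "('h::{real_inner,complete_space} \<Rightarrow>\<^sub>L 'e::banach) \<Rightarrow> ('e \<Rightarrow>\<^sub>L real) \<Rightarrow> 'h" where
  "riesz_adjoint R xs = (THE k. \<forall>g. k \<bullet> g = blinfun_apply xs (R g))"

text \<open>
  \<open>\<Sum>n<N. h n \<otimes> x n\<close>, identified with the operator \<open>g \<mapsto> \<Sum>n<N. [h n, g] x n\<close>.
\<close>

definition tensor_sum ::
  "nat \<Rightarrow> (nat \<Rightarrow> 'k::{real_inner,complete_space}) \<Rightarrow> (nat \<Rightarrow> 'e::banach) \<Rightarrow> 'k \<Rightarrow>\<^sub>L 'e" where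
  "tensor_sum N h x = (\<Sum>n<N. blinfun_scaleR_left (x n) o\<^sub>L blinfun_inner_right (h n))"

definition orthonormal_upto :: "nat \<Rightarrow> (nat \<Rightarrow> 'k::real_inner) \<Rightarrow> bool" where
  "orthonormal_upto N h \<longleftrightarrow> (\<forall>m<N. \<forall>n<N. h m \<bullet> h n = (if m = n then 1 else 0))"

text \<open>The \<open>\<gamma>\<close>-norm on the algebraic tensor product; the Gaussians are the coordinates of the
  standard Gaussian measure on \<open>\<real>\<^sup>N\<close>.\<close>

definition gamma_norm :: "('k::{real_inner,complete_space} \<Rightarrow>\<^sub>L 'e::banach) \<Rightarrow> real" where
  "gamma_norm R = (THE c. \<exists>N h x. orthonormal_upto N h \<and> R = tensor_sum N h x \<and>
     c = sqrt (\<integral>\<gamma>. (norm (\<Sum>n<N. \<gamma> n *\<^sub>R x n))\<^sup>2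
               \<partial>(\<Pi>\<^sub>M n\<in>{..<N}. density lborel (\<lambda>x. ennreal (std_normal_density x)))))"

text \<open>
  A \<open>\<gamma>\<close>-Cauchy sequence in \<open>\<H> \<otimes> E\<close>, i.e. an element of the completion \<open>\<gamma>(\<H>,E)\<close>, is identified
  with its limit in operator norm, which exists because the operator norm is dominated by the
  \<open>\<gamma>\<close>-norm.
\<close>

definition gamma_approximates ::
  "(nat \<Rightarrow> 'k::{real_inner,complete_space} \<Rightarrow>\<^sub>L 'e::banach) \<Rightarrow> ('k \<Rightarrow>\<^sub>L 'e) \<Rightarrow> bool" where
  "gamma_approximates Rs R \<longleftrightarrow>
     (\<forall>i. \<exists>N h x. Rs i = tensor_sum N h x) \<and>
     (\<forall>\<epsilon>>0. \<exists>I. \<forall>i\<ge>I. \<forall>l\<ge>I. gamma_norm (Rs i - Rs l) < \<epsilon>) \<and>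
     Rs \<longlonglongrightarrow> R"

definition gamma_radonifying :: "('k::{real_inner,complete_space} \<Rightarrow>\<^sub>L 'e::banach) \<Rightarrow> bool" where
  "gamma_radonifying R \<longleftrightarrow> (\<exists>Rs. gamma_approximates Rs R)"

text \<open>
  A Borel measurable version of the value at \<open>R \<in> \<gamma>(\<H>,E)\<close> of the continuous extension of
  \<open>h \<otimes> x \<mapsto> W(h) \<otimes> x\<close> to a map from \<open>\<gamma>(\<H>,E)\<close> into \<open>L\<^sup>2(\<Omega>;E)\<close>.
\<close>

definition isonormal_extension ::
  "'w measure \<Rightarrow> ('k::{real_inner,complete_space} \<Rightarrow> 'w \<Rightarrow> real) \<Rightarrow> ('k \<Rightarrow>\<^sub>L 'e::banach) \<Rightarrow> 'w \<Rightarrow> 'e" where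
  "isonormal_extension M W R = (SOME X. X \<in> borel_measurable M \<and> in_L2 M X \<and>
     (\<exists>N h x. gamma_approximates (\<lambda>i. tensor_sum (N i) (h i) (x i)) R \<and>
        (\<lambda>i. L2_norm M (\<lambda>\<omega>. X \<omega> - (\<Sum>n<N i. W (h i n) \<omega> *\<^sub>R x i n))) \<longlonglongrightarrow> 0))"

definition orbit_in_space ::
  "real \<Rightarrow> ('k::{real_inner,complete_space} \<Rightarrow> real \<Rightarrow> 'h::{real_inner,complete_space}) \<Rightarrow>
   (real \<Rightarrow> 'h \<Rightarrow>\<^sub>L 'e::banach) \<Rightarrow> ('e \<Rightarrow>\<^sub>L real) \<Rightarrow> 'k \<Rightarrow> bool" where
  "orbit_in_space T j \<Phi> xs k \<longleftrightarrow> (AE t in time_measure T. j k t = riesz_adjoint (\<Phi> t) xs)"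

text \<open>The orbit \<open>\<Phi>\<^sup>*x\<^sup>*\<close> as an element of \<open>\<H>\<close>.\<close>

definition orbit ::
  "real \<Rightarrow> ('k::{real_inner,complete_space} \<Rightarrow> real \<Rightarrow> 'h::{real_inner,complete_space}) \<Rightarrow>
   (real \<Rightarrow> 'h \<Rightarrow>\<^sub>L 'e::banach) \<Rightarrow> ('e \<Rightarrow>\<^sub>L real) \<Rightarrow> 'k" where
  "orbit T j \<Phi> xs = (THE k. orbit_in_space T j \<Phi> xs k)"

definition represents ::
  "real \<Rightarrow> ('k::{real_inner,complete_space} \<Rightarrow> real \<Rightarrow> 'h::{real_inner,complete_space}) \<Rightarrow>
   (real \<Rightarrow> 'h \<Rightarrow>\<^sub>L 'e::banach) \<Rightarrow> ('k \<Rightarrow>\<^sub>L 'e) \<Rightarrow> bool" where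
  "represents T j \<Phi> R \<longleftrightarrow> gamma_radonifying R \<and> (\<forall>xs. riesz_adjoint R xs = orbit T j \<Phi> xs)"

definition stochastically_integrable ::
  "real \<Rightarrow> ('k::{real_inner,complete_space} \<Rightarrow> real \<Rightarrow> 'h::{real_inner,complete_space}) \<Rightarrow>
   (real \<Rightarrow> 'h \<Rightarrow>\<^sub>L 'e::banach) \<Rightarrow> bool" where
  "stochastically_integrable T j \<Phi> \<longleftrightarrow>
     (\<forall>xs. \<exists>k. orbit_in_space T j \<Phi> xs k) \<and> (\<exists>R. represents T j \<Phi> R)"

definition stochastic_integral ::
  "'w measure \<Rightarrow> ('k::{real_inner,complete_space} \<Rightarrow> 'w \<Rightarrow> real) \<Rightarrow> real \<Rightarrow>
   ('k \<Rightarrow> real \<Rightarrow> 'h::{real_inner,complete_space}) \<Rightarrow> (real \<Rightarrow> 'h \<Rightarrow>\<^sub>L 'e::banach) \<Rightarrow> 'w \<Rightarrow> 'e" where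
  "stochastic_integral M W T j \<Phi> = isonormal_extension M W (THE R. represents T j \<Phi> R)"

definition covariance_operator ::
  "'w measure \<Rightarrow> ('w \<Rightarrow> 'e::banach) \<Rightarrow> ('e \<Rightarrow>\<^sub>L real) \<Rightarrow>\<^sub>L 'e" where
  "covariance_operator M X = (THE Q. \<forall>xs ys.
     blinfun_apply ys (blinfun_apply Q xs) =
       (\<integral>\<omega>. blinfun_apply xs (X \<omega>) * blinfun_apply ys (X \<omega>) \<partial>M))"

text \<open>
  The underlying set, as a subspace of \<open>E\<close>, of the completion of the range of \<open>Q\<close> under
  \<open>[Q x, Q y] = \<langle>Q x, y\<rangle>\<close>: a Cauchy sequence \<open>Q (ys n)\<close> for this inner product is mapped to its
  limit in \<open>E\<close>.
\<close>

definition rkhs :: "(('e::banach \<Rightarrow>\<^sub>L real) \<Rightarrow>\<^sub>L 'e) \<Rightarrow> 'e set" where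
  "rkhs Q = {g. \<exists>ys :: nat \<Rightarrow> ('e \<Rightarrow>\<^sub>L real).
     (\<forall>\<epsilon>>0. \<exists>N. \<forall>m\<ge>N. \<forall>n\<ge>N.
        sqrt (blinfun_apply (ys m - ys n) (blinfun_apply Q (ys m - ys n))) < \<epsilon>) \<and>
     (\<lambda>n. blinfun_apply Q (ys n)) \<longlonglongrightarrow> g}"

text \<open>
  \<open>\<H>\<^sup>\<star>\<close> is the space of bounded functionals on \<open>\<H>\<close>, with pairing \<open>\<langle>k, f\<rangle> = f k\<close>; a function
  \<open>f \<in> L\<^sup>2(H)\<close> is included in it as the functional \<open>k \<mapsto> \<integral>\<^sub>0\<^sup>T [j k t, f t] dt\<close>.
\<close>

type_synonym 'k L2_dual = "'k \<Rightarrow>\<^sub>L real"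

definition control_operator ::
  "real \<Rightarrow> ('k::{real_inner,complete_space} \<Rightarrow> real \<Rightarrow> 'h::{real_inner,complete_space}) \<Rightarrow>
   (real \<Rightarrow> 'h \<Rightarrow>\<^sub>L 'e::banach) \<Rightarrow> 'k L2_dual \<Rightarrow>\<^sub>L 'e" where
  "control_operator T j \<Phi> = (THE R. \<forall>f xs.
     blinfun_apply xs (blinfun_apply R f) = blinfun_apply f (orbit T j \<Phi> xs))"

definition controlled_mild_solution ::
  "(real \<Rightarrow> 'e::banach \<Rightarrow>\<^sub>L 'e) \<Rightarrow> ('h::{real_inner,complete_space} \<Rightarrow>\<^sub>L 'e) \<Rightarrow> real \<Rightarrow>
   ('k::{real_inner,complete_space} \<Rightarrow> real \<Rightarrow> 'h) \<Rightarrow> 'e \<Rightarrow> 'k L2_dual \<Rightarrow> 'e" where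
  "controlled_mild_solution S B T j x0 f =
     S T x0 + control_operator T j (\<lambda>t. S (T - t) o\<^sub>L B) f"

definition stochastic_mild_solution ::
  "'w measure \<Rightarrow> ('k::{real_inner,complete_space} \<Rightarrow> 'w \<Rightarrow> real) \<Rightarrow>
   (real \<Rightarrow> 'e::banach \<Rightarrow>\<^sub>L 'e) \<Rightarrow> ('h::{real_inner,complete_space} \<Rightarrow>\<^sub>L 'e) \<Rightarrow> real \<Rightarrow>
   ('k \<Rightarrow> real \<Rightarrow> 'h) \<Rightarrow> 'e \<Rightarrow> 'w \<Rightarrow> 'e" where
  "stochastic_mild_solution M W S B T j x0 \<omega> =
     S T x0 + stochastic_integral M W T j (\<lambda>t. S (T - t) o\<^sub>L B) \<omega>"

end

theory Submission
  imports Defs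
begin

text \<open>
  Let \<open>R\<close> represent \<open>\<Phi>\<close> and let \<open>X = W(R)\<close> be the stochastic integral, so that
  \<open>\<langle>X, x\<^sup>*\<rangle> = W (R\<^sup>* x\<^sup>*)\<close> and the covariance operator of \<open>X\<close> is \<open>R R\<^sup>*\<close>. Both the
  reproducing kernel Hilbert space of \<open>X\<close> and the range of the control operator are then the range
  of \<open>R\<close>, so (i) and (ii) both say that \<open>S(T)\<close> maps into the range of \<open>R\<close>. By the Cameron-Martin
  formula the law of \<open>X + R h\<close> is the image under \<open>X\<close> of the measure with density
  \<open>exp (W h - \<parallel>h\<parallel>\<^sup>2 / 2)\<close>, hence absolutely continuous with respect to the law of \<open>X\<close>; conversely,
  translation by a vector outside the range of \<open>R\<close> gives a law that is singular to the law of \<open>X\<close>.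
\<close>

text \<open>No separability is assumed, and this shapes the probabilistic half. Borel sets of
  \<open>E\<close> need not be generated by functionals, so a law on \<open>E\<close> cannot be
  identified through its finite-dimensional projections, and a sum of two Borel maps need not be
  Borel. Identities between laws are therefore proved for finite-rank approximants, whose randomness
  sits in finitely many Gaussian coordinates, and carried over to \<open>X\<close> by almost
  everywhere convergence of a subsequence, tested against continuous functions; these determine a
  finite Borel measure on any metric space. An isonormal process is only known to be linear almost
  everywhere for each fixed combination and to have Gaussian one-dimensional marginals; independence
  along orthonormal vectors follows because linearity makes every combination Gaussian. The
  operators given by unique description (covariance, control operator, representing operator) are
  pinned down by Hahn-Banach: functionals separate points. In the Cameron-Martin density the term
  \<open>- (norm h)^2 / 2\<close> normalises the exponential of \<open>W h\<close>, a centred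
  Gaussian of variance \<open>(norm h)^2\<close>.\<close>

subsection \<open>Riesz representation and separation of points\<close>

text \<open>A minimising sequence of \<open>\<parallel>x\<parallel>\<^sup>2 - 2 f x\<close> over \<open>V\<close> is Cauchy by the parallelogram law.\<close>

lemma riesz_subspace:
  fixes V :: "'k::{real_inner,complete_space} set" and f :: "'k \<Rightarrow> real"
  assumes V: "subspace V"
    and add: "\<And>x y. x \<in> V \<Longrightarrow> y \<in> V \<Longrightarrow> f (x + y) = f x + f y"
    and scale: "\<And>c x. x \<in> V \<Longrightarrow> f (c *\<^sub>R x) = c * f x"
    and bound: "\<And>x. x \<in> V \<Longrightarrow> \<bar>f x\<bar> \<le> C * norm x"
  obtains s k where "\<And>n. s n \<in> V" "s \<longlonglongrightarrow> k" "\<And>g. g \<in> V \<Longrightarrow> k \<bullet> g = f g"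
proof -
  define J where "J x = (norm x)\<^sup>2 - 2 * f x" for x
  define m where "m = Inf (J ` V)"
  have J_lower: "J x \<ge> - C\<^sup>2" if "x \<in> V" for x
  proof -
    have "0 \<le> (norm x - C)\<^sup>2" by simp
    also have "\<dots> = (norm x)\<^sup>2 - 2 * (C * norm x) + C\<^sup>2"
      by (simp add: power2_diff)
    finally show ?thesis
      using bound[OF that] unfolding J_def by linarith
  qed
  have bdd: "bdd_below (J ` V)"
    using J_lower by (intro bdd_belowI[of _ "- C\<^sup>2"]) auto
  have V0: "0 \<in> V" using V by (rule subspace_0)
  have m_le: "m \<le> J x" if "x \<in> V" for x
    unfolding m_def using bdd that by (intro cInf_lower) auto
  have "\<exists>x\<in>V. J x < m + e" if "e > 0" for e :: real
  proof -
    have "Inf (J ` V) < m + e" using that m_def by simp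
    then show ?thesis
      using cInf_less_iff[of "J ` V" "m + e"] V0 bdd by auto
  qed
  then have "\<forall>n. \<exists>x\<in>V. J x < m + 1 / real (Suc n)" by simp
  then obtain s where s: "\<And>n. s n \<in> V" and sJ: "\<And>n. J (s n) < m + 1 / real (Suc n)"
    by metis
  have par: "(norm (x - y))\<^sup>2 = 2 * J x + 2 * J y - 4 * J ((1/2) *\<^sub>R (x + y))"
    if "x \<in> V" "y \<in> V" for x y
    using that V
    by (simp add: J_def scale add subspace_add power2_norm_eq_inner inner_simps inner_commute
        del: norm_scaleR) (simp add: field_simps)
  have s_diff: "(norm (s i - s l))\<^sup>2 \<le> 4 / real (Suc n)" if "n \<le> i" "n \<le> l" for i l n
  proof -
    have "m \<le> J ((1/2) *\<^sub>R (s i + s l))"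
      using s V by (intro m_le subspace_scale subspace_add)
    moreover have "1 / real (Suc i) \<le> 1 / real (Suc n)" "1 / real (Suc l) \<le> 1 / real (Suc n)"
      using that by (auto simp: frac_le)
    ultimately have "(norm (s i - s l))\<^sup>2 \<le> 4 * (1 / real (Suc n))"
      using sJ[of i] sJ[of l] par[OF s s, of i l] by linarith
    then show ?thesis by simp
  qed
  have "Cauchy s"
  proof (rule metric_CauchyI)
    fix e :: real assume "0 < e"
    obtain n where "4 / e\<^sup>2 < real n" using reals_Archimedean2 by blast
    then have "4 / e\<^sup>2 < real (Suc n)" by simp
    then have "4 / real (Suc n) < e\<^sup>2"
      using \<open>0 < e\<close> by (metis mult.commute pos_divide_less_eq of_nat_0_less_iff zero_less_Suc zero_less_power)
    then have "(norm (s i - s l))\<^sup>2 < e\<^sup>2" if "n \<le> i" "n \<le> l" for i l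
      using s_diff[OF that] by linarith
    then have "dist (s i) (s l) < e" if "n \<le> i" "n \<le> l" for i l
      unfolding dist_norm using that \<open>0 < e\<close> by (meson power2_less_imp_less less_imp_le)
    then show "\<exists>n. \<forall>i\<ge>n. \<forall>l\<ge>n. dist (s i) (s l) < e" by blast
  qed
  then obtain k where k: "s \<longlonglongrightarrow> k" using Cauchy_convergent convergent_def by blast
  have "k \<bullet> g = f g" if g: "g \<in> V" for g
  proof -
    \<comment> \<open>\<open>m\<close> bounds \<open>J\<close> from below at the perturbed point
      \<open>s n + t g\<close>, and the slack 1/(n+1) vanishes in the limit. What remains is a
      quadratic in \<open>t\<close> that vanishes at 0 and is never negative, so its linear
      coefficient must be zero.\<close>
    have ineq: "0 \<le> 2 * t * (k \<bullet> g - f g) + t\<^sup>2 * (norm g)\<^sup>2" for t :: real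
    proof (rule LIMSEQ_le)
      show "(\<lambda>n. 2 * t * (s n \<bullet> g - f g) + t\<^sup>2 * (norm g)\<^sup>2) \<longlonglongrightarrow> 2 * t * (k \<bullet> g - f g) + t\<^sup>2 * (norm g)\<^sup>2"
        by (intro tendsto_intros k)
      show "(\<lambda>n. - (1 / real (Suc n))) \<longlonglongrightarrow> 0"
        using tendsto_minus[OF LIMSEQ_inverse_real_of_nat] by (simp add: inverse_eq_divide)
      have "- (1 / real (Suc n)) \<le> 2 * t * (s n \<bullet> g - f g) + t\<^sup>2 * (norm g)\<^sup>2" for n
      proof -
        have "m \<le> J (s n + t *\<^sub>R g)"
          using s V g by (intro m_le subspace_scale subspace_add)
        also have "\<dots> = J (s n) + 2 * t * (s n \<bullet> g - f g) + t\<^sup>2 * (norm g)\<^sup>2"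
          using s V g unfolding J_def
          by (simp add: add scale subspace_scale power2_norm_eq_inner inner_simps inner_commute)
             (simp add: algebra_simps power2_eq_square)
        finally show ?thesis using sJ[of n] by linarith
      qed
      then show "\<exists>N. \<forall>n\<ge>N. - (1 / real (Suc n)) \<le> 2 * t * (s n \<bullet> g - f g) + t\<^sup>2 * (norm g)\<^sup>2" by blast
    qed
    define d where "d = k \<bullet> g - f g"
    \<comment> \<open>The \<open>+ 1\<close> keeps \<open>q\<close> positive when
      \<open>g = 0\<close>; the choice \<open>t = - d / q\<close> minimises
      \<open>2 * t * d + t^2 * q\<close>.\<close>
    define q where "q = (norm g)\<^sup>2 + 1"
    have "q > 0" unfolding q_def by (simp add: add_nonneg_pos)
    have "0 \<le> 2 * (- d / q) * d + (- d / q)\<^sup>2 * (norm g)\<^sup>2" using ineq d_def by blast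
    also have "\<dots> \<le> 2 * (- d / q) * d + (- d / q)\<^sup>2 * q"
      unfolding q_def by (intro add_left_mono mult_left_mono) auto
    also have "\<dots> = - (d\<^sup>2 / q)" using \<open>q > 0\<close> by (simp add: field_simps power2_eq_square)
    finally have "d\<^sup>2 / q \<le> 0" by simp
    then have "d = 0" using \<open>q > 0\<close> by (simp add: divide_le_0_iff)
    then show ?thesis unfolding d_def by simp
  qed
  \<comment> \<open>\<open>V\<close> need not be closed, so \<open>k\<close> lies only in its
    closure. The sequence \<open>s\<close> is exported because the reproducing kernel space is
    described by such approximating sequences.\<close>
  then show ?thesis using that s k by blast
qed

lemma riesz_representation:
  fixes f :: "'k::{real_inner,complete_space} \<Rightarrow>\<^sub>L real"
  obtains k where "\<And>g. k \<bullet> g = f g"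
proof (rule riesz_subspace[of UNIV "blinfun_apply f" "norm f"])
  show "\<bar>f x\<bar> \<le> norm f * norm x" for x
    using norm_blinfun[of f x] by simp
qed (auto simp: blinfun.add_right blinfun.scaleR_right)

lemma riesz_adjoint_inner:
  fixes R :: "'k::{real_inner,complete_space} \<Rightarrow>\<^sub>L 'e::banach"
  shows "riesz_adjoint R xs \<bullet> g = blinfun_apply xs (R g)"
proof -
  obtain k where k: "\<And>g. k \<bullet> g = blinfun_apply (xs o\<^sub>L R) g"
    by (rule riesz_representation[of "xs o\<^sub>L R"]) blast
  have "riesz_adjoint R xs = k"
    unfolding riesz_adjoint_def
  proof (rule the_equality)
    show "\<forall>g. k \<bullet> g = blinfun_apply xs (R g)" using k by simp
    fix l assume "\<forall>g. l \<bullet> g = blinfun_apply xs (R g)"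
    then have "\<forall>g. l \<bullet> g = k \<bullet> g" using k by simp
    then show "l = k" by (metis vector_eq_rdot)
  qed
  then show ?thesis using k by simp
qed

lemma inner_riesz_adjoint:
  "g \<bullet> riesz_adjoint R xs = blinfun_apply xs (blinfun_apply R g)"
  by (simp add: riesz_adjoint_inner inner_commute[of g])

lemma riesz_adjoint_eqI: "(\<And>g. k \<bullet> g = blinfun_apply xs (blinfun_apply R g)) \<Longrightarrow> riesz_adjoint R xs = k"
  using riesz_adjoint_inner by (metis vector_eq_rdot)

lemma linear_riesz_adjoint: "linear (riesz_adjoint R)"
  by (intro linearI riesz_adjoint_eqI)
     (auto simp: inner_simps riesz_adjoint_inner blinfun.add_left blinfun.scaleR_left)

lemma norm_riesz_adjoint_le: "norm (riesz_adjoint R xs) \<le> norm xs * norm R"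
proof -
  let ?k = "riesz_adjoint R xs"
  have "norm ?k * norm ?k = blinfun_apply xs (R ?k)"
    by (simp add: power2_norm_eq_inner riesz_adjoint_inner flip: power2_eq_square)
  also have "\<dots> \<le> norm xs * norm (R ?k)"
    using norm_blinfun[of xs "R ?k"] by simp
  also have "\<dots> \<le> norm xs * (norm R * norm ?k)"
    by (intro mult_left_mono norm_blinfun) simp
  finally have "norm ?k * norm ?k \<le> (norm xs * norm R) * norm ?k" by (simp add: mult.assoc)
  then show ?thesis by (cases "?k = 0") auto
qed

section \<open>Hahn-Banach by minimal sublinear functionals\<close>

definition sublinear :: "('e::real_normed_vector \<Rightarrow> real) \<Rightarrow> bool" where
  "sublinear p \<longleftrightarrow> (\<forall>x y. p (x + y) \<le> p x + p y) \<and> (\<forall>t x. 0 \<le> t \<longrightarrow> p (t *\<^sub>R x) = t * p x) \<and>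
    (\<forall>x. p x \<le> norm x)"

lemma sublinear_add: "sublinear p \<Longrightarrow> p (x + y) \<le> p x + p y"
  and sublinear_scale: "sublinear p \<Longrightarrow> 0 \<le> t \<Longrightarrow> p (t *\<^sub>R x) = t * p x"
  and sublinear_le_norm: "sublinear p \<Longrightarrow> p x \<le> norm x"
  by (auto simp: sublinear_def)

lemma sublinear_zero: "sublinear p \<Longrightarrow> p 0 = 0"
  using sublinear_scale[of p 0 0] by simp

lemma sublinear_neg: "sublinear p \<Longrightarrow> - p (- x) \<le> p x"
  using sublinear_add[of p x "- x"] sublinear_zero[of p] by simp

lemma sublinear_ge_minus_norm: "sublinear p \<Longrightarrow> - norm x \<le> p x"
  using sublinear_le_norm[of p "- x"] sublinear_neg[of p x] by simp

text \<open>The witness is the infimum of \<open>p (x + t y) - t * p y\<close> over \<open>t\<close>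
  at least 0. Subadditivity bounds it below by \<open>- p (- x)\<close>, so it is finite;
  \<open>t = 0\<close> gives \<open>q\<close> below \<open>p\<close>, and \<open>t = 1\<close> at
  \<open>x = - y\<close> gives the last claim. It serves twice: to show that minimal functionals are
  odd, and to tilt the norm towards a chosen vector.\<close>

lemma sublinear_tilt:
  fixes p :: "'e::real_normed_vector \<Rightarrow> real"
  assumes p: "sublinear p"
  obtains q where "sublinear q" "q \<le> p" "q (- y) \<le> - p y"
proof -
  define q where "q x = (INF t\<in>{0..}. p (x + t *\<^sub>R y) - t * p y)" for x
  have lower: "- p (- x) \<le> p (x + t *\<^sub>R y) - t * p y" if "0 \<le> t" for x t
    using sublinear_add[OF p, of "x + t *\<^sub>R y" "- x"] sublinear_scale[OF p that, of y] by simp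
  have bdd: "bdd_below ((\<lambda>t. p (x + t *\<^sub>R y) - t * p y) ` {0..})" for x
    using lower by (intro bdd_belowI2[where m = "- p (- x)"]) auto
  have q_le: "q x \<le> p (x + t *\<^sub>R y) - t * p y" if "0 \<le> t" for x t
    unfolding q_def using bdd that by (intro cINF_lower) auto
  have q_ge: "c \<le> q x" if "\<And>t. 0 \<le> t \<Longrightarrow> c \<le> p (x + t *\<^sub>R y) - t * p y" for c x
    unfolding q_def using that by (intro cINF_greatest) auto
  have qp: "q x \<le> p x" for x using q_le[of 0 x] by simp
  have add: "q (x + z) \<le> q x + q z" for x z
  proof -
    have "q (x + z) - (p (z + t *\<^sub>R y) - t * p y) \<le> q x" if t: "0 \<le> t" for t
    proof (rule q_ge)
      fix s :: real assume s: "0 \<le> s"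
      have "q (x + z) \<le> p ((x + z) + (s + t) *\<^sub>R y) - (s + t) * p y"
        using s t by (intro q_le) simp
      also have "(x + z) + (s + t) *\<^sub>R y = (x + s *\<^sub>R y) + (z + t *\<^sub>R y)"
        by (simp add: algebra_simps)
      also have "p \<dots> \<le> p (x + s *\<^sub>R y) + p (z + t *\<^sub>R y)" by (rule sublinear_add[OF p])
      finally show "q (x + z) - (p (z + t *\<^sub>R y) - t * p y) \<le> p (x + s *\<^sub>R y) - s * p y"
        by (simp add: algebra_simps)
    qed
    then have "q (x + z) - q x \<le> q z" by (intro q_ge) (simp add: algebra_simps)
    then show ?thesis by simp
  qed
  have scale_le: "q (c *\<^sub>R x) \<le> c * q x" if c: "0 < c" for c x
  proof -
    have "q (c *\<^sub>R x) / c \<le> q x"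
    proof (rule q_ge)
      fix t :: real assume "0 \<le> t"
      then have "q (c *\<^sub>R x) \<le> p (c *\<^sub>R x + (c * t) *\<^sub>R y) - (c * t) * p y"
        using c by (intro q_le) simp
      also have "c *\<^sub>R x + (c * t) *\<^sub>R y = c *\<^sub>R (x + t *\<^sub>R y)" by (simp add: algebra_simps)
      also have "p \<dots> = c * p (x + t *\<^sub>R y)" using c by (intro sublinear_scale[OF p]) simp
      finally show "q (c *\<^sub>R x) / c \<le> p (x + t *\<^sub>R y) - t * p y"
        using c by (simp add: field_simps)
    qed
    then show ?thesis using c by (simp add: field_simps)
  qed
  have scale: "q (c *\<^sub>R x) = c * q x" if "0 \<le> c" for c x
  proof (cases "c = 0")
    case True
    have "q 0 \<le> 0" using qp[of 0] sublinear_zero[OF p] by simp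
    moreover have "0 \<le> q 0" using lower[of _ 0] sublinear_zero[OF p] by (intro q_ge) simp
    ultimately show ?thesis using True by simp
  next
    case False
    then have c: "c > 0" using that by simp
    have "q ((1 / c) *\<^sub>R (c *\<^sub>R x)) \<le> (1 / c) * q (c *\<^sub>R x)" using c by (intro scale_le) simp
    then have "c * q x \<le> q (c *\<^sub>R x)" using c by (simp add: field_simps)
    then show ?thesis using scale_le[OF c, of x] by simp
  qed
  have "sublinear q"
    using add scale qp sublinear_le_norm[OF p] unfolding sublinear_def by (meson order_trans)
  moreover have "q (- y) \<le> - p y" using q_le[of 1 "- y"] sublinear_zero[OF p] by simp
  moreover have "q \<le> p" using qp by (simp add: le_fun_def)
  ultimately show ?thesis using that by blast
qed

text \<open>An infimum of sublinear functionals is not subadditive in general; in a chain the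
  smaller of two members can be used at both points. Domination by the norm, which is part of
  \<open>sublinear\<close>, bounds every member below by \<open>- norm x\<close> and so keeps the
  infimum finite.\<close>

lemma sublinear_INF_chain:
  fixes C :: "('e::real_normed_vector \<Rightarrow> real) set"
  assumes ne: "C \<noteq> {}" and sub: "\<And>p. p \<in> C \<Longrightarrow> sublinear p"
    and chain: "\<And>p q. p \<in> C \<Longrightarrow> q \<in> C \<Longrightarrow> p \<le> q \<or> q \<le> p"
  shows "sublinear (\<lambda>x. INF p\<in>C. p x)"
proof -
  let ?u = "\<lambda>x. INF p\<in>C. p x"
  have bdd: "bdd_below ((\<lambda>p. p x) ` C)" for x
    using sublinear_ge_minus_norm[OF sub] by (intro bdd_belowI2[where m = "- norm x"]) auto
  have u_le: "?u x \<le> p x" if "p \<in> C" for p x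
    using bdd that by (intro cINF_lower)
  have u_ge: "c \<le> ?u x" if "\<And>p. p \<in> C \<Longrightarrow> c \<le> p x" for c x
    using ne that by (intro cINF_greatest)
  have "?u (x + y) \<le> ?u x + ?u y" for x y
  proof -
    have "?u (x + y) \<le> p x + q y" if pq: "p \<in> C" "q \<in> C" for p q
    proof -
      obtain r where r: "r \<in> C" "r \<le> p" "r \<le> q" using chain[OF pq] pq by blast
      have "?u (x + y) \<le> r x + r y"
        using u_le[OF r(1), of "x + y"] sublinear_add[OF sub[OF r(1)], of x y] by simp
      then show ?thesis using r le_funD[OF r(2), of x] le_funD[OF r(3), of y] by linarith
    qed
    then have "?u (x + y) - p x \<le> ?u y" if "p \<in> C" for p
      using that by (intro u_ge) (simp add: diff_le_eq add.commute[of _ "p x"])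
    then have "?u (x + y) - ?u y \<le> ?u x" by (intro u_ge) (simp add: algebra_simps)
    then show ?thesis by simp
  qed
  moreover have "?u (t *\<^sub>R x) = t * ?u x" if t: "0 \<le> t" for t x
  proof (cases "t = 0")
    case True
    then show ?thesis using ne sub by (simp add: sublinear_zero)
  next
    case False
    then have t: "t > 0" using t by simp
    have eq: "p (t *\<^sub>R x) = t * p x" if "p \<in> C" for p
      using t by (intro sublinear_scale sub that) simp
    show ?thesis
    proof (rule antisym)
      have "?u (t *\<^sub>R x) / t \<le> ?u x"
        using u_le[of _ "t *\<^sub>R x"] eq t by (intro u_ge) (simp add: field_simps)
      then show "?u (t *\<^sub>R x) \<le> t * ?u x" using t by (simp add: field_simps)
      show "t * ?u x \<le> ?u (t *\<^sub>R x)"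
        using u_le[of _ x] t by (intro u_ge) (simp add: eq)
    qed
  qed
  moreover have "?u x \<le> norm x" for x
  proof -
    obtain p where "p \<in> C" using ne by blast
    then show ?thesis using u_le[of p x] sublinear_le_norm[OF sub, of p x] by linarith
  qed
  ultimately show ?thesis unfolding sublinear_def by blast
qed

text \<open>Zorn's lemma for the reversed pointwise order, whose maximal elements are the minimal
  functionals.\<close>

lemma minimal_sublinear_below:
  fixes p0 :: "'e::real_normed_vector \<Rightarrow> real"
  assumes p0: "sublinear p0"
  obtains p where "sublinear p" "p \<le> p0" "\<And>q. sublinear q \<Longrightarrow> q \<le> p \<Longrightarrow> q = p"
proof -
  define A where "A = {p. sublinear p \<and> p \<le> p0}"
  have "\<exists>m\<in>A. \<forall>a\<in>A. m \<ge> a \<longrightarrow> a = m"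
  proof (rule predicate_Zorn)
    show "partial_order_on A (relation_of (\<ge>) A)"
      by (rule partial_order_on_relation_ofI) auto
    fix C assume "C \<in> Chains (relation_of (\<ge>) A)"
    then have C: "C \<subseteq> A" "\<And>p q. p \<in> C \<Longrightarrow> q \<in> C \<Longrightarrow> p \<le> q \<or> q \<le> p"
      by (auto simp: Chains_def relation_of_def)
    show "\<exists>u\<in>A. \<forall>a\<in>C. a \<ge> u"
    \<comment> \<open>The infimum over an empty chain carries no information, so \<open>p0\<close>
      itself serves as its bound.\<close>
    proof (cases "C = {}")
      case True
      then show ?thesis using p0 unfolding A_def by auto
    next
      case False
      have sub: "sublinear p" if "p \<in> C" for p using C(1) that A_def by auto
      let ?u = "\<lambda>x. INF p\<in>C. p x"
      have le: "?u \<le> p" if "p \<in> C" for p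
        using that sublinear_ge_minus_norm[OF sub]
        by (intro le_funI cINF_lower bdd_belowI2[where m = "- norm _"]) auto
      have "sublinear ?u" using False sub C(2) by (rule sublinear_INF_chain)
      moreover have "?u \<le> p0" using False le C(1) unfolding A_def by fastforce
      ultimately show ?thesis using le unfolding A_def by blast
    qed
  qed
  then obtain m where m: "m \<in> A" "\<And>a. a \<in> A \<Longrightarrow> a \<le> m \<Longrightarrow> a = m" by blast
  show ?thesis
  proof (rule that)
    show "sublinear m" "m \<le> p0" using m(1) A_def by auto
    fix q assume "sublinear q" "q \<le> m"
    then show "q = m" using m A_def by auto
  qed
qed

text \<open>A minimal sublinear functional cannot be lowered by tilting it along \<open>y\<close>, so it is odd and
  hence linear.\<close>

lemma minimal_sublinear_bounded_linear:
  assumes p: "sublinear p" and min: "\<And>q. sublinear q \<Longrightarrow> q \<le> p \<Longrightarrow> q = p"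
  shows "bounded_linear p"
proof -
  have odd: "p (- y) = - p y" for y
  proof -
    obtain q where "sublinear q" "q \<le> p" "q (- y) \<le> - p y" using sublinear_tilt[OF p] .
    then have "p (- y) \<le> - p y" using min by metis
    then show ?thesis using sublinear_neg[OF p, of y] by simp
  qed
  show ?thesis
  proof (rule bounded_linear_intro)
    fix x y
    show "p (x + y) = p x + p y"
      using sublinear_add[OF p, of x y] sublinear_add[OF p, of "- x" "- y"]
        odd[of x] odd[of y] odd[of "x + y"] by simp
    fix r :: real
    show "p (r *\<^sub>R x) = r *\<^sub>R p x"
    proof (cases "0 \<le> r")
      case True
      then show ?thesis using sublinear_scale[OF p] by simp
    next
      case False
      then have "p (- r *\<^sub>R x) = - r * p x" by (intro sublinear_scale[OF p]) simp
      then show ?thesis using odd[of "r *\<^sub>R x"] by simp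
    qed
    show "norm (p x) \<le> norm x * 1"
      using sublinear_le_norm[OF p, of x] sublinear_ge_minus_norm[OF p, of x] by simp
  qed
qed

lemma sublinear_norm: "sublinear norm"
  by (simp add: sublinear_def norm_triangle_ineq)

text \<open>The norm is tilted along \<open>z = x - y\<close> before a minimal functional below it
  is taken. That functional is linear and at most \<open>- norm z\<close> at \<open>- z\<close>,
  whereas by assumption it takes equal values at \<open>x\<close> and \<open>y\<close>. This is the
  source of uniqueness for the operators defined by \<open>THE\<close>.\<close>

theorem dual_separates_points:
  fixes x y :: "'e::real_normed_vector"
  assumes "\<And>xs :: 'e \<Rightarrow>\<^sub>L real. xs x = xs y"
  shows "x = y"
proof (rule ccontr)
  assume "x \<noteq> y"
  define z where "z = x - y"
  obtain q where q: "sublinear q" "q (- z) \<le> - norm z"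
    using sublinear_tilt[OF sublinear_norm] .
  obtain p where p: "sublinear p" "p \<le> q" "\<And>q. sublinear q \<Longrightarrow> q \<le> p \<Longrightarrow> q = p"
    by (rule minimal_sublinear_below[OF q(1)]) blast
  have bl: "bounded_linear p" using p by (intro minimal_sublinear_bounded_linear)
  have "p (- z) \<le> - norm z" using q(2) le_funD[OF p(2), of "- z"] by simp
  moreover have "p (- z) = 0"
    using assms[of "Blinfun p"] bl
    by (simp add: bounded_linear_Blinfun_apply z_def linear_diff bounded_linear.linear)
  ultimately show False using \<open>x \<noteq> y\<close> z_def by simp
qed

subsection \<open>The ranges of the operators attached to a Hilbert space operator\<close>

lemma bounded_linear_adjoint_square:
  fixes R :: "'k::{real_inner,complete_space} \<Rightarrow>\<^sub>L 'e::banach"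
  shows "bounded_linear (\<lambda>xs. R (riesz_adjoint R xs))"
proof (rule bounded_linear_intro)
  interpret linear "riesz_adjoint R" by (rule linear_riesz_adjoint)
  show "R (riesz_adjoint R (xs + ys)) = R (riesz_adjoint R xs) + R (riesz_adjoint R ys)" for xs ys
    by (simp add: add blinfun.add_right)
  show "R (riesz_adjoint R (r *\<^sub>R xs)) = r *\<^sub>R R (riesz_adjoint R xs)" for r xs
    by (simp add: scale blinfun.scaleR_right)
  show "norm (R (riesz_adjoint R xs)) \<le> norm xs * (norm R * norm R)" for xs
  proof -
    have "norm (R (riesz_adjoint R xs)) \<le> norm R * norm (riesz_adjoint R xs)" by (rule norm_blinfun)
    also have "\<dots> \<le> norm R * (norm xs * norm R)"
      by (intro mult_left_mono norm_riesz_adjoint_le) simp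
    finally show ?thesis by (simp add: ac_simps)
  qed
qed

text \<open>The RKHS inner product of \<open>Q ys\<close> with itself is the squared norm of
  \<open>riesz_adjoint R ys\<close>. Hence the RKHS is a copy of the closure of the range of the
  adjoint, mapped into \<open>E\<close> by \<open>R\<close>; the orthogonal complement of that
  closure is the kernel of \<open>R\<close>, so nothing of the range is lost.\<close>

lemma rkhs_adjoint_square:
  fixes R :: "'k::{real_inner,complete_space} \<Rightarrow>\<^sub>L 'e::banach"
    and Q :: "('e \<Rightarrow>\<^sub>L real) \<Rightarrow>\<^sub>L 'e"
  assumes Q: "\<And>xs. Q xs = R (riesz_adjoint R xs)"
  shows "rkhs Q = range R"
proof -
  interpret adj: linear "riesz_adjoint R" by (rule linear_riesz_adjoint)
  have norm_eq: "sqrt (blinfun_apply (ys - zs) (Q (ys - zs)))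
      = dist (riesz_adjoint R ys) (riesz_adjoint R zs)" for ys zs
    by (simp only: Q flip: riesz_adjoint_inner) (simp add: adj.diff dist_norm norm_eq_sqrt_inner)
  show ?thesis
  proof (intro set_eqI iffI)
    fix g assume "g \<in> rkhs Q"
    then obtain ys where ys: "Cauchy (\<lambda>n. riesz_adjoint R (ys n))" "(\<lambda>n. Q (ys n)) \<longlonglongrightarrow> g"
      unfolding rkhs_def norm_eq Cauchy_def by blast
    obtain h where "(\<lambda>n. riesz_adjoint R (ys n)) \<longlonglongrightarrow> h"
      using ys(1) Cauchy_convergent convergent_def by blast
    then have "(\<lambda>n. Q (ys n)) \<longlonglongrightarrow> R h" unfolding Q by (intro tendsto_intros)
    then have "g = R h" using ys(2) LIMSEQ_unique by blast
    then show "g \<in> range R" by simp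
  next
    fix g assume "g \<in> range R"
    then obtain h where h: "g = R h" by blast
    \<comment> \<open>Applying Riesz to the functional \<open>h \<bullet> _\<close> on the range of
      the adjoint yields the orthogonal projection \<open>k\<close> of \<open>h\<close> onto its
      closure, together with a sequence in the range that tends to \<open>k\<close>.\<close>
    obtain s k where s: "\<And>n. s n \<in> range (riesz_adjoint R)" and k: "s \<longlonglongrightarrow> k"
      and kh: "\<And>l. l \<in> range (riesz_adjoint R) \<Longrightarrow> k \<bullet> l = h \<bullet> l"
    proof (rule riesz_subspace[of "range (riesz_adjoint R)" "\<lambda>l. h \<bullet> l" "norm h"])
      show "subspace (range (riesz_adjoint R))"
        using adj.linear_axioms by (intro linear_subspace_image) auto
      show "\<bar>h \<bullet> x\<bar> \<le> norm h * norm x" for x by (rule Cauchy_Schwarz_ineq2)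
    qed (auto simp: inner_simps)
    have "\<forall>n. \<exists>ys. s n = riesz_adjoint R ys" using s by blast
    then obtain ys where ys: "\<And>n. s n = riesz_adjoint R (ys n)" by metis
    have "blinfun_apply xs (R k) = blinfun_apply xs (R h)" for xs :: "'e \<Rightarrow>\<^sub>L real"
      using kh[of "riesz_adjoint R xs"] by (simp add: inner_riesz_adjoint)
    then have "R k = R h" by (rule dual_separates_points)
    then have "(\<lambda>n. Q (ys n)) \<longlonglongrightarrow> g"
      using blinfun.tendsto[OF tendsto_const k, of R] unfolding Q ys h by simp
    moreover have "Cauchy (\<lambda>n. riesz_adjoint R (ys n))"
      using k LIMSEQ_imp_Cauchy unfolding ys by blast
    ultimately show "g \<in> rkhs Q"
      unfolding rkhs_def norm_eq Cauchy_def by blast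
  qed
qed

text \<open>The bound makes \<open>riesz_adjoint R xs\<close> to \<open>xs a\<close> a well-defined
  bounded functional on the range of the adjoint. Its Riesz representer \<open>k\<close> satisfies
  \<open>R k = a\<close>, because every functional agrees on both sides.\<close>

lemma mem_range_if_adjoint_bounded:
  fixes R :: "'k::{real_inner,complete_space} \<Rightarrow>\<^sub>L 'e::banach"
  assumes bound: "\<And>xs. \<bar>blinfun_apply xs a\<bar> \<le> C * norm (riesz_adjoint R xs)"
  shows "a \<in> range R"
proof -
  interpret adj: linear "riesz_adjoint R" by (rule linear_riesz_adjoint)
  \<comment> \<open>The chosen preimage does not matter: two preimages differ by some
    \<open>xs\<close> with zero adjoint, and the bound then forces \<open>xs a = 0\<close>.\<close>
  define f where "f l = blinfun_apply (SOME xs. riesz_adjoint R xs = l) a" for l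
  have f: "f (riesz_adjoint R xs) = blinfun_apply xs a" for xs
  proof -
    let ?ys = "SOME ys. riesz_adjoint R ys = riesz_adjoint R xs"
    have "riesz_adjoint R ?ys = riesz_adjoint R xs" by (rule someI[of _ xs]) simp
    then have "\<bar>blinfun_apply (?ys - xs) a\<bar> \<le> C * 0"
      using bound[of "?ys - xs"] by (simp add: adj.diff)
    then show ?thesis unfolding f_def by (simp add: blinfun.diff_left)
  qed
  obtain s k where "\<And>n. s n \<in> range (riesz_adjoint R)" "s \<longlonglongrightarrow> k"
    and k: "\<And>l. l \<in> range (riesz_adjoint R) \<Longrightarrow> k \<bullet> l = f l"
  proof (rule riesz_subspace[of "range (riesz_adjoint R)" f C])
    show "subspace (range (riesz_adjoint R))"
      using adj.linear_axioms by (intro linear_subspace_image) auto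
    show "\<bar>f x\<bar> \<le> C * norm x" if "x \<in> range (riesz_adjoint R)" for x
      using that bound f by auto
    show "f (x + y) = f x + f y"
      if "x \<in> range (riesz_adjoint R)" "y \<in> range (riesz_adjoint R)" for x y
      using that f by (auto simp: blinfun.add_left simp flip: adj.add)
    show "f (c *\<^sub>R x) = c * f x" if "x \<in> range (riesz_adjoint R)" for c x
      using that f by (auto simp: blinfun.scaleR_left simp flip: adj.scale)
  qed blast
  have "blinfun_apply xs (R k) = blinfun_apply xs a" for xs :: "'e \<Rightarrow>\<^sub>L real"
    using k[of "riesz_adjoint R xs"] f[of xs] by (simp add: inner_riesz_adjoint)
  then have "R k = a" by (rule dual_separates_points)
  then show ?thesis by blast
qed

text \<open>Under the Riesz identification of the dual of \<open>'k\<close> with \<open>'k\<close>,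
  the control operator becomes \<open>R\<close> itself. The identification is onto, since
  \<open>blinfun_inner_right k\<close> is represented by \<open>k\<close>, so the ranges
  agree.\<close>

lemma range_control_operator:
  fixes R :: "'k::{real_inner,complete_space} \<Rightarrow>\<^sub>L 'e::banach"
  assumes orbit: "\<And>xs. riesz_adjoint R xs = orbit T j \<Phi> xs"
  shows "range (control_operator T j \<Phi>) = range R"
proof -
  obtain riesz :: "('k \<Rightarrow>\<^sub>L real) \<Rightarrow> 'k" where riesz: "\<And>f g. riesz f \<bullet> g = blinfun_apply f g"
  proof -
    have "\<exists>k. \<forall>g. k \<bullet> g = blinfun_apply f g" for f :: "'k \<Rightarrow>\<^sub>L real"
      by (rule riesz_representation[of f]) blast
    then show thesis using that by metis
  qed
  have riesz_eqI: "riesz f = k" if "\<And>g. k \<bullet> g = blinfun_apply f g" for f k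
    using riesz that by (metis vector_eq_rdot)
  have norm_riesz: "norm (riesz f) \<le> norm f" for f
  proof -
    have "norm (riesz f) * norm (riesz f) = f (riesz f)"
      by (simp add: power2_norm_eq_inner riesz flip: power2_eq_square)
    also have "\<dots> \<le> norm f * norm (riesz f)" using norm_blinfun[of f "riesz f"] by simp
    finally show ?thesis by (cases "riesz f = 0") auto
  qed
  have bl: "bounded_linear (\<lambda>f. R (riesz f))"
  proof (rule bounded_linear_intro)
    fix f g :: "'k \<Rightarrow>\<^sub>L real" and r :: real
    have "riesz (f + g) = riesz f + riesz g"
      by (intro riesz_eqI) (simp add: inner_simps riesz blinfun.add_left)
    then show "R (riesz (f + g)) = R (riesz f) + R (riesz g)" by (simp add: blinfun.add_right)
    have "riesz (r *\<^sub>R f) = r *\<^sub>R riesz f"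
      by (intro riesz_eqI) (simp add: inner_simps riesz blinfun.scaleR_left)
    then show "R (riesz (r *\<^sub>R f)) = r *\<^sub>R R (riesz f)" by (simp add: blinfun.scaleR_right)
    have "norm (R (riesz f)) \<le> norm R * norm (riesz f)" by (rule norm_blinfun)
    also have "\<dots> \<le> norm f * norm R"
      using norm_riesz[of f] by (simp add: mult.commute mult_left_mono)
    finally show "norm (R (riesz f)) \<le> norm f * norm R" .
  qed
  have C: "control_operator T j \<Phi> = Blinfun (\<lambda>f. R (riesz f))"
    unfolding control_operator_def
  proof (rule the_equality)
    show *: "\<forall>f xs. blinfun_apply xs (Blinfun (\<lambda>f. R (riesz f)) f) = blinfun_apply f (orbit T j \<Phi> xs)"
      by (simp add: bounded_linear_Blinfun_apply[OF bl] inner_riesz_adjoint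
          flip: orbit riesz)
    fix C :: "('k \<Rightarrow>\<^sub>L real) \<Rightarrow>\<^sub>L 'e"
    assume "\<forall>f xs. blinfun_apply xs (C f) = blinfun_apply f (orbit T j \<Phi> xs)"
    then have "blinfun_apply xs (C f) = blinfun_apply xs (Blinfun (\<lambda>f. R (riesz f)) f)" for xs :: "'e \<Rightarrow>\<^sub>L real" and f
      using * by simp
    then have "C f = Blinfun (\<lambda>f. R (riesz f)) f" for f by (rule dual_separates_points)
    then show "C = Blinfun (\<lambda>f. R (riesz f))" by (rule blinfun_eqI)
  qed
  have "riesz (blinfun_inner_right k) = k" for k
    by (rule riesz_eqI) (simp add: blinfun_inner_right.rep_eq)
  then have "surj riesz" by (rule surjI)
  moreover have "blinfun_apply (control_operator T j \<Phi>) = blinfun_apply R \<circ> riesz"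
    unfolding C by (simp add: bounded_linear_Blinfun_apply[OF bl] fun_eq_iff)
  ultimately show ?thesis by (metis image_comp)
qed

text \<open>All representing operators share the adjoint given by the orbits, and an operator is
  determined by its adjoint because functionals separate points.\<close>

lemma the_represents:
  fixes R :: "'k::{real_inner,complete_space} \<Rightarrow>\<^sub>L 'e::banach"
  assumes R: "represents T j \<Phi> R"
  shows "(THE R. represents T j \<Phi> R) = R"
proof (rule the_equality)
  show "represents T j \<Phi> R" by (rule R)
  fix R' assume "represents T j \<Phi> R'"
  then have "riesz_adjoint R' xs = riesz_adjoint R xs" for xs
    using R unfolding represents_def by simp
  then have "blinfun_apply xs (blinfun_apply R' g) = blinfun_apply xs (blinfun_apply R g)"
    for xs :: "'e \<Rightarrow>\<^sub>L real" and g
    by (metis inner_riesz_adjoint)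
  then have "R' g = R g" for g by (rule dual_separates_points)
  then show "R' = R" by (rule blinfun_eqI)
qed

subsection \<open>Finite-dimensional distributions of an isonormal process\<close>

text \<open>The phase \<open>s\<close> lets real integrals carry the whole characteristic function:
  \<open>s = 0\<close> returns its real part and \<open>s = pi / 2\<close> its imaginary
  part.\<close>

lemma integral_cos_distribution:
  assumes "real_distribution \<mu>"
  shows "(\<integral>x. cos (t * x - s) \<partial>\<mu>) = Re (char \<mu> t) * cos s + Im (char \<mu> t) * sin s"
proof -
  interpret real_distribution \<mu> by fact
  have int: "integrable \<mu> (\<lambda>x. iexp (t * x))" by (rule integrable_iexp) auto
  have ReIm: "Re (iexp y) = cos y" "Im (iexp y) = sin y" for y
    by (simp_all add: Re_exp Im_exp)
  have "Re (char \<mu> t) = (\<integral>x. cos (t * x) \<partial>\<mu>)" "Im (char \<mu> t) = (\<integral>x. sin (t * x) \<partial>\<mu>)"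
    unfolding char_def using integral_Re[OF int] integral_Im[OF int] by (simp_all only: ReIm)
  moreover have "integrable \<mu> (\<lambda>x. cos (t * x))" "integrable \<mu> (\<lambda>x. sin (t * x))"
    using integrable_Re[OF int] integrable_Im[OF int] by (simp_all only: ReIm)
  ultimately show ?thesis by (simp add: cos_diff)
qed

lemma char_eqI_cos:
  assumes \<mu>: "real_distribution \<mu>" and cos: "\<And>s. (\<integral>x. cos (t * x - s) \<partial>\<mu>) = cos s * c"
  shows "char \<mu> t = complex_of_real c"
proof (rule complex_eqI)
  show "Re (char \<mu> t) = Re (complex_of_real c)"
    using cos[of 0] integral_cos_distribution[OF \<mu>, of t 0] by simp
  show "Im (char \<mu> t) = Im (complex_of_real c)"
    using cos[of "pi / 2"] integral_cos_distribution[OF \<mu>, of t "pi / 2"] by simp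
qed

text \<open>A positive weight is turned into a probability density, to which Levy's uniqueness theorem
  applies.\<close>

lemma (in prob_space) weighted_normalI:
  fixes u Y :: "'a \<Rightarrow> real"
  assumes [measurable]: "u \<in> borel_measurable M" "Y \<in> borel_measurable M" "A \<in> sets borel"
    and nonneg: "\<And>x. 0 \<le> u x" and u: "integrable M u"
    and cos: "\<And>t s. (\<integral>x. u x * cos (t * Y x - s) \<partial>M) = C * (cos s * exp (- t\<^sup>2 / 2))"
  shows "(\<integral>x. u x * indicator A (Y x) \<partial>M) = C * measure std_normal_distribution A"
proof -
  \<comment> \<open>At \<open>t = s = 0\<close> the cosine hypothesis says that \<open>C\<close> is
    the total mass of the weight.\<close>
  have C: "(\<integral>x. u x \<partial>M) = C" using cos[of 0 0] by simp
  show ?thesis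
  proof (cases "C = 0")
    case True
    then have "AE x in M. u x = 0"
      using C u nonneg by (simp add: integral_nonneg_eq_0_iff_AE)
    then have "(\<integral>x. u x * indicator A (Y x) \<partial>M) = (\<integral>x. 0 \<partial>M)"
      by (intro integral_cong_AE) auto
    then show ?thesis using True by simp
  next
    case False
    then have "C > 0" using C nonneg by (metis integral_nonneg_AE AE_I2 order_le_less)
    define P where "P = density M (\<lambda>x. ennreal (u x / C))"
    have "prob_space P"
    proof (rule prob_spaceI)
      have "emeasure P (space P) = (\<integral>\<^sup>+x. ennreal (u x / C) \<partial>M)"
        unfolding P_def by (simp add: emeasure_density cong: nn_integral_cong)
      also have "\<dots> = ennreal (\<integral>x. u x / C \<partial>M)"
        using u nonneg \<open>C > 0\<close> by (intro nn_integral_eq_integral) auto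
      finally show "emeasure P (space P) = 1" using C \<open>C > 0\<close> by simp
    qed
    then interpret P: prob_space P .
    have [measurable]: "Y \<in> borel_measurable P" unfolding P_def by simp
    have int: "(\<integral>x. f (Y x) \<partial>P) = (\<integral>x. u x * f (Y x) \<partial>M) / C"
      if [measurable]: "f \<in> borel_measurable borel" for f :: "real \<Rightarrow> real"
      unfolding P_def using nonneg \<open>C > 0\<close>
      by (subst integral_density) (auto simp: less_imp_le)
    have rd: "real_distribution (distr P borel Y)" by simp
    have "char (distr P borel Y) = char std_normal_distribution"
    proof
      fix t
      have "char (distr P borel Y) t = complex_of_real (exp (- t\<^sup>2 / 2))"
      proof (rule char_eqI_cos[OF rd])
        fix s
        have "(\<integral>x. cos (t * x - s) \<partial>distr P borel Y) = (\<integral>x. cos (t * Y x - s) \<partial>P)"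
          by (rule integral_distr) auto
        also have "\<dots> = (\<integral>x. u x * cos (t * Y x - s) \<partial>M) / C"
          by (rule int) auto
        finally show "(\<integral>x. cos (t * x - s) \<partial>distr P borel Y) = cos s * exp (- t\<^sup>2 / 2)"
          using cos \<open>C > 0\<close> by simp
      qed
      then show "char (distr P borel Y) t = char std_normal_distribution t"
        by (simp add: char_std_normal_distribution)
    qed
    then have D: "distr P borel Y = std_normal_distribution"
      using rd real_dist_normal_dist Levy_uniqueness by blast
    have "measure std_normal_distribution A = (\<integral>x. indicator A x \<partial>distr P borel Y)"
      unfolding D by simp
    also have "\<dots> = (\<integral>x. indicator A (Y x) \<partial>P)" by (rule integral_distr) auto
    also have "\<dots> = (\<integral>x. u x * indicator A (Y x) \<partial>M) / C" by (rule int) auto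
    finally show ?thesis using \<open>C > 0\<close> by (simp add: field_simps)
  qed
qed

lemma restrict_vimage_PiE: "(\<lambda>\<omega>. \<lambda>n\<in>I. f n \<omega>) -` Pi\<^sub>E I A \<inter> S = {\<omega> \<in> S. \<forall>n\<in>I. f n \<omega> \<in> A n}"
  by (auto simp: PiE_iff)

locale isonormal = prob_space M for M :: "'w measure" +
  fixes W :: "'k::{real_inner,complete_space} \<Rightarrow> 'w \<Rightarrow> real"
  assumes isonormal: "isonormal_process M W"
begin

lemma W_measurable [measurable]: "W h \<in> borel_measurable M"
  using isonormal by (simp add: isonormal_process_def centred_gaussian_def)

lemma W_linear: "AE \<omega> in M. W (a *\<^sub>R h + b *\<^sub>R k) \<omega> = a * W h \<omega> + b * W k \<omega>"
  using isonormal by (simp add: isonormal_process_def)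

lemma W_inner: "(\<integral>\<omega>. W h \<omega> * W k \<omega> \<partial>M) = h \<bullet> k"
  using isonormal by (simp add: isonormal_process_def)

lemma W_scale: "AE \<omega> in M. W (a *\<^sub>R h) \<omega> = a * W h \<omega>"
  using W_linear[of a h 0 h] by simp

lemma W_diff: "AE \<omega> in M. W (h - k) \<omega> = W h \<omega> - W k \<omega>"
  using W_linear[of 1 h "- 1" k] by simp

lemma W_sum: "AE \<omega> in M. W (\<Sum>n<N. c n *\<^sub>R h n) \<omega> = (\<Sum>n<N. c n * W (h n) \<omega>)" for N :: nat
proof (induction N)
  case 0
  then show ?case using W_scale[of 0 0] by simp
next
  case (Suc N)
  have "AE \<omega> in M. W (1 *\<^sub>R (\<Sum>n<N. c n *\<^sub>R h n) + c N *\<^sub>R h N) \<omega> =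
      1 * W (\<Sum>n<N. c n *\<^sub>R h n) \<omega> + c N * W (h N) \<omega>"
    by (rule W_linear)
  with Suc show ?case by eventually_elim simp
qed

text \<open>Gaussianity leaves the variance open and admits the Dirac law; the isometry property
  forces the second moment to be 1, which excludes the Dirac law and fixes
  \<open>\<sigma> = 1\<close>.\<close>

lemma distr_W_unit:
  assumes "norm h = 1"
  shows "distr M borel (W h) = std_normal_distribution"
proof -
  have var: "(\<integral>x. x\<^sup>2 \<partial>distr M borel (W h)) = 1"
    using W_inner[of h h] assms
    by (simp add: integral_distr power2_eq_square flip: power2_norm_eq_inner)
  consider "distr M borel (W h) = return borel 0"
    | \<sigma> where "\<sigma> > 0" "distr M borel (W h) = density lborel (\<lambda>x. ennreal (normal_density 0 \<sigma> x))"
    using isonormal unfolding isonormal_process_def centred_gaussian_def by blast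
  then show ?thesis
  proof cases
    case 1
    then show ?thesis using var by (simp add: integral_return)
  next
    case 2
    have "(\<integral>x. x\<^sup>2 \<partial>distr M borel (W h)) = (\<integral>x. normal_density 0 \<sigma> x * x\<^sup>2 \<partial>lborel)"
      unfolding 2(2) by (subst integral_density) auto
    also have "\<dots> = \<sigma>\<^sup>2"
      using has_bochner_integral_integral_eq[OF normal_moment_even[OF 2(1), of 0 1]]
      by (simp add: fact_numeral)
    finally have "\<sigma> = 1" using var 2(1) by (simp add: power2_eq_1_iff)
    then show ?thesis using 2(2) by simp
  qed
qed

lemma W_eq_unit:
  assumes "h \<noteq> 0"
  shows "AE \<omega> in M. W h \<omega> = norm h * W (h /\<^sub>R norm h) \<omega>"
  using W_scale[of "norm h" "h /\<^sub>R norm h"] assms by simp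

lemma W_square_integrable: "integrable M (\<lambda>\<omega>. (W h \<omega>)\<^sup>2)"
proof (cases "h = 0")
  case True
  have "AE \<omega> in M. W 0 \<omega> = 0" using W_scale[of 0 0] by simp
  then have "integrable M (\<lambda>\<omega>. (W 0 \<omega>)\<^sup>2) = integrable M (\<lambda>\<omega>. 0::real)"
    by (intro integrable_cong_AE) auto
  then show ?thesis using True by simp
next
  case False
  let ?u = "h /\<^sub>R norm h"
  have "integrable (distr M borel (W ?u)) (\<lambda>x. x ^ 2)"
    using False by (subst distr_W_unit) (auto intro: integrable_std_normal_distribution_moment)
  then have "integrable M (\<lambda>\<omega>. (W ?u \<omega>)\<^sup>2)" by (subst (asm) integrable_distr_eq) auto
  then have "integrable M (\<lambda>\<omega>. (norm h)\<^sup>2 * (W ?u \<omega>)\<^sup>2)" by simp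
  moreover have "AE \<omega> in M. (norm h)\<^sup>2 * (W ?u \<omega>)\<^sup>2 = (W h \<omega>)\<^sup>2"
    using W_eq_unit[OF False] by eventually_elim (simp add: power_mult_distrib)
  ultimately show ?thesis by (subst (asm) integrable_cong_AE) auto
qed

lemma W_square: "(\<integral>\<omega>. (W h \<omega>)\<^sup>2 \<partial>M) = (norm h)\<^sup>2"
  using W_inner[of h h] by (simp add: power2_eq_square flip: power2_norm_eq_inner)

lemma W_cos: "(\<integral>\<omega>. cos (W k \<omega> - s) \<partial>M) = cos s * exp (- (norm k)\<^sup>2 / 2)"
proof (cases "k = 0")
  case True
  have "AE \<omega> in M. W 0 \<omega> = 0" using W_scale[of 0 0] by simp
  then have "(\<integral>\<omega>. cos (W 0 \<omega> - s) \<partial>M) = (\<integral>\<omega>. cos s \<partial>M)"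
    by (intro integral_cong_AE) auto
  then show ?thesis using True by (simp add: prob_space)
next
  case False
  let ?u = "k /\<^sub>R norm k"
  have "(\<integral>\<omega>. cos (W k \<omega> - s) \<partial>M) = (\<integral>\<omega>. cos (norm k * W ?u \<omega> - s) \<partial>M)"
    using W_eq_unit[OF False] by (intro integral_cong_AE) auto
  also have "\<dots> = (\<integral>x. cos (norm k * x - s) \<partial>distr M borel (W ?u))"
    by (rule integral_distr[symmetric]) auto
  also have "\<dots> = (\<integral>x. cos (norm k * x - s) \<partial>std_normal_distribution)"
    using False by (subst distr_W_unit) auto
  also have "\<dots> = cos s * exp (- (norm k)\<^sup>2 / 2)"
    by (simp add: integral_cos_distribution[OF real_dist_normal_dist] char_std_normal_distribution)
  finally show ?thesis .
qed

text \<open>The events \<open>W (e n) \<in> A n\<close> are split off one at a time, keeping track of the characteristic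
  function in the directions orthogonal to the \<open>e n\<close> already treated.\<close>

lemma orthonormal_indep:
  fixes e :: "nat \<Rightarrow> 'k"
  assumes e: "orthonormal_upto N e" and "m \<le> N"
    and [measurable]: "\<And>n. A n \<in> sets borel" and "\<And>n. n < m \<Longrightarrow> k \<bullet> e n = 0"
  shows "(\<integral>\<omega>. (\<Prod>n<m. indicator (A n) (W (e n) \<omega>)) * cos (W k \<omega> - s) \<partial>M) =
    (\<Prod>n<m. measure std_normal_distribution (A n)) * (cos s * exp (- (norm k)\<^sup>2 / 2))"
  using \<open>m \<le> N\<close> assms(4)
proof (induction m arbitrary: k s)
  case 0
  then show ?case by (simp add: W_cos)
next
  case (Suc m)
  define v where "v \<omega> = (\<Prod>n<m. indicator (A n) (W (e n) \<omega>) :: real)" for \<omega>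
  define c where "c = (\<Prod>n<m. measure std_normal_distribution (A n))"
  have v01: "0 \<le> v \<omega>" "v \<omega> \<le> 1" for \<omega>
    unfolding v_def by (auto intro!: prod_nonneg prod_le_1)
  have [measurable]: "v \<in> borel_measurable M" unfolding v_def by measurable
  have int_v: "integrable M (\<lambda>\<omega>. v \<omega> * g \<omega>)" if [measurable]: "g \<in> borel_measurable M" and "\<And>\<omega>. \<bar>g \<omega>\<bar> \<le> 2" for g
  proof (rule integrable_const_bound[where B = 2])
    show "AE \<omega> in M. norm (v \<omega> * g \<omega>) \<le> 2"
    proof (intro AE_I2)
      fix \<omega>
      have "\<bar>v \<omega>\<bar> * \<bar>g \<omega>\<bar> \<le> 1 * 2" using v01[of \<omega>] that(2)[of \<omega>] by (intro mult_mono) auto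
      then show "norm (v \<omega> * g \<omega>) \<le> 2" by (simp add: abs_mult)
    qed
  qed auto
  have em: "e m \<bullet> e m = 1" "\<And>n. n < m \<Longrightarrow> e m \<bullet> e n = 0"
    using e Suc.prems unfolding orthonormal_upto_def by auto
  have IH: "(\<integral>\<omega>. v \<omega> * cos (W l \<omega> - r) \<partial>M) = c * (cos r * exp (- (norm l)\<^sup>2 / 2))"
    if "\<And>n. n < m \<Longrightarrow> l \<bullet> e n = 0" for l r
    using Suc.IH[of l r] Suc.prems that unfolding v_def c_def by simp
  \<comment> \<open>A cosine changes sign and cannot serve as a weight in
    \<open>weighted_normalI\<close>, but \<open>1 + cos\<close> can. The contribution of the
    constant 1 is removed afterwards by means of \<open>one\<close>.\<close>
  have split: "(\<integral>\<omega>. (v \<omega> * (1 + cos (W l \<omega> - r))) * indicator (A m) (W (e m) \<omega>) \<partial>M)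
      = (c * (1 + cos r * exp (- (norm l)\<^sup>2 / 2))) * measure std_normal_distribution (A m)"
    if l: "\<And>n. n < Suc m \<Longrightarrow> l \<bullet> e n = 0" for l r
  proof (rule weighted_normalI)
    have "\<bar>1 + cos x\<bar> \<le> 2" for x :: real
      using abs_cos_le_one[of x] by linarith
    then show "integrable M (\<lambda>\<omega>. v \<omega> * (1 + cos (W l \<omega> - r)))" by (intro int_v) auto
    show "0 \<le> v \<omega> * (1 + cos (W l \<omega> - r))" for \<omega>
    proof -
      have "0 \<le> 1 + cos (W l \<omega> - r)" using cos_ge_minus_one[of "W l \<omega> - r"] by linarith
      then show ?thesis using v01[of \<omega>] by simp
    qed
    fix t q
    have lm: "l \<bullet> e m = 0" using l[of m] by simp
    have n1: "(norm (t *\<^sub>R e m))\<^sup>2 = t\<^sup>2"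
      using em by (simp add: power_mult_distrib power2_norm_eq_inner)
    have n2: "(norm (1 *\<^sub>R l + t' *\<^sub>R e m))\<^sup>2 = (norm l)\<^sup>2 + t\<^sup>2" if "t'\<^sup>2 = t\<^sup>2" for t'
    proof -
      have "(norm (1 *\<^sub>R l + t' *\<^sub>R e m))\<^sup>2 = (l + t' *\<^sub>R e m) \<bullet> (l + t' *\<^sub>R e m)"
        by (simp add: power2_norm_eq_inner)
      also have "\<dots> = l \<bullet> l + t'\<^sup>2"
        using em(1) lm by (simp add: inner_simps inner_commute[of "e m" l] power2_eq_square)
      finally show ?thesis using that by (simp add: power2_norm_eq_inner)
    qed
    have "AE \<omega> in M. (v \<omega> * (1 + cos (W l \<omega> - r))) * cos (t * W (e m) \<omega> - q) =
        v \<omega> * cos (W (t *\<^sub>R e m) \<omega> - q)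
        + (v \<omega> * cos (W (1 *\<^sub>R l + t *\<^sub>R e m) \<omega> - (r + q))
          + v \<omega> * cos (W (1 *\<^sub>R l + (- t) *\<^sub>R e m) \<omega> - (r - q))) / 2"
      using W_scale[of t "e m"] W_linear[of 1 l t "e m"] W_linear[of 1 l "- t" "e m"]
    proof eventually_elim
      case (elim \<omega>)
      \<comment> \<open>The product formula turns the two cosines into cosines of \<open>W\<close>
        at \<open>l + t e m\<close> and \<open>l - t e m\<close>. Both vectors are still orthogonal
        to the earlier \<open>e n\<close>, so the induction hypothesis applies, and both have
        squared norm \<open>(norm l)^2 + t^2\<close>, so the exponentials factor.\<close>
      have "cos a * cos b = (cos (a + b) + cos (a - b)) / 2" for a b :: real
        by (simp add: cos_add cos_diff)
      from this[of "W l \<omega> - r" "t * W (e m) \<omega> - q"] show ?case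
        unfolding elim by (simp add: algebra_simps)
    qed
    then have "(\<integral>\<omega>. (v \<omega> * (1 + cos (W l \<omega> - r))) * cos (t * W (e m) \<omega> - q) \<partial>M) =
        (\<integral>\<omega>. v \<omega> * cos (W (t *\<^sub>R e m) \<omega> - q)
          + (v \<omega> * cos (W (1 *\<^sub>R l + t *\<^sub>R e m) \<omega> - (r + q))
            + v \<omega> * cos (W (1 *\<^sub>R l + (- t) *\<^sub>R e m) \<omega> - (r - q))) / 2 \<partial>M)"
      by (intro integral_cong_AE) auto
    also have "\<dots> = (\<integral>\<omega>. v \<omega> * cos (W (t *\<^sub>R e m) \<omega> - q) \<partial>M)
        + ((\<integral>\<omega>. v \<omega> * cos (W (1 *\<^sub>R l + t *\<^sub>R e m) \<omega> - (r + q)) \<partial>M)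
          + (\<integral>\<omega>. v \<omega> * cos (W (1 *\<^sub>R l + (- t) *\<^sub>R e m) \<omega> - (r - q)) \<partial>M)) / 2"
    proof -
      have i: "integrable M (\<lambda>\<omega>. v \<omega> * cos (W l' \<omega> - r'))" for l' r'
      proof (rule int_v)
        show "\<bar>cos (W l' \<omega> - r')\<bar> \<le> 2" for \<omega>
          using abs_cos_le_one[of "W l' \<omega> - r'"] by linarith
      qed auto
      show ?thesis using i by simp
    qed
    also have "\<dots> = c * (cos q * exp (- t\<^sup>2 / 2))
        + (c * (cos (r + q) * exp (- ((norm l)\<^sup>2 + t\<^sup>2) / 2))
          + c * (cos (r - q) * exp (- ((norm l)\<^sup>2 + t\<^sup>2) / 2))) / 2"
    proof -
      have "(t *\<^sub>R e m) \<bullet> e n = 0" "(1 *\<^sub>R l + t' *\<^sub>R e m) \<bullet> e n = 0" if "n < m" for n t'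
        using that em(2) l[of n] by (simp_all add: inner_simps)
      then show ?thesis by (simp only: IH n1 n2 power2_minus)
    qed
    also have "\<dots> = (c * (1 + cos r * exp (- (norm l)\<^sup>2 / 2))) * (cos q * exp (- t\<^sup>2 / 2))"
    proof -
      have "exp (- ((norm l)\<^sup>2 + t\<^sup>2) / 2) = exp (- (norm l)\<^sup>2 / 2) * exp (- t\<^sup>2 / 2)"
        by (simp add: field_simps flip: exp_add)
      then show ?thesis by (simp only: cos_add cos_diff) (simp add: algebra_simps)
    qed
    finally show "(\<integral>\<omega>. (v \<omega> * (1 + cos (W l \<omega> - r))) * cos (t * W (e m) \<omega> - q) \<partial>M) =
      (c * (1 + cos r * exp (- (norm l)\<^sup>2 / 2))) * (cos q * exp (- t\<^sup>2 / 2))" .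
  qed auto
  let ?I = "\<lambda>\<omega>. indicator (A m) (W (e m) \<omega>) :: real"
  have one: "(\<integral>\<omega>. v \<omega> * ?I \<omega> \<partial>M) = c * measure std_normal_distribution (A m)"
  proof -
    have "AE \<omega> in M. W 0 \<omega> = 0" using W_scale[of 0 0] by simp
    \<comment> \<open>With \<open>l = 0\<close> and phase \<open>pi / 2\<close> the cosine vanishes
      and the weight \<open>1 + cos\<close> reduces to 1.\<close>
    then have "(\<integral>\<omega>. (v \<omega> * (1 + cos (W 0 \<omega> - pi / 2))) * ?I \<omega> \<partial>M) = (\<integral>\<omega>. v \<omega> * ?I \<omega> \<partial>M)"
      by (intro integral_cong_AE) auto
    then show ?thesis using split[of 0 "pi / 2"] by simp
  qed
  have "(\<integral>\<omega>. (v \<omega> * (1 + cos (W k \<omega> - s))) * ?I \<omega> \<partial>M) =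
      (\<integral>\<omega>. v \<omega> * ?I \<omega> + v \<omega> * (?I \<omega> * cos (W k \<omega> - s)) \<partial>M)"
    by (simp add: algebra_simps)
  also have "\<dots> = (\<integral>\<omega>. v \<omega> * ?I \<omega> \<partial>M) + (\<integral>\<omega>. v \<omega> * (?I \<omega> * cos (W k \<omega> - s)) \<partial>M)"
  proof (intro Bochner_Integration.integral_add int_v)
    show "\<bar>?I \<omega> * cos (W k \<omega> - s)\<bar> \<le> 2" for \<omega>
      using abs_cos_le_one[of "W k \<omega> - s"] by (simp add: indicator_def del: abs_cos_le_one)
  qed (auto simp: indicator_def)
  finally have "(\<integral>\<omega>. v \<omega> * (?I \<omega> * cos (W k \<omega> - s)) \<partial>M) =
      c * measure std_normal_distribution (A m) * (cos s * exp (- (norm k)\<^sup>2 / 2))"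
    using one split[of k s] Suc.prems by (simp add: algebra_simps)
  then show ?case unfolding v_def c_def by (simp add: ac_simps)
qed

abbreviation gauss :: "nat \<Rightarrow> (nat \<Rightarrow> real) measure" where
  "gauss N \<equiv> \<Pi>\<^sub>M n\<in>{..<N}. std_normal_distribution"

text \<open>Taking \<open>k = 0\<close> and \<open>s = 0\<close> in \<open>orthonormal_indep\<close>
  gives the product formula on rectangles, which determines the joint law. The result moves
  expectations of functions of finitely many \<open>W (e n)\<close> to the explicit Gaussian measure
  used by \<open>gamma_norm\<close>.\<close>

lemma distr_orthonormal:
  assumes e: "orthonormal_upto N e"
  shows "distr M (\<Pi>\<^sub>M n\<in>{..<N}. borel) (\<lambda>\<omega>. \<lambda>n\<in>{..<N}. W (e n) \<omega>) = gauss N"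
proof -
  interpret N: real_distribution std_normal_distribution by (rule real_dist_normal_dist)
  interpret product_sigma_finite "\<lambda>n::nat. std_normal_distribution" by standard
  have meas: "(\<lambda>\<omega>. \<lambda>n\<in>{..<N}. W (e n) \<omega>) \<in> measurable M (\<Pi>\<^sub>M n\<in>{..<N}. borel)"
    by (rule measurable_restrict) simp
  show ?thesis
  proof (rule PiM_eqI)
    show "sets (distr M (\<Pi>\<^sub>M n\<in>{..<N}. borel) (\<lambda>\<omega>. \<lambda>n\<in>{..<N}. W (e n) \<omega>)) = sets (gauss N)"
      by (simp cong: sets_PiM_cong)
    fix A :: "nat \<Rightarrow> real set"
    assume A: "\<And>n. n \<in> {..<N} \<Longrightarrow> A n \<in> sets std_normal_distribution"
    \<comment> \<open>\<open>orthonormal_indep\<close> asks for Borel sets at every index, whereas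
      \<open>A\<close> is controlled only below \<open>N\<close>.\<close>
    define A' where "A' n = (if n < N then A n else UNIV)" for n
    have [measurable]: "A' n \<in> sets borel" for n using A by (auto simp: A'_def)
    have PiE: "Pi\<^sub>E {..<N} A \<in> sets (\<Pi>\<^sub>M n\<in>{..<N}. borel)"
    proof (rule sets_PiM_I_finite)
      show "A n \<in> sets borel" if "n \<in> {..<N}" for n using A[OF that] by simp
    qed simp
    have eq: "(\<lambda>\<omega>. \<lambda>n\<in>{..<N}. W (e n) \<omega>) -` Pi\<^sub>E {..<N} A \<inter> space M
        = {\<omega> \<in> space M. \<forall>n\<in>{..<N}. W (e n) \<omega> \<in> A' n}"
      unfolding restrict_vimage_PiE by (auto simp: A'_def)
    have [measurable]: "{\<omega> \<in> space M. \<forall>n\<in>{..<N}. W (e n) \<omega> \<in> A' n} \<in> sets M"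
      unfolding eq[symmetric] by (rule measurable_sets[OF meas PiE])
    have ind: "(\<Prod>n<N. indicator (A' n) (W (e n) \<omega>)) =
        (indicator {\<omega> \<in> space M. \<forall>n\<in>{..<N}. W (e n) \<omega> \<in> A' n} \<omega> :: real)" if "\<omega> \<in> space M" for \<omega>
    proof (cases "\<forall>n\<in>{..<N}. W (e n) \<omega> \<in> A' n")
      case True
      then have "(\<Prod>n<N. indicator (A' n) (W (e n) \<omega>)) = (1 :: real)" by (intro prod.neutral) simp
      then show ?thesis using that True by simp
    next
      case False
      then obtain n where "n < N" "W (e n) \<omega> \<notin> A' n" by blast
      then have "(\<Prod>n<N. indicator (A' n) (W (e n) \<omega>)) = (0 :: real)"
        by (intro prod_zero) (auto intro!: bexI[of _ n])
      then show ?thesis using that False by simp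
    qed
    have "(\<integral>\<omega>. (\<Prod>n<N. indicator (A' n) (W (e n) \<omega>)) * cos (W 0 \<omega> - 0) \<partial>M) =
      (\<Prod>n<N. measure std_normal_distribution (A' n))"
      using orthonormal_indep[OF e order_refl, of A' 0 0] by simp
    moreover have "(\<integral>\<omega>. (\<Prod>n<N. indicator (A' n) (W (e n) \<omega>)) * cos (W 0 \<omega> - 0) \<partial>M) =
      (\<integral>\<omega>. indicator {\<omega> \<in> space M. \<forall>n\<in>{..<N}. W (e n) \<omega> \<in> A' n} \<omega> \<partial>M)"
    proof (rule integral_cong_AE)
      have "AE \<omega> in M. W 0 \<omega> = 0" using W_scale[of 0 0] by simp
      then show "AE \<omega> in M. (\<Prod>n<N. indicator (A' n) (W (e n) \<omega>)) * cos (W 0 \<omega> - 0) =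
        (indicator {\<omega> \<in> space M. \<forall>n\<in>{..<N}. W (e n) \<omega> \<in> A' n} \<omega> :: real)"
        using AE_space by eventually_elim (simp add: ind)
    qed auto
    ultimately have "prob {\<omega> \<in> space M. \<forall>n\<in>{..<N}. W (e n) \<omega> \<in> A' n}
        = (\<Prod>n<N. measure std_normal_distribution (A' n))"
      by simp
    then have "emeasure M {\<omega> \<in> space M. \<forall>n\<in>{..<N}. W (e n) \<omega> \<in> A' n}
        = (\<Prod>n<N. emeasure std_normal_distribution (A' n))"
      by (simp add: prod_ennreal[symmetric] measure_nonneg emeasure_eq_measure N.emeasure_eq_measure)
    then show "emeasure (distr M (\<Pi>\<^sub>M n\<in>{..<N}. borel) (\<lambda>\<omega>. \<lambda>n\<in>{..<N}. W (e n) \<omega>)) (Pi\<^sub>E {..<N} A)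
        = (\<Prod>n\<in>{..<N}. emeasure std_normal_distribution (A n))"
      by (simp add: emeasure_distr[OF meas PiE] eq) (simp add: A'_def)
  qed simp
qed

end

subsection \<open>Gaussian sums and the \<open>\<gamma>\<close>-norm\<close>

text \<open>Addition need not be Borel measurable on a non-separable space, so sums are handled by
  discretising the scalar coefficient.\<close>

lemma borel_measurable_add_scaleR:
  fixes f :: "'a \<Rightarrow> 'e::real_normed_vector" and r :: "'a \<Rightarrow> real"
  assumes f: "f \<in> borel_measurable M" and [measurable]: "r \<in> borel_measurable M"
  shows "(\<lambda>\<omega>. f \<omega> + r \<omega> *\<^sub>R x) \<in> borel_measurable M"
proof (rule borel_measurable_LIMSEQ_metric)
  fix i :: nat
  have "(\<lambda>\<omega>. f \<omega> + (of_int k / real (Suc i)) *\<^sub>R x) \<in> borel_measurable M" for k :: int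
    by (rule measurable_compose[OF f])
       (auto intro!: borel_measurable_continuous_onI continuous_intros)
  then show "(\<lambda>\<omega>. f \<omega> + (of_int \<lfloor>real (Suc i) * r \<omega>\<rfloor> / real (Suc i)) *\<^sub>R x) \<in> borel_measurable M"
    by (rule measurable_compose_countable) measurable
next
  fix \<omega>
  have "(\<lambda>i. of_int \<lfloor>real (Suc i) * r \<omega>\<rfloor> / real (Suc i)) \<longlonglongrightarrow> r \<omega>"
  proof (rule tendsto_sandwich)
    show "(\<lambda>i. r \<omega> - 1 / real (Suc i)) \<longlonglongrightarrow> r \<omega>"
      using tendsto_diff[OF tendsto_const LIMSEQ_inverse_real_of_nat] by (simp add: inverse_eq_divide)
    show "\<forall>\<^sub>F i in sequentially. r \<omega> - 1 / real (Suc i) \<le> of_int \<lfloor>real (Suc i) * r \<omega>\<rfloor> / real (Suc i)"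
    proof (intro always_eventually allI)
      fix i
      have "real (Suc i) * r \<omega> - 1 \<le> of_int \<lfloor>real (Suc i) * r \<omega>\<rfloor>" by linarith
      then have "(real (Suc i) * r \<omega> - 1) / real (Suc i) \<le> of_int \<lfloor>real (Suc i) * r \<omega>\<rfloor> / real (Suc i)"
        by (rule divide_right_mono) simp
      then show "r \<omega> - 1 / real (Suc i) \<le> of_int \<lfloor>real (Suc i) * r \<omega>\<rfloor> / real (Suc i)"
        by (simp add: diff_divide_distrib)
    qed
    show "\<forall>\<^sub>F i in sequentially. of_int \<lfloor>real (Suc i) * r \<omega>\<rfloor> / real (Suc i) \<le> r \<omega>"
    proof (intro always_eventually allI)
      fix i
      have "of_int \<lfloor>real (Suc i) * r \<omega>\<rfloor> \<le> real (Suc i) * r \<omega>" by linarith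
      then show "of_int \<lfloor>real (Suc i) * r \<omega>\<rfloor> / real (Suc i) \<le> r \<omega>"
        by (simp add: divide_le_eq mult.commute)
    qed
  qed simp
  then show "(\<lambda>i. f \<omega> + (of_int \<lfloor>real (Suc i) * r \<omega>\<rfloor> / real (Suc i)) *\<^sub>R x) \<longlonglongrightarrow> f \<omega> + r \<omega> *\<^sub>R x"
    by (intro tendsto_intros)
qed

lemma borel_measurable_add_sum_scaleR:
  fixes f :: "'a \<Rightarrow> 'e::real_normed_vector" and r :: "nat \<Rightarrow> 'a \<Rightarrow> real"
  assumes "f \<in> borel_measurable M" "\<And>n. n < N \<Longrightarrow> r n \<in> borel_measurable M"
  shows "(\<lambda>\<omega>. f \<omega> + (\<Sum>n<N. r n \<omega> *\<^sub>R x n)) \<in> borel_measurable M"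
  using assms(2)
proof (induction N)
  case 0
  then show ?case using assms(1) by simp
next
  case (Suc N)
  then have "(\<lambda>\<omega>. (f \<omega> + (\<Sum>n<N. r n \<omega> *\<^sub>R x n)) + r N \<omega> *\<^sub>R x N) \<in> borel_measurable M"
    by (intro borel_measurable_add_scaleR) auto
  then show ?case by (simp add: add.assoc)
qed

lemma borel_measurable_sum_scaleR:
  fixes x :: "nat \<Rightarrow> 'e::real_normed_vector"
  assumes "\<And>n. n < N \<Longrightarrow> r n \<in> borel_measurable M"
  shows "(\<lambda>\<omega>. \<Sum>n<N. r n \<omega> *\<^sub>R x n) \<in> borel_measurable M"
  using borel_measurable_add_sum_scaleR[of "\<lambda>_. 0" M N r x] assms by simp

lemma borel_measurable_diff_sum_scaleR:
  fixes x :: "nat \<Rightarrow> 'e::real_normed_vector"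
  assumes "f \<in> borel_measurable M" "\<And>n. n < N \<Longrightarrow> r n \<in> borel_measurable M"
  shows "(\<lambda>\<omega>. f \<omega> - (\<Sum>n<N. r n \<omega> *\<^sub>R x n)) \<in> borel_measurable M"
  using borel_measurable_add_sum_scaleR[of f M N r "\<lambda>n. - x n"] assms by (simp add: sum_negf)

text \<open>The vectors in a tensor sum are arbitrary, but \<open>gamma_norm\<close> and the
  Gaussian laws require orthonormal ones. The family may be linearly dependent: when the remainder
  \<open>d\<close> vanishes no vector is added, which is why \<open>L\<close> is not tied to
  \<open>N\<close>.\<close>

lemma gram_schmidt:
  fixes g :: "nat \<Rightarrow> 'k::real_inner"
  shows "\<exists>L e. orthonormal_upto L e \<and> (\<forall>m<N. g m = (\<Sum>l<L. (g m \<bullet> e l) *\<^sub>R e l))"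
proof (induction N)
  case 0
  show ?case by (intro exI[of _ 0]) (simp add: orthonormal_upto_def)
next
  case (Suc N)
  then obtain L e where e: "orthonormal_upto L e"
    and g: "\<And>m. m < N \<Longrightarrow> g m = (\<Sum>l<L. (g m \<bullet> e l) *\<^sub>R e l)" by blast
  define d where "d = g N - (\<Sum>l<L. (g N \<bullet> e l) *\<^sub>R e l)"
  have sum_e: "(\<Sum>l<L. c l *\<^sub>R e l) \<bullet> e i = c i" if "i < L" for c i
  proof -
    have "(\<Sum>l<L. c l *\<^sub>R e l) \<bullet> e i = (\<Sum>l<L. if l = i then c l else 0)"
      using e that unfolding orthonormal_upto_def inner_sum_left
      by (intro sum.cong) auto
    then show ?thesis using that by simp
  qed
  have d_e: "d \<bullet> e i = 0" if "i < L" for i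
    unfolding d_def using sum_e[OF that, of "\<lambda>l. g N \<bullet> e l"] by (simp add: inner_simps)
  show ?case
  proof (cases "d = 0")
    case True
    then have "g m = (\<Sum>l<L. (g m \<bullet> e l) *\<^sub>R e l)" if "m < Suc N" for m
      using g[of m] that unfolding d_def by (cases "m = N") auto
    then show ?thesis using e by blast
  next
    case False
    define e' where "e' = e(L := d /\<^sub>R norm d)"
    have "d \<bullet> d = norm d * norm d" by (simp add: power2_norm_eq_inner flip: power2_eq_square)
    then have "e' L \<bullet> e' L = 1" using False by (simp add: e'_def field_simps)
    moreover have "e' L \<bullet> e' i = 0" "e' i \<bullet> e' L = 0" if "i < L" for i
      using d_e[OF that] that by (simp_all add: e'_def inner_commute[of "e i" d])
    moreover have "e' i \<bullet> e' l = (if i = l then 1 else 0)" if "i < L" "l < L" for i l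
      using e that by (simp add: orthonormal_upto_def e'_def)
    ultimately have "orthonormal_upto (Suc L) e'"
      unfolding orthonormal_upto_def by (metis less_Suc_eq less_irrefl)
    moreover have "g m = (\<Sum>l<Suc L. (g m \<bullet> e' l) *\<^sub>R e' l)" if "m < Suc N" for m
    proof (cases "m = N")
      case True
      have "(\<Sum>l<L. c l *\<^sub>R e l) \<bullet> d = 0" for c
        unfolding inner_sum_left using d_e by (simp add: inner_commute[of _ d])
      moreover have "g N \<bullet> d = (\<Sum>l<L. (g N \<bullet> e l) *\<^sub>R e l) \<bullet> d + d \<bullet> d"
        using inner_add_left[of "\<Sum>l<L. (g N \<bullet> e l) *\<^sub>R e l" d d] by (simp add: d_def)
      ultimately have "g N \<bullet> d = d \<bullet> d" by simp
      then have "(g N \<bullet> (d /\<^sub>R norm d)) *\<^sub>R (d /\<^sub>R norm d) = d"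
        using False \<open>d \<bullet> d = norm d * norm d\<close> by (simp add: field_simps)
      then show ?thesis unfolding True by (simp add: e'_def d_def)
    next
      case False
      then have m: "m < N" using that by simp
      have "g m \<bullet> d = (\<Sum>l<L. (g m \<bullet> e l) *\<^sub>R e l) \<bullet> d" using g[OF m] by simp
      also have "\<dots> = 0"
        unfolding inner_sum_left using d_e by (simp add: inner_commute[of _ d])
      finally have "g m \<bullet> d = 0" .
      then show ?thesis using g[OF m] by (simp add: e'_def)
    qed
    ultimately show ?thesis by blast
  qed
qed

lemma tensor_sum_apply: "blinfun_apply (tensor_sum N h x) g = (\<Sum>n<N. (h n \<bullet> g) *\<^sub>R x n)"
  by (simp add: tensor_sum_def blinfun.sum_left blinfun_scaleR_left.rep_eq blinfun_inner_right.rep_eq)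

lemma sum_concat:
  fixes a b :: "nat \<Rightarrow> 'a::comm_monoid_add"
  shows "(\<Sum>n<N + N'. if n < N then a n else b (n - N)) = (\<Sum>n<N. a n) + (\<Sum>n<N'. b n)"
  by (induction N') (auto simp: add.assoc)

text \<open>Makes the difference of two tensor sums a single tensor sum, as
  \<open>gamma_norm_tensor_sum\<close> requires, and lets Gram-Schmidt orthonormalise two families
  jointly.\<close>

definition concat_seq :: "nat \<Rightarrow> (nat \<Rightarrow> 'a) \<Rightarrow> (nat \<Rightarrow> 'a) \<Rightarrow> nat \<Rightarrow> 'a" where
  "concat_seq N a b n = (if n < N then a n else b (n - N))"

lemma sum_concat_seq:
  fixes F :: "'a \<Rightarrow> 'b \<Rightarrow> 'c::comm_monoid_add"
  shows "(\<Sum>n<N + N'. F (concat_seq N a a' n) (concat_seq N b b' n)) =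
    (\<Sum>n<N. F (a n) (b n)) + (\<Sum>n<N'. F (a' n) (b' n))"
  using sum_concat[where a = "\<lambda>n. F (a n) (b n)" and b = "\<lambda>n. F (a' n) (b' n)" and N = N and N' = N']
  unfolding concat_seq_def by (simp add: if_distrib if_distribR cong: if_cong)

lemma tensor_sum_diff:
  "tensor_sum N h x - tensor_sum N' h' x' =
    tensor_sum (N + N') (concat_seq N h h') (concat_seq N x (\<lambda>n. - x' n))"
  by (rule blinfun_eqI)
     (simp add: blinfun.diff_left tensor_sum_apply sum_concat_seq[where F = "\<lambda>h x. (h \<bullet> _) *\<^sub>R x"] sum_negf)

section \<open>The isonormal process on finite-rank operators\<close>

context isonormal
begin

definition W_sum_tensor :: "nat \<Rightarrow> (nat \<Rightarrow> 'k) \<Rightarrow> (nat \<Rightarrow> 'e::banach) \<Rightarrow> 'w \<Rightarrow> 'e" where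
  "W_sum_tensor N h x \<omega> = (\<Sum>n<N. W (h n) \<omega> *\<^sub>R x n)"

lemma W_sum_tensor_measurable [measurable]: "W_sum_tensor N h x \<in> borel_measurable M"
  unfolding W_sum_tensor_def by (intro borel_measurable_sum_scaleR) auto

lemma diff_W_sum_tensor_measurable:
  "X \<in> borel_measurable M \<Longrightarrow> (\<lambda>\<omega>. X \<omega> - W_sum_tensor N h x \<omega>) \<in> borel_measurable M"
  unfolding W_sum_tensor_def by (intro borel_measurable_diff_sum_scaleR) auto

lemma W_sum_tensor_diff:
  "W_sum_tensor N h x \<omega> - W_sum_tensor N' h' x' \<omega> =
    W_sum_tensor (N + N') (concat_seq N h h') (concat_seq N x (\<lambda>n. - x' n)) \<omega>"
  unfolding W_sum_tensor_def
  by (simp add: sum_concat_seq[where F = "\<lambda>h x. W h \<omega> *\<^sub>R x"] sum_negf)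

lemma functional_W_sum_tensor:
  "AE \<omega> in M. blinfun_apply xs (W_sum_tensor N h x \<omega>) = W (riesz_adjoint (tensor_sum N h x) xs) \<omega>"
proof -
  have "riesz_adjoint (tensor_sum N h x) xs = (\<Sum>n<N. blinfun_apply xs (x n) *\<^sub>R h n)"
    by (rule riesz_adjoint_eqI)
       (simp add: tensor_sum_apply blinfun.sum_right blinfun.scaleR_right inner_sum_left mult.commute)
  moreover have "AE \<omega> in M. W (\<Sum>n<N. blinfun_apply xs (x n) *\<^sub>R h n) \<omega> =
      (\<Sum>n<N. blinfun_apply xs (x n) * W (h n) \<omega>)"
    by (rule W_sum)
  ultimately show ?thesis
    by (simp add: W_sum_tensor_def blinfun.sum_right blinfun.scaleR_right mult.commute eq_commute)
qed

text \<open>Re-expanding in an orthonormal system whose span contains the \<open>h m\<close> gives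
  \<open>e l\<close> the coefficient obtained by applying the operator to \<open>e l\<close>. The
  new representation thus depends only on the operator and the system, not on \<open>h\<close> and
  \<open>x\<close>.\<close>

lemma W_sum_tensor_basis:
  fixes x :: "nat \<Rightarrow> 'e::banach"
  assumes h: "\<And>m. m < N \<Longrightarrow> h m = (\<Sum>l<L. (h m \<bullet> e l) *\<^sub>R e l)"
  shows "tensor_sum N h x = tensor_sum L e (\<lambda>l. tensor_sum N h x (e l))"
    and "AE \<omega> in M. W_sum_tensor N h x \<omega> = W_sum_tensor L e (\<lambda>l. tensor_sum N h x (e l)) \<omega>"
proof -
  have swap: "(\<Sum>m<N. (\<Sum>l<L. (h m \<bullet> e l) * c l) *\<^sub>R x m) = (\<Sum>l<L. c l *\<^sub>R tensor_sum N h x (e l))" for c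
  proof -
    have "(\<Sum>m<N. (\<Sum>l<L. (h m \<bullet> e l) * c l) *\<^sub>R x m) = (\<Sum>m<N. \<Sum>l<L. c l *\<^sub>R (h m \<bullet> e l) *\<^sub>R x m)"
      by (simp add: scaleR_sum_left mult.commute)
    also have "\<dots> = (\<Sum>l<L. c l *\<^sub>R tensor_sum N h x (e l))"
      by (subst sum.swap) (simp add: tensor_sum_apply scaleR_sum_right)
    finally show ?thesis .
  qed
  show "tensor_sum N h x = tensor_sum L e (\<lambda>l. tensor_sum N h x (e l))"
  proof (rule blinfun_eqI)
    fix g
    have "h m \<bullet> g = (\<Sum>l<L. (h m \<bullet> e l) * (e l \<bullet> g))" if "m < N" for m
      by (subst h[OF that]) (simp add: inner_sum_left)
    then have "tensor_sum N h x g = (\<Sum>m<N. (\<Sum>l<L. (h m \<bullet> e l) * (e l \<bullet> g)) *\<^sub>R x m)"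
      unfolding tensor_sum_apply by (intro sum.cong) auto
    then show "tensor_sum N h x g = tensor_sum L e (\<lambda>l. tensor_sum N h x (e l)) g"
      unfolding swap by (simp add: tensor_sum_apply[of L])
  qed
  have "AE \<omega> in M. W (h m) \<omega> = (\<Sum>l<L. (h m \<bullet> e l) * W (e l) \<omega>)" if "m < N" for m
    using W_sum[where N = L and c = "\<lambda>l. h m \<bullet> e l" and h = e] h[OF that] by simp
  then have "AE \<omega> in M. \<forall>m\<in>{..<N}. W (h m) \<omega> = (\<Sum>l<L. (h m \<bullet> e l) * W (e l) \<omega>)"
    by (intro AE_ball_countable') auto
  then show "AE \<omega> in M. W_sum_tensor N h x \<omega> = W_sum_tensor L e (\<lambda>l. tensor_sum N h x (e l)) \<omega>"
    by eventually_elim (simp add: W_sum_tensor_def flip: swap)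
qed

text \<open>This is the well-definedness of \<open>W\<close> on finite-rank operators: in an
  orthonormal system common to \<open>h\<close> and \<open>h'\<close>, both representations acquire
  the same coefficients.\<close>

lemma W_sum_tensor_cong:
  fixes x x' :: "nat \<Rightarrow> 'e::banach"
  assumes eq: "tensor_sum N h x = tensor_sum N' h' x'"
  shows "AE \<omega> in M. W_sum_tensor N h x \<omega> = W_sum_tensor N' h' x' \<omega>"
proof -
  obtain L e where "orthonormal_upto L e" and g: "\<forall>m<N + N'.
      concat_seq N h h' m = (\<Sum>l<L. (concat_seq N h h' m \<bullet> e l) *\<^sub>R e l)"
    using gram_schmidt[of "N + N'" "concat_seq N h h'"] by blast
  have "h m = (\<Sum>l<L. (h m \<bullet> e l) *\<^sub>R e l)" if "m < N" for m
    using g[rule_format, of m] that by (simp add: concat_seq_def)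
  then have 1: "AE \<omega> in M. W_sum_tensor N h x \<omega> = W_sum_tensor L e (\<lambda>l. tensor_sum N h x (e l)) \<omega>"
    by (rule W_sum_tensor_basis)
  have "h' m = (\<Sum>l<L. (h' m \<bullet> e l) *\<^sub>R e l)" if "m < N'" for m
    using g[rule_format, of "N + m"] that by (simp add: concat_seq_def)
  then have 2: "AE \<omega> in M. W_sum_tensor N' h' x' \<omega> = W_sum_tensor L e (\<lambda>l. tensor_sum N' h' x' (e l)) \<omega>"
    by (rule W_sum_tensor_basis)
  from 1 2 show ?thesis by eventually_elim (simp add: eq)
qed

lemma nn_integral_orthonormal:
  assumes e: "orthonormal_upto N e" and F: "F \<in> borel_measurable (\<Pi>\<^sub>M n\<in>{..<N}. borel)"
  shows "(\<integral>\<^sup>+\<omega>. F (\<lambda>n\<in>{..<N}. W (e n) \<omega>) \<partial>M) = (\<integral>\<^sup>+\<gamma>. F \<gamma> \<partial>gauss N)"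
  unfolding distr_orthonormal[OF e, symmetric]
  using F by (intro nn_integral_distr[symmetric] measurable_restrict) auto

lemma sets_gauss: "sets (gauss N) = sets (\<Pi>\<^sub>M n\<in>{..<N}. borel)"
  by (intro sets_PiM_cong) auto

lemma gauss_sum_measurable:
  fixes x :: "nat \<Rightarrow> 'e::real_normed_vector"
  shows "(\<lambda>\<gamma>. \<Sum>n<N. \<gamma> n *\<^sub>R x n) \<in> borel_measurable (\<Pi>\<^sub>M n\<in>{..<N}. borel)"
  by (intro borel_measurable_sum_scaleR measurable_component_singleton) auto

lemma gauss_norm_eq_L2_norm:
  fixes x :: "nat \<Rightarrow> 'e::banach"
  assumes e: "orthonormal_upto N e"
  shows "sqrt (\<integral>\<gamma>. (norm (\<Sum>n<N. \<gamma> n *\<^sub>R x n))\<^sup>2 \<partial>gauss N) = L2_norm M (W_sum_tensor N e x)"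
proof -
  have m: "(\<lambda>\<gamma>. (norm (\<Sum>n<N. \<gamma> n *\<^sub>R x n))\<^sup>2) \<in> borel_measurable (\<Pi>\<^sub>M n\<in>{..<N}. borel)"
    by (intro borel_measurable_power measurable_compose[OF gauss_sum_measurable])
       (auto intro!: borel_measurable_continuous_onI continuous_intros)
  then have "(\<integral>\<gamma>. (norm (\<Sum>n<N. \<gamma> n *\<^sub>R x n))\<^sup>2 \<partial>gauss N) =
      enn2real (\<integral>\<^sup>+\<gamma>. ennreal ((norm (\<Sum>n<N. \<gamma> n *\<^sub>R x n))\<^sup>2) \<partial>gauss N)"
    by (intro integral_eq_nn_integral) (auto simp: measurable_cong_sets[OF sets_gauss refl])
  also have "(\<integral>\<^sup>+\<gamma>. ennreal ((norm (\<Sum>n<N. \<gamma> n *\<^sub>R x n))\<^sup>2) \<partial>gauss N) =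
      (\<integral>\<^sup>+\<omega>. ennreal ((norm (W_sum_tensor N e x \<omega>))\<^sup>2) \<partial>M)"
    using m by (subst nn_integral_orthonormal[OF e, symmetric]) (auto simp: W_sum_tensor_def)
  finally show ?thesis unfolding L2_norm_def by simp
qed

lemma L2_norm_cong_AE:
  assumes "AE \<omega> in M. X \<omega> = Y \<omega>"
  shows "L2_norm M X = L2_norm M Y"
proof -
  have "(\<integral>\<^sup>+\<omega>. ennreal ((norm (X \<omega>))\<^sup>2) \<partial>M) = (\<integral>\<^sup>+\<omega>. ennreal ((norm (Y \<omega>))\<^sup>2) \<partial>M)"
    using assms by (intro nn_integral_cong_AE) auto
  then show ?thesis by (simp add: L2_norm_def)
qed

text \<open>Gram-Schmidt provides an orthonormal representation, so the description in
  \<open>gamma_norm\<close> is satisfiable. For uniqueness, each candidate equals an L2 norm over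
  \<open>M\<close>, and \<open>W_sum_tensor_cong\<close> shows that this norm does not depend on the
  representation.\<close>

lemma gamma_norm_tensor_sum:
  fixes x :: "nat \<Rightarrow> 'e::banach"
  shows "gamma_norm (tensor_sum N h x) = L2_norm M (W_sum_tensor N h x)"
  unfolding gamma_norm_def
proof (rule the_equality)
  obtain L e where e: "orthonormal_upto L e" and h: "\<And>m. m < N \<Longrightarrow> h m = (\<Sum>l<L. (h m \<bullet> e l) *\<^sub>R e l)"
    using gram_schmidt[of N h] by blast
  note b = W_sum_tensor_basis[where N = N and h = h and L = L and e = e and x = x, OF h]
  have "L2_norm M (W_sum_tensor N h x) = L2_norm M (W_sum_tensor L e (\<lambda>l. tensor_sum N h x (e l)))"
    using b(2) by (intro L2_norm_cong_AE) simp
  also have "\<dots> = sqrt (\<integral>\<gamma>. (norm (\<Sum>n<L. \<gamma> n *\<^sub>R tensor_sum N h x (e n)))\<^sup>2 \<partial>gauss L)"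
    using gauss_norm_eq_L2_norm[OF e] ..
  finally have "orthonormal_upto L e \<and> tensor_sum N h x = tensor_sum L e (\<lambda>l. tensor_sum N h x (e l)) \<and>
      L2_norm M (W_sum_tensor N h x) =
        sqrt (\<integral>\<gamma>. (norm (\<Sum>n<L. \<gamma> n *\<^sub>R tensor_sum N h x (e n)))\<^sup>2 \<partial>gauss L)"
    using e b(1) by blast
  then show "\<exists>N' h' x'. orthonormal_upto N' h' \<and> tensor_sum N h x = tensor_sum N' h' x' \<and>
      L2_norm M (W_sum_tensor N h x) = sqrt (\<integral>\<gamma>. (norm (\<Sum>n<N'. \<gamma> n *\<^sub>R x' n))\<^sup>2 \<partial>gauss N')"
    by (intro exI)
next
  fix c
  assume "\<exists>N' h' x'. orthonormal_upto N' h' \<and> tensor_sum N h x = tensor_sum N' h' x' \<and>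
      c = sqrt (\<integral>\<gamma>. (norm (\<Sum>n<N'. \<gamma> n *\<^sub>R x' n))\<^sup>2 \<partial>gauss N')"
  then obtain N' h' and x' :: "nat \<Rightarrow> 'e" where h': "orthonormal_upto N' h'"
    and eq: "tensor_sum N h x = tensor_sum N' h' x'"
    and c: "c = sqrt (\<integral>\<gamma>. (norm (\<Sum>n<N'. \<gamma> n *\<^sub>R x' n))\<^sup>2 \<partial>gauss N')"
    by blast
  have "L2_norm M (W_sum_tensor N h x) = L2_norm M (W_sum_tensor N' h' x')"
    using W_sum_tensor_cong[OF eq] by (intro L2_norm_cong_AE)
  then show "c = L2_norm M (W_sum_tensor N h x)"
    unfolding c gauss_norm_eq_L2_norm[OF h'] by simp
qed

lemma W_sum_tensor_L2: "(\<integral>\<^sup>+\<omega>. ennreal ((norm (W_sum_tensor N h x \<omega>))\<^sup>2) \<partial>M) < \<infinity>"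
proof -
  have "(norm (\<Sum>n<N. W (h n) \<omega> *\<^sub>R x n))\<^sup>2 \<le> real N * (\<Sum>n<N. (norm (x n))\<^sup>2 * (W (h n) \<omega>)\<^sup>2)" for \<omega>
  proof -
    have "(norm (\<Sum>n<N. W (h n) \<omega> *\<^sub>R x n))\<^sup>2 \<le> (\<Sum>n<N. \<bar>W (h n) \<omega>\<bar> * norm (x n))\<^sup>2"
      using norm_sum[of "\<lambda>n. W (h n) \<omega> *\<^sub>R x n" "{..<N}"] by (intro power_mono) auto
    also have "\<dots> = (\<Sum>n<N. 1 * (\<bar>W (h n) \<omega>\<bar> * norm (x n)))\<^sup>2" by simp
    also have "\<dots> \<le> (\<Sum>n<N. 1\<^sup>2) * (\<Sum>n<N. (\<bar>W (h n) \<omega>\<bar> * norm (x n))\<^sup>2)"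
      by (rule Cauchy_Schwarz_ineq_sum)
    finally show ?thesis by (simp add: power_mult_distrib mult.commute)
  qed
  then have "(\<integral>\<^sup>+\<omega>. ennreal ((norm (W_sum_tensor N h x \<omega>))\<^sup>2) \<partial>M) \<le>
      (\<integral>\<^sup>+\<omega>. ennreal (real N * (\<Sum>n<N. (norm (x n))\<^sup>2 * (W (h n) \<omega>)\<^sup>2)) \<partial>M)"
    unfolding W_sum_tensor_def by (intro nn_integral_mono ennreal_leI)
  also have "\<dots> < \<infinity>"
  proof -
    have "integrable M (\<lambda>\<omega>. real N * (\<Sum>n<N. (norm (x n))\<^sup>2 * (W (h n) \<omega>)\<^sup>2))"
      using W_square_integrable by simp
    then show ?thesis
      by (subst nn_integral_eq_integral) (auto intro!: sum_nonneg AE_I2 mult_nonneg_nonneg)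
  qed
  finally show ?thesis .
qed

end

subsection \<open>Extension of the isonormal process to \<open>\<gamma>\<close>-radonifying operators\<close>

lemma L2_norm_square:
  assumes "(\<integral>\<^sup>+\<omega>. ennreal ((norm (f \<omega>))\<^sup>2) \<partial>M) < \<infinity>"
  shows "(\<integral>\<^sup>+\<omega>. ennreal ((norm (f \<omega>))\<^sup>2) \<partial>M) = ennreal ((L2_norm M f)\<^sup>2)"
  using assms by (simp add: L2_norm_def)

lemma L2_norm_nonneg: "0 \<le> L2_norm M f"
  by (simp add: L2_norm_def)

text \<open>\<open>X - Y\<close> itself may fail to be Borel. Only the norms of \<open>X\<close> and
  \<open>Y\<close> are integrated in the upper bound, and monotonicity of the nonnegative integral
  asks for no measurability of the smaller function.\<close>

lemma nn_integral_norm_diff_square: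
  fixes X Y :: "'a \<Rightarrow> 'b::real_normed_vector"
  assumes X: "(\<integral>\<^sup>+\<omega>. ennreal ((norm (X \<omega>))\<^sup>2) \<partial>M) < \<infinity>" and Y: "(\<integral>\<^sup>+\<omega>. ennreal ((norm (Y \<omega>))\<^sup>2) \<partial>M) < \<infinity>"
    and "X \<in> borel_measurable M" "Y \<in> borel_measurable M"
  shows "(\<integral>\<^sup>+\<omega>. ennreal ((norm (X \<omega> - Y \<omega>))\<^sup>2) \<partial>M) < \<infinity>"
proof -
  have [measurable]: "(\<lambda>\<omega>. norm (X \<omega>)) \<in> borel_measurable M" "(\<lambda>\<omega>. norm (Y \<omega>)) \<in> borel_measurable M"
    using assms by auto
  have "(norm (a - b))\<^sup>2 \<le> 2 * (norm a)\<^sup>2 + 2 * (norm b)\<^sup>2" for a b :: 'b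
  proof -
    have "(norm (a - b))\<^sup>2 \<le> (norm a + norm b)\<^sup>2" by (intro power_mono norm_triangle_ineq4) simp
    also have "\<dots> \<le> 2 * (norm a)\<^sup>2 + 2 * (norm b)\<^sup>2"
      using sum_squares_ge_zero[of "norm a - norm b" 0] by (simp add: power2_eq_square algebra_simps)
    finally show ?thesis .
  qed
  then have "(\<integral>\<^sup>+\<omega>. ennreal ((norm (X \<omega> - Y \<omega>))\<^sup>2) \<partial>M) \<le>
      (\<integral>\<^sup>+\<omega>. 2 * ennreal ((norm (X \<omega>))\<^sup>2) + 2 * ennreal ((norm (Y \<omega>))\<^sup>2) \<partial>M)"
    by (intro nn_integral_mono) (simp add: ennreal_leI flip: ennreal_mult' ennreal_plus ennreal_numeral)
  also have "\<dots> = 2 * (\<integral>\<^sup>+\<omega>. ennreal ((norm (X \<omega>))\<^sup>2) \<partial>M) + 2 * (\<integral>\<^sup>+\<omega>. ennreal ((norm (Y \<omega>))\<^sup>2) \<partial>M)"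
    by (simp add: nn_integral_add nn_integral_cmult)
  also have "\<dots> < \<infinity>" using X Y by (simp add: ennreal_mult_less_top)
  finally show ?thesis .
qed

lemma L2_norm_tendsto_AE_subseq:
  fixes D :: "nat \<Rightarrow> 'a \<Rightarrow> 'b::real_normed_vector"
  assumes D: "\<And>i. D i \<in> borel_measurable M"
    and fin: "\<And>i. (\<integral>\<^sup>+\<omega>. ennreal ((norm (D i \<omega>))\<^sup>2) \<partial>M) < \<infinity>"
    and lim: "(\<lambda>i. L2_norm M (D i)) \<longlonglongrightarrow> 0"
  obtains r :: "nat \<Rightarrow> nat" where "strict_mono r" "AE \<omega> in M. (\<lambda>i. D (r i) \<omega>) \<longlonglongrightarrow> 0"
proof -
  have [measurable]: "(\<lambda>\<omega>. norm (D i \<omega>)) \<in> borel_measurable M" for i using D by simp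
  have "(\<integral>\<omega>. norm ((norm (D i \<omega>))\<^sup>2) \<partial>M) = (L2_norm M (D i))\<^sup>2" for i
    by (subst integral_eq_nn_integral) (auto simp: L2_norm_def)
  then have "(\<lambda>i. \<integral>\<omega>. norm ((norm (D i \<omega>))\<^sup>2) \<partial>M) \<longlonglongrightarrow> 0"
    using tendsto_power[OF lim, of 2] by simp
  moreover have "integrable M (\<lambda>\<omega>. (norm (D i \<omega>))\<^sup>2)" for i
    using fin[of i] by (intro integrableI_nonneg) auto
  ultimately obtain r :: "nat \<Rightarrow> nat" where r: "strict_mono r"
    and AE: "AE \<omega> in M. (\<lambda>i. (norm (D (r i) \<omega>))\<^sup>2) \<longlonglongrightarrow> 0"
    using tendsto_L1_AE_subseq[of M "\<lambda>i \<omega>. (norm (D i \<omega>))\<^sup>2"] by blast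
  from AE have "AE \<omega> in M. (\<lambda>i. D (r i) \<omega>) \<longlonglongrightarrow> 0"
  proof eventually_elim
    case (elim \<omega>)
    then have "(\<lambda>i. sqrt ((norm (D (r i) \<omega>))\<^sup>2)) \<longlonglongrightarrow> sqrt 0" by (rule tendsto_real_sqrt)
    then show ?case by (simp add: tendsto_norm_zero_iff)
  qed
  with r show ?thesis using that by blast
qed

lemma AE_summable:
  fixes f :: "nat \<Rightarrow> 'a \<Rightarrow> real"
  assumes [measurable]: "\<And>k. f k \<in> borel_measurable M" and nonneg: "\<And>k \<omega>. 0 \<le> f k \<omega>"
    and le: "\<And>k. (\<integral>\<^sup>+\<omega>. ennreal (f k \<omega>) \<partial>M) \<le> ennreal (c k)" and c: "summable c" "\<And>k. 0 \<le> c k"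
  shows "AE \<omega> in M. summable (\<lambda>k. f k \<omega>)"
proof -
  have "(\<integral>\<^sup>+\<omega>. (\<Sum>k. ennreal (f k \<omega>)) \<partial>M) = (\<Sum>k. \<integral>\<^sup>+\<omega>. ennreal (f k \<omega>) \<partial>M)"
    by (rule nn_integral_suminf) simp
  also have "\<dots> \<le> (\<Sum>k. ennreal (c k))" using le by (intro suminf_le) auto
  also have "\<dots> = ennreal (\<Sum>k. c k)" using c by (intro suminf_ennreal2) auto
  finally have "(\<integral>\<^sup>+\<omega>. (\<Sum>k. ennreal (f k \<omega>)) \<partial>M) \<noteq> \<infinity>" by (auto simp: top_unique)
  then have "AE \<omega> in M. (\<Sum>k. ennreal (f k \<omega>)) \<noteq> \<infinity>" by (intro nn_integral_PInf_AE) auto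
  then show ?thesis
    by eventually_elim (intro summable_suminf_not_top, auto simp: nonneg)
qed

text \<open>A diagonal argument. Truncating distances at 1 makes dominated convergence available, so
  \<open>n k\<close> can be chosen with expected truncated distance below \<open>(1/2)^k\<close>;
  summability then sends the distances along the diagonal to 0 almost everywhere.\<close>

lemma (in prob_space) strongly_measurable_AE_limit:
  fixes Y :: "nat \<Rightarrow> 'a \<Rightarrow> 'b::real_normed_vector"
  assumes s: "\<And>k n. simple_function M (s k n)"
    and meas: "\<And>k n. (\<lambda>\<omega>. s k n \<omega> - Y k \<omega>) \<in> borel_measurable M"
    and s_lim: "\<And>k \<omega>. \<omega> \<in> space M \<Longrightarrow> (\<lambda>n. s k n \<omega>) \<longlonglongrightarrow> Y k \<omega>"
    and lim: "AE \<omega> in M. (\<lambda>k. Y k \<omega>) \<longlonglongrightarrow> X \<omega>"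
  shows "strongly_measurable M X"
proof -
  let ?d = "\<lambda>k n \<omega>. min 1 (norm (s k n \<omega> - Y k \<omega>))"
  have [measurable]: "(\<lambda>\<omega>. norm (s k n \<omega> - Y k \<omega>)) \<in> borel_measurable M" for k n
    using meas[of k n] by simp
  have "(\<lambda>n. \<integral>\<omega>. ?d k n \<omega> \<partial>M) \<longlonglongrightarrow> (\<integral>\<omega>. 0 \<partial>M)" for k
  proof (rule integral_dominated_convergence[where w = "\<lambda>_. 1"])
    show "AE \<omega> in M. (\<lambda>n. ?d k n \<omega>) \<longlonglongrightarrow> 0"
    proof (intro AE_I2)
      fix \<omega> assume "\<omega> \<in> space M"
      then have "(\<lambda>n. norm (s k n \<omega> - Y k \<omega>)) \<longlonglongrightarrow> norm (Y k \<omega> - Y k \<omega>)"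
        by (intro tendsto_intros s_lim)
      then show "(\<lambda>n. ?d k n \<omega>) \<longlonglongrightarrow> 0"
        using tendsto_min[OF tendsto_const[of 1]] by fastforce
    qed
  qed auto
  then have "\<exists>n. (\<integral>\<omega>. ?d k n \<omega> \<partial>M) < (1/2) ^ k" for k
    using order_tendstoD(2)[of "\<lambda>n. \<integral>\<omega>. ?d k n \<omega> \<partial>M" 0 sequentially "(1/2)^k"]
    by (auto simp: eventually_sequentially)
  then obtain n where n: "\<And>k. (\<integral>\<omega>. ?d k (n k) \<omega> \<partial>M) < (1/2) ^ k" by metis
  have "AE \<omega> in M. summable (\<lambda>k. ?d k (n k) \<omega>)"
  proof (rule AE_summable)
    fix k
    have "integrable M (\<lambda>\<omega>. ?d k (n k) \<omega>)"
      by (rule integrable_const_bound[where B = 1]) auto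
    then have "(\<integral>\<^sup>+\<omega>. ennreal (?d k (n k) \<omega>) \<partial>M) = ennreal (\<integral>\<omega>. ?d k (n k) \<omega> \<partial>M)"
      by (intro nn_integral_eq_integral) auto
    also have "\<dots> \<le> ennreal ((1/2) ^ k)" using n[of k] by (intro ennreal_leI) simp
    finally show "(\<integral>\<^sup>+\<omega>. ennreal (?d k (n k) \<omega>) \<partial>M) \<le> ennreal ((1/2) ^ k)" .
  qed (auto simp: summable_geometric)
  then have "AE \<omega> in M. (\<lambda>k. s k (n k) \<omega>) \<longlonglongrightarrow> X \<omega>"
    using lim
  proof eventually_elim
    case (elim \<omega>)
    then have d0: "(\<lambda>k. ?d k (n k) \<omega>) \<longlonglongrightarrow> 0" by (intro summable_LIMSEQ_zero)
    have "(\<lambda>k. norm (s k (n k) \<omega> - Y k \<omega>)) \<longlonglongrightarrow> 0"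
    proof (rule Lim_transform_eventually[OF d0])
      show "\<forall>\<^sub>F k in sequentially. ?d k (n k) \<omega> = norm (s k (n k) \<omega> - Y k \<omega>)"
        using order_tendstoD(2)[OF d0 zero_less_one] by eventually_elim auto
    qed
    then have "(\<lambda>k. s k (n k) \<omega> - Y k \<omega>) \<longlonglongrightarrow> 0" by (simp add: tendsto_norm_zero_iff)
    from tendsto_add[OF this elim(2)] show ?case by simp
  qed
  with s show ?thesis
    unfolding strongly_measurable_def by (intro exI[of _ "\<lambda>k. s k (n k)"]) blast
qed

section \<open>Construction of the stochastic integral as an almost everywhere limit\<close>

context isonormal
begin

lemma W_sum_tensor_simple_approx:
  obtains s where "\<And>n. simple_function M (s n)"
    "\<And>\<omega>. \<omega> \<in> space M \<Longrightarrow> (\<lambda>n. s n \<omega>) \<longlonglongrightarrow> W_sum_tensor N h x \<omega>"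
proof -
  have "\<exists>F. (\<forall>i. simple_function M (F i)) \<and> (\<forall>\<omega>\<in>space M. (\<lambda>i. F i \<omega>) \<longlonglongrightarrow> W (h m) \<omega>)" for m
    using borel_measurable_implies_sequence_metric[OF W_measurable[of "h m"], of 0] by blast
  then obtain F where F: "\<And>m i. simple_function M (F m i)"
    "\<And>m \<omega>. \<omega> \<in> space M \<Longrightarrow> (\<lambda>i. F m i \<omega>) \<longlonglongrightarrow> W (h m) \<omega>"
    by metis
  show ?thesis
  proof (rule that)
    have "simple_function M (\<lambda>\<omega>. F m i \<omega> *\<^sub>R x m)" for m i
      using simple_function_compose1[OF F(1), of "\<lambda>r. r *\<^sub>R x m"] .
    then show "simple_function M (\<lambda>\<omega>. \<Sum>m<N. F m i \<omega> *\<^sub>R x m)" for i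
      by (induction N) (auto intro!: simple_function_compose2[where h = "(+)"])
    show "(\<lambda>i. \<Sum>m<N. F m i \<omega> *\<^sub>R x m) \<longlonglongrightarrow> W_sum_tensor N h x \<omega>" if "\<omega> \<in> space M" for \<omega>
      unfolding W_sum_tensor_def using that by (intro tendsto_intros F(2))
  qed
qed

text \<open>Supplies a witness for the \<open>SOME\<close> in \<open>isonormal_extension\<close>. By
  the isometry a Cauchy sequence for the gamma norm is Cauchy in L2, and the argument is the
  completeness proof for L2: a fast subsequence converges almost everywhere, and Fatou's lemma
  identifies its limit as the L2 limit.\<close>

lemma isonormal_extension_exists:
  fixes R :: "'k \<Rightarrow>\<^sub>L 'e::banach"
  assumes "gamma_radonifying R"
  shows "\<exists>X. X \<in> borel_measurable M \<and> in_L2 M X \<and>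
     (\<exists>N h x. gamma_approximates (\<lambda>i. tensor_sum (N i) (h i) (x i)) R \<and>
        (\<lambda>i. L2_norm M (\<lambda>\<omega>. X \<omega> - (\<Sum>n<N i. W (h i n) \<omega> *\<^sub>R x i n))) \<longlonglongrightarrow> 0)"
proof -
  obtain Rs where Rs: "gamma_approximates Rs R" using assms gamma_radonifying_def by blast
  then have "\<forall>i. \<exists>N h x. Rs i = tensor_sum N h x" by (simp add: gamma_approximates_def)
  then obtain N h x where Rs_eq: "\<And>i. Rs i = tensor_sum (N i) (h i) (x i)" by metis
  define Y where "Y i = W_sum_tensor (N i) (h i) (x i)" for i
  have Y_meas: "Y i \<in> borel_measurable M" for i unfolding Y_def by simp
  have sub_meas: "(\<lambda>\<omega>. X \<omega> - Y i \<omega>) \<in> borel_measurable M" if "X \<in> borel_measurable M" for X i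
    unfolding Y_def using that by (rule diff_W_sum_tensor_measurable)
  have [measurable]: "(\<lambda>\<omega>. norm (Y i \<omega> - Y l \<omega>)) \<in> borel_measurable M" for i l
    using sub_meas[OF Y_meas] by simp
  have Y_L2: "(\<integral>\<^sup>+\<omega>. ennreal ((norm (Y i \<omega>))\<^sup>2) \<partial>M) < \<infinity>" for i
    unfolding Y_def by (rule W_sum_tensor_L2)
  have norm_eq: "gamma_norm (Rs i - Rs l) = L2_norm M (\<lambda>\<omega>. Y i \<omega> - Y l \<omega>)" for i l
    unfolding Rs_eq tensor_sum_diff gamma_norm_tensor_sum Y_def W_sum_tensor_diff ..
  have diff_sq: "(\<integral>\<^sup>+\<omega>. ennreal ((norm (Y i \<omega> - Y l \<omega>))\<^sup>2) \<partial>M) = ennreal ((L2_norm M (\<lambda>\<omega>. Y i \<omega> - Y l \<omega>))\<^sup>2)" for i l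
    using Y_L2 Y_meas by (intro L2_norm_square nn_integral_norm_diff_square)
  have "\<exists>I. \<forall>i\<ge>I. \<forall>l\<ge>I. L2_norm M (\<lambda>\<omega>. Y i \<omega> - Y l \<omega>) < (1/2) ^ k" for k :: nat
    using Rs unfolding gamma_approximates_def norm_eq by simp
  then obtain I where I: "\<And>k i l. I k \<le> i \<Longrightarrow> I k \<le> l \<Longrightarrow> L2_norm M (\<lambda>\<omega>. Y i \<omega> - Y l \<omega>) < (1/2) ^ k"
    by metis
  \<comment> \<open>Summing the thresholds makes \<open>r m\<close> exceed every \<open>I k\<close>
    with \<open>k\<close> at most \<open>m\<close>; this is all that is asked of \<open>r\<close>,
    which need not be strictly increasing.\<close>
  define r where "r k = (\<Sum>m\<le>k. I m)" for k
  have r_ge: "I k \<le> r m" if "k \<le> m" for k m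
    unfolding r_def using that by (intro member_le_sum) auto
  have sq_le: "(\<integral>\<^sup>+\<omega>. ennreal ((norm (Y i \<omega> - Y l \<omega>))\<^sup>2) \<partial>M) \<le> ennreal (((1/2) ^ k)\<^sup>2)"
    if "I k \<le> i" "I k \<le> l" for i l k
    unfolding diff_sq using I[OF that] by (intro ennreal_leI power_mono L2_norm_nonneg) auto
  have "AE \<omega> in M. summable (\<lambda>k. norm (Y (r (Suc k)) \<omega> - Y (r k) \<omega>))"
  proof (rule AE_summable)
    fix k
    \<comment> \<open>Passes from L2 to L1 bounds: the squares integrate to at most
      \<open>((1/2)^k)^2\<close>, so with the factor \<open>2^k\<close> both terms contribute
      \<open>(1/2)^k\<close>, and the increments have summable expectations.\<close>
    have le: "d \<le> (1/2) ^ k + 2 ^ k * d\<^sup>2" if "0 \<le> d" for d :: real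
    proof (cases "d \<le> (1/2) ^ k")
      case True
      then show ?thesis by (simp add: add_increasing2)
    next
      case False
      then have "1 \<le> 2 ^ k * d" by (simp add: power_divide field_simps)
      then have "d * 1 \<le> d * (2 ^ k * d)" using that by (intro mult_left_mono)
      then show ?thesis by (simp add: power2_eq_square mult_ac add_increasing)
    qed
    have "(\<integral>\<^sup>+\<omega>. ennreal (norm (Y (r (Suc k)) \<omega> - Y (r k) \<omega>)) \<partial>M) \<le>
        (\<integral>\<^sup>+\<omega>. ennreal ((1/2) ^ k) + ennreal (2 ^ k) * ennreal ((norm (Y (r (Suc k)) \<omega> - Y (r k) \<omega>))\<^sup>2) \<partial>M)"
      using le by (intro nn_integral_mono) (simp add: ennreal_leI flip: ennreal_mult' ennreal_plus)
    also have "\<dots> = ennreal ((1/2) ^ k) +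
        ennreal (2 ^ k) * (\<integral>\<^sup>+\<omega>. ennreal ((norm (Y (r (Suc k)) \<omega> - Y (r k) \<omega>))\<^sup>2) \<partial>M)"
      by (simp add: nn_integral_add nn_integral_cmult emeasure_space_1)
    also have "\<dots> \<le> ennreal ((1/2) ^ k) + ennreal (2 ^ k) * ennreal (((1/2) ^ k)\<^sup>2)"
      by (intro add_left_mono mult_left_mono sq_le r_ge) auto
    also have "\<dots> = ennreal (2 * (1/2) ^ k)"
      by (simp add: power_divide power2_eq_square flip: ennreal_mult' ennreal_plus)
    finally show "(\<integral>\<^sup>+\<omega>. ennreal (norm (Y (r (Suc k)) \<omega> - Y (r k) \<omega>)) \<partial>M) \<le> ennreal (2 * (1/2) ^ k)" .
  qed (auto simp: summable_geometric)
  then have conv: "AE \<omega> in M. convergent (\<lambda>k. Y (r k) \<omega>)"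
  proof eventually_elim
    case (elim \<omega>)
    then have "summable (\<lambda>k. Y (r (Suc k)) \<omega> - Y (r k) \<omega>)" by (rule summable_norm_cancel)
    then have "convergent (\<lambda>n. Y (r 0) \<omega> + (\<Sum>k<n. Y (r (Suc k)) \<omega> - Y (r k) \<omega>))"
      by (intro convergent_add convergent_const) (simp add: summable_iff_convergent)
    then show ?case by (simp add: sum_lessThan_telescope[of "\<lambda>k. Y (r k) \<omega>"])
  qed
  obtain Z where Z: "{\<omega> \<in> space M. \<not> convergent (\<lambda>k. Y (r k) \<omega>)} \<subseteq> Z" "emeasure M Z = 0" "Z \<in> sets M"
    using conv by (rule AE_E)
  \<comment> \<open>Resetting the approximants to 0 on a measurable null set makes them converge at
    every point of the space. Their limit is then genuinely Borel; an almost everywhere limit would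
    not suffice, as \<open>M\<close> need not be complete.\<close>
  define Y' where "Y' k \<omega> = (if \<omega> \<in> Z then 0 else Y (r k) \<omega>)" for k \<omega>
  define X where "X \<omega> = lim (\<lambda>k. Y' k \<omega>)" for \<omega>
  have Y'_lim: "(\<lambda>k. Y' k \<omega>) \<longlonglongrightarrow> X \<omega>" if "\<omega> \<in> space M" for \<omega>
    using that Z(1) unfolding X_def Y'_def
    by (cases "\<omega> \<in> Z") (auto simp: convergent_LIMSEQ_iff[symmetric] convergent_const)
  have Y'_meas: "Y' k \<in> borel_measurable M" for k
    unfolding Y'_def using Z(3) Y_meas by (intro measurable_If_set) auto
  have X_meas: "X \<in> borel_measurable M"
    using Y'_meas Y'_lim by (rule borel_measurable_LIMSEQ_metric)
  have "AE \<omega> in M. \<omega> \<notin> Z" using Z by (intro AE_not_in null_setsI)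
  then have lim: "AE \<omega> in M. (\<lambda>k. Y (r k) \<omega>) \<longlonglongrightarrow> X \<omega>"
    using AE_space
  proof eventually_elim
    case (elim \<omega>)
    then show ?case using Y'_lim[of \<omega>] by (simp add: Y'_def)
  qed
  have X_diff: "(\<integral>\<^sup>+\<omega>. ennreal ((norm (X \<omega> - Y i \<omega>))\<^sup>2) \<partial>M) \<le> ennreal (((1/2) ^ k)\<^sup>2)" if i: "I k \<le> i" for i k
  proof -
    have "AE \<omega> in M. ennreal ((norm (X \<omega> - Y i \<omega>))\<^sup>2) = liminf (\<lambda>m. ennreal ((norm (Y (r m) \<omega> - Y i \<omega>))\<^sup>2))"
      using lim
    proof eventually_elim
      case (elim \<omega>)
      then have "(\<lambda>m. ennreal ((norm (Y (r m) \<omega> - Y i \<omega>))\<^sup>2)) \<longlonglongrightarrow> ennreal ((norm (X \<omega> - Y i \<omega>))\<^sup>2)"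
        by (intro tendsto_intros)
      from lim_imp_Liminf[OF _ this] show ?case by simp
    qed
    then have "(\<integral>\<^sup>+\<omega>. ennreal ((norm (X \<omega> - Y i \<omega>))\<^sup>2) \<partial>M) =
        (\<integral>\<^sup>+\<omega>. liminf (\<lambda>m. ennreal ((norm (Y (r m) \<omega> - Y i \<omega>))\<^sup>2)) \<partial>M)"
      by (rule nn_integral_cong_AE)
    \<comment> \<open>Fatou's lemma transfers the Cauchy estimate for large \<open>m\<close> to the
      limit \<open>X\<close>.\<close>
    also have "\<dots> \<le> liminf (\<lambda>m. \<integral>\<^sup>+\<omega>. ennreal ((norm (Y (r m) \<omega> - Y i \<omega>))\<^sup>2) \<partial>M)"
      by (rule nn_integral_liminf) simp
    also have "\<dots> \<le> ennreal (((1/2) ^ k)\<^sup>2)"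
    proof (rule Liminf_le)
      show "\<forall>\<^sub>F m in sequentially. (\<integral>\<^sup>+\<omega>. ennreal ((norm (Y (r m) \<omega> - Y i \<omega>))\<^sup>2) \<partial>M) \<le> ennreal (((1/2) ^ k)\<^sup>2)"
        using eventually_ge_at_top[of k] by eventually_elim (intro sq_le r_ge i)
    qed simp
    finally show ?thesis .
  qed
  have X_L2: "(\<integral>\<^sup>+\<omega>. ennreal ((norm (X \<omega>))\<^sup>2) \<partial>M) < \<infinity>"
  proof -
    \<comment> \<open>\<open>X\<close> is written as a difference so that
      \<open>nn_integral_norm_diff_square\<close> applies with two square-integrable terms.\<close>
    have "(\<integral>\<^sup>+\<omega>. ennreal ((norm ((X \<omega> - Y (I 0) \<omega>) - (- Y (I 0) \<omega>)))\<^sup>2) \<partial>M) < \<infinity>"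
    proof (rule nn_integral_norm_diff_square)
      show "(\<integral>\<^sup>+\<omega>. ennreal ((norm (X \<omega> - Y (I 0) \<omega>))\<^sup>2) \<partial>M) < \<infinity>"
        using X_diff[of 0 "I 0"] by (simp add: order_le_less_trans)
      show "(\<integral>\<^sup>+\<omega>. ennreal ((norm (- Y (I 0) \<omega>))\<^sup>2) \<partial>M) < \<infinity>" using Y_L2 by simp
      show "(\<lambda>\<omega>. X \<omega> - Y (I 0) \<omega>) \<in> borel_measurable M" using X_meas by (rule sub_meas)
      show "(\<lambda>\<omega>. - Y (I 0) \<omega>) \<in> borel_measurable M"
        using sub_meas[of "\<lambda>_. 0" "I 0"] by simp
    qed
    then show ?thesis by simp
  qed
  have "strongly_measurable M X"
  proof -
    have "\<exists>s. (\<forall>n. simple_function M (s n)) \<and> (\<forall>\<omega>\<in>space M. (\<lambda>n. s n \<omega>) \<longlonglongrightarrow> Y i \<omega>)" for i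
      unfolding Y_def using W_sum_tensor_simple_approx by metis
    then obtain s where s: "\<And>i n. simple_function M (s i n)"
      "\<And>i \<omega>. \<omega> \<in> space M \<Longrightarrow> (\<lambda>n. s i n \<omega>) \<longlonglongrightarrow> Y i \<omega>"
      by metis
    show ?thesis
    proof (rule strongly_measurable_AE_limit[where s = "\<lambda>k. s (r k)" and Y = "\<lambda>k. Y (r k)"])
      show "(\<lambda>\<omega>. s (r k) n \<omega> - Y (r k) \<omega>) \<in> borel_measurable M" for k n
        by (intro sub_meas borel_measurable_simple_function s)
    qed (use s lim in auto)
  qed
  then have "in_L2 M X" using X_L2 by (simp add: in_L2_def)
  moreover have "gamma_approximates (\<lambda>i. tensor_sum (N i) (h i) (x i)) R"
    using Rs by (simp flip: Rs_eq)
  moreover have "(\<lambda>i. L2_norm M (\<lambda>\<omega>. X \<omega> - (\<Sum>n<N i. W (h i n) \<omega> *\<^sub>R x i n))) \<longlonglongrightarrow> 0"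
  proof (rule LIMSEQ_I)
    fix \<epsilon> :: real assume "0 < \<epsilon>"
    obtain k where k: "(1/2) ^ k < \<epsilon>" using real_arch_pow_inv[OF \<open>0 < \<epsilon>\<close>, of "1/2"] by auto
    have "norm (L2_norm M (\<lambda>\<omega>. X \<omega> - Y i \<omega>) - 0) < \<epsilon>" if "I k \<le> i" for i
    proof -
      have "(\<integral>\<^sup>+\<omega>. ennreal ((norm (X \<omega> - Y i \<omega>))\<^sup>2) \<partial>M) = ennreal ((L2_norm M (\<lambda>\<omega>. X \<omega> - Y i \<omega>))\<^sup>2)"
        using X_diff[OF that] by (intro L2_norm_square) (simp add: order_le_less_trans)
      then have "(L2_norm M (\<lambda>\<omega>. X \<omega> - Y i \<omega>))\<^sup>2 \<le> ((1/2) ^ k)\<^sup>2"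
        using X_diff[OF that] by (simp add: ennreal_le_iff)
      then have "L2_norm M (\<lambda>\<omega>. X \<omega> - Y i \<omega>) \<le> (1/2) ^ k"
        by (rule power2_le_imp_le) simp
      then show ?thesis using k L2_norm_nonneg[of M "\<lambda>\<omega>. X \<omega> - Y i \<omega>"] by simp
    qed
    then show "\<exists>n0. \<forall>i\<ge>n0. norm (L2_norm M (\<lambda>\<omega>. X \<omega> - (\<Sum>n<N i. W (h i n) \<omega> *\<^sub>R x i n)) - 0) < \<epsilon>"
      unfolding Y_def W_sum_tensor_def by blast
  qed
  ultimately show ?thesis using X_meas by blast
qed

text \<open>The interface to \<open>isonormal_extension\<close>: the chosen version comes with some
  approximating sequence of tensors, and a subsequence gives convergence in operator norm and almost
  everywhere at once.\<close>

lemma isonormal_extension_approx: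
  fixes R :: "'k \<Rightarrow>\<^sub>L 'e::banach"
  assumes "gamma_radonifying R"
  obtains N h x where "isonormal_extension M W R \<in> borel_measurable M"
    "(\<lambda>i. tensor_sum (N i) (h i) (x i)) \<longlonglongrightarrow> R"
    "AE \<omega> in M. (\<lambda>i. W_sum_tensor (N i) (h i) (x i) \<omega>) \<longlonglongrightarrow> isonormal_extension M W R \<omega>"
proof -
  let ?X = "isonormal_extension M W R"
  have "?X \<in> borel_measurable M \<and> in_L2 M ?X \<and>
     (\<exists>N h x. gamma_approximates (\<lambda>i. tensor_sum (N i) (h i) (x i)) R \<and>
        (\<lambda>i. L2_norm M (\<lambda>\<omega>. ?X \<omega> - (\<Sum>n<N i. W (h i n) \<omega> *\<^sub>R x i n))) \<longlonglongrightarrow> 0)"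
    unfolding isonormal_extension_def using isonormal_extension_exists[OF assms] by (rule someI_ex)
  then obtain N h x where X: "?X \<in> borel_measurable M" "in_L2 M ?X"
    and approx: "gamma_approximates (\<lambda>i. tensor_sum (N i) (h i) (x i)) R"
    and lim: "(\<lambda>i. L2_norm M (\<lambda>\<omega>. ?X \<omega> - W_sum_tensor (N i) (h i) (x i) \<omega>)) \<longlonglongrightarrow> 0"
    unfolding W_sum_tensor_def by blast
  obtain r :: "nat \<Rightarrow> nat" where r: "strict_mono r"
    and AE: "AE \<omega> in M. (\<lambda>i. ?X \<omega> - W_sum_tensor (N (r i)) (h (r i)) (x (r i)) \<omega>) \<longlonglongrightarrow> 0"
  proof (rule L2_norm_tendsto_AE_subseq[OF _ _ lim])
    show "(\<lambda>\<omega>. ?X \<omega> - W_sum_tensor (N i) (h i) (x i) \<omega>) \<in> borel_measurable M" for i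
      using X(1) by (rule diff_W_sum_tensor_measurable)
    show "(\<integral>\<^sup>+\<omega>. ennreal ((norm (?X \<omega> - W_sum_tensor (N i) (h i) (x i) \<omega>))\<^sup>2) \<partial>M) < \<infinity>" for i
      using X by (intro nn_integral_norm_diff_square W_sum_tensor_L2) (auto simp: in_L2_def)
  qed blast
  have "(\<lambda>i. tensor_sum (N i) (h i) (x i)) \<longlonglongrightarrow> R" using approx by (simp add: gamma_approximates_def)
  then have "(\<lambda>i. tensor_sum (N (r i)) (h (r i)) (x (r i))) \<longlonglongrightarrow> R"
    using LIMSEQ_subseq_LIMSEQ[OF _ r] by (fastforce simp: o_def)
  moreover have "AE \<omega> in M. (\<lambda>i. W_sum_tensor (N (r i)) (h (r i)) (x (r i)) \<omega>) \<longlonglongrightarrow> ?X \<omega>"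
    using AE
  proof eventually_elim
    case (elim \<omega>)
    from tendsto_diff[OF tendsto_const this, of "?X \<omega>"] show ?case by simp
  qed
  ultimately show ?thesis using that[of "\<lambda>i. N (r i)" "\<lambda>i. h (r i)" "\<lambda>i. x (r i)"] X(1) by blast
qed

end

subsection \<open>Translations of Gaussian measures\<close>

text \<open>The Cameron-Martin formula in dimension one: substitute \<open>x + a\<close> and
  complete the square in the exponent.\<close>

lemma nn_integral_std_normal_shift:
  fixes f :: "real \<Rightarrow> ennreal"
  assumes [measurable]: "f \<in> borel_measurable borel"
  shows "(\<integral>\<^sup>+x. ennreal (exp (a * x - a\<^sup>2 / 2)) * f x \<partial>std_normal_distribution) =
    (\<integral>\<^sup>+x. f (x + a) \<partial>std_normal_distribution)"
proof -
  have dens: "std_normal_density (x + a) * exp (a * (x + a) - a\<^sup>2 / 2) = std_normal_density x" for x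
  proof -
    have "- (x + a)\<^sup>2 / 2 + (a * (x + a) - a\<^sup>2 / 2) = - x\<^sup>2 / 2"
      by (simp add: power2_eq_square field_simps)
    then show ?thesis
      unfolding std_normal_density_def mult.assoc exp_add[symmetric] by simp
  qed
  have "(\<integral>\<^sup>+x. ennreal (exp (a * x - a\<^sup>2 / 2)) * f x \<partial>std_normal_distribution) =
      (\<integral>\<^sup>+x. ennreal (std_normal_density x) * (ennreal (exp (a * x - a\<^sup>2 / 2)) * f x) \<partial>lborel)"
    by (rule nn_integral_density) auto
  also have "\<dots> = (\<integral>\<^sup>+x. ennreal (std_normal_density x * exp (a * x - a\<^sup>2 / 2)) * f x \<partial>lborel)"
    by (simp add: ennreal_mult mult.assoc)
  also have "\<dots> = (\<integral>\<^sup>+x. ennreal (std_normal_density (x + a) * exp (a * (x + a) - a\<^sup>2 / 2)) * f (x + a) \<partial>lborel)"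
    by (subst nn_integral_real_affine[where c = 1 and t = a]) (auto simp: add.commute)
  also have "\<dots> = (\<integral>\<^sup>+x. ennreal (std_normal_density x) * f (x + a) \<partial>lborel)"
    unfolding dens ..
  also have "\<dots> = (\<integral>\<^sup>+x. f (x + a) \<partial>std_normal_distribution)"
    by (rule nn_integral_density[symmetric]) auto
  finally show ?thesis .
qed

text \<open>Closed sets form an intersection-stable generator, and the indicator of a nonempty
  closed \<open>F\<close> is the limit of the continuous functions
  \<open>max 0 (1 - n * infdist x F)\<close>. Separability of the space is never involved.\<close>

lemma borel_measure_eqI_continuous:
  fixes \<mu> \<nu> :: "'e::metric_space measure"
  assumes sets: "sets \<mu> = sets borel" "sets \<nu> = sets borel" and fin: "emeasure \<mu> UNIV \<noteq> \<infinity>"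
    and eq: "\<And>\<phi> :: 'e \<Rightarrow> real. continuous_on UNIV \<phi> \<Longrightarrow> (\<And>x. 0 \<le> \<phi> x) \<Longrightarrow> (\<And>x. \<phi> x \<le> 1) \<Longrightarrow>
      (\<integral>\<^sup>+x. ennreal (\<phi> x) \<partial>\<mu>) = (\<integral>\<^sup>+x. ennreal (\<phi> x) \<partial>\<nu>)"
  shows "\<mu> = \<nu>"
proof (rule measure_eqI_generator_eq[where E = "Collect closed" and \<Omega> = UNIV and A = "\<lambda>_. UNIV"])
  show "sets \<mu> = sigma_sets UNIV (Collect closed)" "sets \<nu> = sigma_sets UNIV (Collect closed)"
    unfolding sets borel_eq_closed by simp_all
  show "Int_stable (Collect (closed :: 'e set \<Rightarrow> bool))" by (auto simp: Int_stable_def)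
  fix F :: "'e set" assume "F \<in> Collect closed"
  then have F: "closed F" by simp
  then have F': "F \<in> sets borel" by simp
  show "emeasure \<mu> F = emeasure \<nu> F"
  \<comment> \<open>\<open>infdist\<close> to the empty set is 0 by convention, so the approximating
    functions would be constantly 1 there.\<close>
  proof (cases "F = {}")
    case False
    define \<phi> where "\<phi> n x = max 0 (1 - real n * infdist x F)" for n x
    have cont: "continuous_on UNIV (\<phi> n)" for n
      unfolding \<phi>_def by (intro continuous_intros)
    have lim: "(\<lambda>n. \<phi> n x) \<longlonglongrightarrow> indicator F x" for x
    proof (cases "x \<in> F")
      case True
      then show ?thesis by (simp add: \<phi>_def)
    next
      case xF: False
      then have "infdist x F > 0" using F False by (simp add: in_closed_iff_infdist_zero infdist_pos_not_in_closed)
      then obtain n0 where n0: "1 < real n0 * infdist x F" using ex_less_of_nat_mult by blast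
      have "\<forall>\<^sub>F n in sequentially. \<phi> n x = 0"
        using eventually_ge_at_top[of n0]
      proof eventually_elim
        case (elim n)
        then have "real n0 * infdist x F \<le> real n * infdist x F"
          by (intro mult_right_mono) (auto simp: infdist_nonneg)
        then show ?case using n0 by (simp add: \<phi>_def)
      qed
      then show ?thesis using xF by (simp add: tendsto_eventually)
    qed
    have conv: "(\<lambda>n. \<integral>\<^sup>+x. ennreal (\<phi> n x) \<partial>\<kappa>) \<longlonglongrightarrow> emeasure \<kappa> F"
      if \<kappa>: "sets \<kappa> = sets borel" "emeasure \<kappa> UNIV \<noteq> \<infinity>" for \<kappa>
    proof -
      have "(\<lambda>n. \<integral>\<^sup>+x. ennreal (\<phi> n x) \<partial>\<kappa>) \<longlonglongrightarrow> (\<integral>\<^sup>+x. ennreal (indicator F x) \<partial>\<kappa>)"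
      proof (rule nn_integral_dominated_convergence[where w = "\<lambda>_. 1"])
        show "(\<lambda>x. ennreal (\<phi> n x)) \<in> borel_measurable \<kappa>" for n
          unfolding measurable_cong_sets[OF \<kappa>(1) refl]
          using borel_measurable_continuous_onI[OF cont[of n]] by simp
        show "(\<lambda>x. ennreal (indicator F x)) \<in> borel_measurable \<kappa>"
          unfolding measurable_cong_sets[OF \<kappa>(1) refl] using F' by simp
        show "(\<integral>\<^sup>+x. 1 \<partial>\<kappa>) < \<infinity>"
          using \<kappa> sets_eq_imp_space_eq[OF \<kappa>(1)] by (simp add: less_top)
        show "AE x in \<kappa>. (\<lambda>n. ennreal (\<phi> n x)) \<longlonglongrightarrow> ennreal (indicator F x)"
          using lim by (intro AE_I2 tendsto_ennrealI)
        show "AE x in \<kappa>. ennreal (\<phi> n x) \<le> 1" for n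
          by (intro AE_I2) (simp add: \<phi>_def infdist_nonneg)
      qed simp
      also have "(\<integral>\<^sup>+x. ennreal (indicator F x) \<partial>\<kappa>) = emeasure \<kappa> F"
        using F' \<kappa>(1) by (simp add: ennreal_indicator)
      finally show ?thesis .
    qed
    \<comment> \<open>The constant test function 1 transfers finiteness from \<open>\<mu>\<close> to
      \<open>\<nu>\<close>, as dominated convergence needs it for both.\<close>
    have "emeasure \<nu> UNIV = emeasure \<mu> UNIV"
      using eq[of "\<lambda>_. 1"] sets_eq_imp_space_eq[OF sets(1)] sets_eq_imp_space_eq[OF sets(2)] by simp
    then have "(\<lambda>n. \<integral>\<^sup>+x. ennreal (\<phi> n x) \<partial>\<nu>) \<longlonglongrightarrow> emeasure \<nu> F"
      using fin sets by (intro conv) auto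
    moreover have "(\<lambda>n. \<integral>\<^sup>+x. ennreal (\<phi> n x) \<partial>\<mu>) \<longlonglongrightarrow> emeasure \<mu> F"
      using fin sets by (intro conv) auto
    moreover have "(\<integral>\<^sup>+x. ennreal (\<phi> n x) \<partial>\<mu>) = (\<integral>\<^sup>+x. ennreal (\<phi> n x) \<partial>\<nu>)" for n
      by (rule eq[OF cont]) (auto simp: \<phi>_def infdist_nonneg)
    ultimately show ?thesis using LIMSEQ_unique by simp
  qed simp
qed (use fin in auto)

section \<open>The Cameron-Martin formula\<close>

context isonormal
begin

text \<open>Both sides are the product of the shifted one-dimensional laws: the exponential density
  factors over the coordinates, so on rectangles the claim reduces to
  \<open>nn_integral_std_normal_shift\<close>.\<close>

lemma gauss_shift:
  fixes a :: "nat \<Rightarrow> real"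
  shows "density (gauss N) (\<lambda>\<gamma>. ennreal (exp (\<Sum>n<N. a n * \<gamma> n - (a n)\<^sup>2 / 2))) =
    distr (gauss N) (\<Pi>\<^sub>M n\<in>{..<N}. borel) (\<lambda>\<gamma>. \<lambda>n\<in>{..<N}. \<gamma> n + a n)" (is "?P = ?Q")
proof -
  interpret N: real_distribution std_normal_distribution by (rule real_dist_normal_dist)
  interpret G: product_sigma_finite "\<lambda>n::nat. std_normal_distribution" by standard
  have D: "prob_space (distr std_normal_distribution borel (\<lambda>x. x + a n))" for n
    by (intro N.prob_space_distr) simp
  interpret S: product_sigma_finite "\<lambda>n::nat. distr std_normal_distribution borel (\<lambda>x. x + a n)"
    using D by (simp add: product_sigma_finite_def prob_space_imp_sigma_finite)
  let ?S = "\<Pi>\<^sub>M n\<in>{..<N}. distr std_normal_distribution borel (\<lambda>x. x + a n)"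
  have setsS: "sets ?S = sets (\<Pi>\<^sub>M n\<in>{..<N}. borel)" by (intro sets_PiM_cong) auto
  have comp: "(\<lambda>\<gamma>. \<gamma> n) \<in> borel_measurable (gauss N)" if "n < N" for n
    unfolding measurable_cong_sets[OF sets_gauss refl]
    using that by (intro measurable_component_singleton) simp
  have dens: "(\<lambda>\<gamma>. ennreal (exp (\<Sum>n<N. a n * \<gamma> n - (a n)\<^sup>2 / 2))) \<in> borel_measurable (gauss N)"
    using comp by (intro measurable_compose[OF _ measurable_ennreal] borel_measurable_exp
        borel_measurable_sum borel_measurable_diff borel_measurable_times) auto
  have shift: "(\<lambda>\<gamma>. \<lambda>n\<in>{..<N}. \<gamma> n + a n) \<in> measurable (gauss N) (\<Pi>\<^sub>M n\<in>{..<N}. borel)"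
    using comp by (intro measurable_restrict borel_measurable_add) auto
  have em: "emeasure (distr std_normal_distribution borel (\<lambda>x. x + a n)) A =
      (\<integral>\<^sup>+x. ennreal (exp (a n * x - (a n)\<^sup>2 / 2)) * indicator A x \<partial>std_normal_distribution)"
    if A: "A \<in> sets borel" for A n
  proof -
    have "emeasure (distr std_normal_distribution borel (\<lambda>x. x + a n)) A =
        (\<integral>\<^sup>+x. indicator A x \<partial>distr std_normal_distribution borel (\<lambda>x. x + a n))"
      using A by simp
    also have "\<dots> = (\<integral>\<^sup>+x. indicator A (x + a n) \<partial>std_normal_distribution)"
      using A by (intro nn_integral_distr) auto
    also have "\<dots> = (\<integral>\<^sup>+x. ennreal (exp (a n * x - (a n)\<^sup>2 / 2)) * indicator A x \<partial>std_normal_distribution)"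
      using A by (intro nn_integral_std_normal_shift[symmetric]) auto
    finally show ?thesis .
  qed
  have "?P = ?S"
  proof (rule S.PiM_eqI)
    show "sets ?P = sets ?S" unfolding setsS by (simp add: sets_gauss)
    fix A :: "nat \<Rightarrow> real set"
    assume "\<And>n. n \<in> {..<N} \<Longrightarrow> A n \<in> sets (distr std_normal_distribution borel (\<lambda>x. x + a n))"
    then have A: "A n \<in> sets borel" if "n < N" for n using that by simp
    have PiE: "Pi\<^sub>E {..<N} A \<in> sets (gauss N)"
      unfolding sets_gauss by (rule sets_PiM_I_finite) (simp_all add: A)
    have "emeasure ?P (Pi\<^sub>E {..<N} A) =
        (\<integral>\<^sup>+\<gamma>. ennreal (exp (\<Sum>n<N. a n * \<gamma> n - (a n)\<^sup>2 / 2)) * indicator (Pi\<^sub>E {..<N} A) \<gamma> \<partial>gauss N)"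
      by (rule emeasure_density[OF dens PiE])
    also have "\<dots> = (\<integral>\<^sup>+\<gamma>. (\<Prod>n<N. ennreal (exp (a n * \<gamma> n - (a n)\<^sup>2 / 2)) * indicator (A n) (\<gamma> n)) \<partial>gauss N)"
    proof (rule nn_integral_cong)
      fix \<gamma> assume "\<gamma> \<in> space (gauss N)"
      then have ext: "\<gamma> \<in> extensional {..<N}" by (simp add: space_PiM PiE_def)
      have "indicator (Pi\<^sub>E {..<N} A) \<gamma> = (\<Prod>n<N. indicator (A n) (\<gamma> n) :: ennreal)"
      proof (cases "\<gamma> \<in> Pi\<^sub>E {..<N} A")
        case True
        then have "\<gamma> n \<in> A n" if "n < N" for n using that by (simp add: PiE_mem)
        then have "(\<Prod>n<N. indicator (A n) (\<gamma> n) :: ennreal) = 1" by (intro prod.neutral) simp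
        then show ?thesis using True by simp
      next
        case False
        then obtain n where n: "n < N" "\<gamma> n \<notin> A n" using ext unfolding PiE_iff by blast
        then have "(\<Prod>n<N. indicator (A n) (\<gamma> n) :: ennreal) = 0"
          by (intro prod_zero) (simp_all, rule bexI[of _ n], simp_all)
        then show ?thesis using False by simp
      qed
      moreover have "ennreal (exp (\<Sum>n<N. a n * \<gamma> n - (a n)\<^sup>2 / 2)) =
          (\<Prod>n<N. ennreal (exp (a n * \<gamma> n - (a n)\<^sup>2 / 2)))"
        by (simp add: exp_sum prod_ennreal)
      ultimately show "ennreal (exp (\<Sum>n<N. a n * \<gamma> n - (a n)\<^sup>2 / 2)) * indicator (Pi\<^sub>E {..<N} A) \<gamma> =
          (\<Prod>n<N. ennreal (exp (a n * \<gamma> n - (a n)\<^sup>2 / 2)) * indicator (A n) (\<gamma> n))"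
        by (simp add: prod.distrib)
    qed
    also have "\<dots> = (\<Prod>n<N. \<integral>\<^sup>+x. ennreal (exp (a n * x - (a n)\<^sup>2 / 2)) * indicator (A n) x \<partial>std_normal_distribution)"
      using A by (intro G.product_nn_integral_prod) auto
    also have "\<dots> = (\<Prod>n\<in>{..<N}. emeasure (distr std_normal_distribution borel (\<lambda>x. x + a n)) (A n))"
      using A by (intro prod.cong refl em[symmetric]) auto
    finally show "emeasure ?P (Pi\<^sub>E {..<N} A) =
        (\<Prod>n\<in>{..<N}. emeasure (distr std_normal_distribution borel (\<lambda>x. x + a n)) (A n))" .
  qed simp
  moreover have "?Q = ?S"
  proof (rule S.PiM_eqI)
    show "sets ?Q = sets ?S" unfolding setsS by simp
    fix A :: "nat \<Rightarrow> real set"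
    assume "\<And>n. n \<in> {..<N} \<Longrightarrow> A n \<in> sets (distr std_normal_distribution borel (\<lambda>x. x + a n))"
    then have A: "A n \<in> sets borel" if "n < N" for n using that by simp
    have PiE: "Pi\<^sub>E {..<N} A \<in> sets (\<Pi>\<^sub>M n\<in>{..<N}. borel)"
      by (rule sets_PiM_I_finite) (simp_all add: A)
    define B where "B n = (\<lambda>x. x + a n) -` A n" for n
    have B: "B n \<in> sets borel" if "n < N" for n
      unfolding B_def using measurable_sets[of "\<lambda>x. x + a n" borel borel "A n"] A[OF that] by simp
    have pre: "(\<lambda>\<gamma>. \<lambda>n\<in>{..<N}. \<gamma> n + a n) -` Pi\<^sub>E {..<N} A \<inter> space (gauss N) = Pi\<^sub>E {..<N} B"
      unfolding restrict_vimage_PiE by (simp add: B_def space_PiM PiE_iff set_eq_iff conj_commute)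
    have "emeasure ?Q (Pi\<^sub>E {..<N} A) = emeasure (gauss N) (Pi\<^sub>E {..<N} B)"
      unfolding emeasure_distr[OF shift PiE] pre ..
    also have "\<dots> = (\<Prod>n\<in>{..<N}. emeasure std_normal_distribution (B n))"
      by (rule G.emeasure_PiM) (simp_all add: B)
    also have "\<dots> = (\<Prod>n\<in>{..<N}. emeasure (distr std_normal_distribution borel (\<lambda>x. x + a n)) (A n))"
      using A by (intro prod.cong refl) (simp add: emeasure_distr B_def)
    finally show "emeasure ?Q (Pi\<^sub>E {..<N} A) =
        (\<Prod>n\<in>{..<N}. emeasure (distr std_normal_distribution borel (\<lambda>x. x + a n)) (A n))" .
  qed simp
  ultimately show ?thesis by simp
qed

definition cm_density :: "'k \<Rightarrow> 'w \<Rightarrow> real" where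
  "cm_density h \<omega> = exp (W h \<omega> - (norm h)\<^sup>2 / 2)"

lemma cm_density_measurable [measurable]: "cm_density h \<in> borel_measurable M"
  unfolding cm_density_def by measurable

text \<open>In an orthonormal system spanning \<open>h\<close> and all the \<open>g m\<close>, both
  the tensor and \<open>W h\<close> are functions of the same finitely many independent Gaussians.
  There \<open>gauss_shift\<close> applies, and shifting the coordinates by those of
  \<open>h\<close> shifts the tensor by \<open>tensor_sum N g x h\<close>.\<close>

lemma cameron_martin_tensor:
  fixes x :: "nat \<Rightarrow> 'e::banach" and \<phi> :: "'e \<Rightarrow> ennreal"
  assumes \<phi>: "\<phi> \<in> borel_measurable borel"
  shows "(\<integral>\<^sup>+\<omega>. ennreal (cm_density h \<omega>) * \<phi> (W_sum_tensor N g x \<omega>) \<partial>M) =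
    (\<integral>\<^sup>+\<omega>. \<phi> (W_sum_tensor N g x \<omega> + tensor_sum N g x h) \<partial>M)"
proof -
  \<comment> \<open>\<open>h\<close> is appended to the family at index \<open>N\<close>, so that
    its coordinates capture its full norm.\<close>
  obtain L e where e: "orthonormal_upto L e" and gh: "\<forall>m<N + 1.
      concat_seq N g (\<lambda>_. h) m = (\<Sum>l<L. (concat_seq N g (\<lambda>_. h) m \<bullet> e l) *\<^sub>R e l)"
    using gram_schmidt[of "N + 1" "concat_seq N g (\<lambda>_. h)"] by blast
  define a where "a l = h \<bullet> e l" for l
  have g: "g m = (\<Sum>l<L. (g m \<bullet> e l) *\<^sub>R e l)" if "m < N" for m
    using gh[rule_format, of m] that by (simp add: concat_seq_def)
  have h: "h = (\<Sum>l<L. a l *\<^sub>R e l)"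
    using gh[rule_format, of N] unfolding a_def by (simp add: concat_seq_def)
  define y where "y l = tensor_sum N g x (e l)" for l
  have Rh: "tensor_sum N g x h = (\<Sum>l<L. a l *\<^sub>R y l)"
    by (subst h) (simp add: y_def blinfun.sum_right blinfun.scaleR_right)
  have "(norm h)\<^sup>2 = h \<bullet> (\<Sum>l<L. a l *\<^sub>R e l)" using h by (simp add: power2_norm_eq_inner)
  then have norm_h: "(norm h)\<^sup>2 = (\<Sum>l<L. (a l)\<^sup>2)"
    by (simp add: inner_sum_right a_def power2_eq_square)
  have Y: "AE \<omega> in M. W_sum_tensor N g x \<omega> = (\<Sum>l<L. W (e l) \<omega> *\<^sub>R y l)"
    using W_sum_tensor_basis(2)[where N = N and h = g and L = L and e = e and x = x, OF g]
    unfolding y_def W_sum_tensor_def .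
  have Wh: "AE \<omega> in M. W h \<omega> = (\<Sum>l<L. a l * W (e l) \<omega>)"
    using W_sum[where N = L and c = a and h = e] h by simp
  define F where "F \<gamma> = \<phi> (\<Sum>l<L. \<gamma> l *\<^sub>R y l)" for \<gamma>
  define Z where "Z \<gamma> = ennreal (exp (\<Sum>l<L. a l * \<gamma> l - (a l)\<^sup>2 / 2))" for \<gamma> :: "nat \<Rightarrow> real"
  let ?s = "\<lambda>\<gamma>. \<lambda>l\<in>{..<L}. \<gamma> l + a l"
  have F_meas: "F \<in> borel_measurable (\<Pi>\<^sub>M n\<in>{..<L}. borel)"
    unfolding F_def by (rule measurable_compose[OF gauss_sum_measurable \<phi>])
  have comp: "(\<lambda>\<gamma>. \<gamma> l) \<in> borel_measurable (\<Pi>\<^sub>M n\<in>{..<L}. borel)" if "l < L" for l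
    using that by (intro measurable_component_singleton) simp
  have Z_meas: "Z \<in> borel_measurable (\<Pi>\<^sub>M n\<in>{..<L}. borel)"
    unfolding Z_def using comp by (intro measurable_compose[OF _ measurable_ennreal] borel_measurable_exp
        borel_measurable_sum borel_measurable_diff borel_measurable_times) auto
  have s_meas: "?s \<in> measurable (\<Pi>\<^sub>M n\<in>{..<L}. borel) (\<Pi>\<^sub>M n\<in>{..<L}. borel)"
    using comp by (intro measurable_restrict borel_measurable_add) auto
  have "(\<integral>\<^sup>+\<omega>. ennreal (cm_density h \<omega>) * \<phi> (W_sum_tensor N g x \<omega>) \<partial>M) =
      (\<integral>\<^sup>+\<omega>. (\<lambda>\<gamma>. Z \<gamma> * F \<gamma>) (\<lambda>n\<in>{..<L}. W (e n) \<omega>) \<partial>M)"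
  proof (rule nn_integral_cong_AE)
    show "AE \<omega> in M. ennreal (cm_density h \<omega>) * \<phi> (W_sum_tensor N g x \<omega>) =
        (\<lambda>\<gamma>. Z \<gamma> * F \<gamma>) (\<lambda>n\<in>{..<L}. W (e n) \<omega>)"
      using Y Wh
      by eventually_elim
        (simp add: F_def Z_def cm_density_def norm_h sum_subtractf sum_divide_distrib)
  qed
  also have "\<dots> = (\<integral>\<^sup>+\<gamma>. Z \<gamma> * F \<gamma> \<partial>gauss L)"
    using F_meas Z_meas by (intro nn_integral_orthonormal[OF e]) auto
  also have "\<dots> = (\<integral>\<^sup>+\<gamma>. F \<gamma> \<partial>density (gauss L) Z)"
    using F_meas Z_meas
    by (intro nn_integral_density[symmetric]) (simp_all add: measurable_cong_sets[OF sets_gauss refl])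
  also have "density (gauss L) Z = distr (gauss L) (\<Pi>\<^sub>M n\<in>{..<L}. borel) ?s"
    unfolding Z_def by (rule gauss_shift)
  also have "(\<integral>\<^sup>+\<gamma>. F \<gamma> \<partial>distr (gauss L) (\<Pi>\<^sub>M n\<in>{..<L}. borel) ?s) = (\<integral>\<^sup>+\<gamma>. F (?s \<gamma>) \<partial>gauss L)"
    using F_meas s_meas
    by (intro nn_integral_distr) (simp_all add: measurable_cong_sets[OF sets_gauss refl])
  also have "\<dots> = (\<integral>\<^sup>+\<omega>. F (?s (\<lambda>n\<in>{..<L}. W (e n) \<omega>)) \<partial>M)"
    using measurable_compose[OF s_meas F_meas] by (intro nn_integral_orthonormal[OF e, symmetric])
  also have "\<dots> = (\<integral>\<^sup>+\<omega>. \<phi> (W_sum_tensor N g x \<omega> + tensor_sum N g x h) \<partial>M)"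
  proof (rule nn_integral_cong_AE)
    show "AE \<omega> in M. F (?s (\<lambda>n\<in>{..<L}. W (e n) \<omega>)) = \<phi> (W_sum_tensor N g x \<omega> + tensor_sum N g x h)"
      using Y by eventually_elim (simp add: F_def Rh scaleR_add_left sum.distrib)
  qed
  finally show ?thesis .
qed

lemma nn_integral_cm_density: "(\<integral>\<^sup>+\<omega>. ennreal (cm_density h \<omega>) \<partial>M) = 1"
  using cameron_martin_tensor[of "\<lambda>_. 1" h 0 "\<lambda>_. 0" "\<lambda>_. 0 :: real"] by (simp add: emeasure_space_1)

text \<open>Passes to the limit in \<open>cameron_martin_tensor\<close> for continuous
  \<open>\<phi>\<close> with values between 0 and 1. Almost everywhere convergence handles the
  random part, operator-norm convergence the shift; the dominating functions are
  \<open>cm_density h\<close> on one side and 1 on the other.\<close>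

theorem cameron_martin:
  fixes R :: "'k \<Rightarrow>\<^sub>L 'e::banach"
  assumes R: "gamma_radonifying R"
  defines "X \<equiv> isonormal_extension M W R"
  shows "distr (density M (\<lambda>\<omega>. ennreal (cm_density h \<omega>))) borel X = distr M borel (\<lambda>\<omega>. X \<omega> + R h)"
proof -
  obtain N g x where X_meas: "X \<in> borel_measurable M"
    and lim: "(\<lambda>i. tensor_sum (N i) (g i) (x i)) \<longlonglongrightarrow> R"
    and AE_lim: "AE \<omega> in M. (\<lambda>i. W_sum_tensor (N i) (g i) (x i) \<omega>) \<longlonglongrightarrow> X \<omega>"
    unfolding X_def by (rule isonormal_extension_approx[OF R])
  have X_meas': "X \<in> borel_measurable (density M (\<lambda>\<omega>. ennreal (cm_density h \<omega>)))"
    using X_meas by simp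
  have Xh_meas: "(\<lambda>\<omega>. X \<omega> + R h) \<in> borel_measurable M"
    by (rule measurable_compose[OF X_meas]) (auto intro!: borel_measurable_continuous_onI continuous_intros)
  show ?thesis
  proof (rule borel_measure_eqI_continuous)
    show "emeasure (distr (density M (\<lambda>\<omega>. ennreal (cm_density h \<omega>))) borel X) UNIV \<noteq> \<infinity>"
      using X_meas by (simp add: emeasure_distr emeasure_density nn_integral_cm_density cong: nn_integral_cong)
    fix \<phi> :: "'e \<Rightarrow> real"
    assume \<phi>: "continuous_on UNIV \<phi>" "\<And>x. 0 \<le> \<phi> x" "\<And>x. \<phi> x \<le> 1"
    have \<phi>_meas: "(\<lambda>x. ennreal (\<phi> x)) \<in> borel_measurable borel"
      using borel_measurable_continuous_onI[OF \<phi>(1)] by simp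
    have \<phi>_lim: "(\<lambda>i. ennreal (\<phi> (u i))) \<longlonglongrightarrow> ennreal (\<phi> v)" if "u \<longlonglongrightarrow> v" for u v
      using continuous_on_tendsto_compose[OF \<phi>(1) that] by (intro tendsto_ennrealI) simp
    let ?Y = "\<lambda>i. W_sum_tensor (N i) (g i) (x i)"
    let ?R = "\<lambda>i. tensor_sum (N i) (g i) (x i)"
    have "(\<lambda>i. \<integral>\<^sup>+\<omega>. ennreal (cm_density h \<omega>) * ennreal (\<phi> (?Y i \<omega>)) \<partial>M) \<longlonglongrightarrow>
        (\<integral>\<^sup>+\<omega>. ennreal (cm_density h \<omega>) * ennreal (\<phi> (X \<omega>)) \<partial>M)"
    proof (rule nn_integral_dominated_convergence[where w = "\<lambda>\<omega>. ennreal (cm_density h \<omega>)"])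
      show "(\<lambda>\<omega>. ennreal (cm_density h \<omega>) * ennreal (\<phi> (?Y i \<omega>))) \<in> borel_measurable M" for i
        using measurable_compose[OF W_sum_tensor_measurable \<phi>_meas] by simp
      show "(\<lambda>\<omega>. ennreal (cm_density h \<omega>) * ennreal (\<phi> (X \<omega>))) \<in> borel_measurable M"
        using measurable_compose[OF X_meas \<phi>_meas] by simp
      show "AE \<omega> in M. ennreal (cm_density h \<omega>) * ennreal (\<phi> (?Y i \<omega>)) \<le> ennreal (cm_density h \<omega>)" for i
        using \<phi>(3) by (intro AE_I2) (simp add: mult_left_le)
      show "AE \<omega> in M. (\<lambda>i. ennreal (cm_density h \<omega>) * ennreal (\<phi> (?Y i \<omega>))) \<longlonglongrightarrow>
          ennreal (cm_density h \<omega>) * ennreal (\<phi> (X \<omega>))"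
        using AE_lim by eventually_elim (intro ennreal_tendsto_cmult \<phi>_lim, auto)
    qed (simp_all add: nn_integral_cm_density)
    moreover have "(\<lambda>i. \<integral>\<^sup>+\<omega>. ennreal (\<phi> (?Y i \<omega> + ?R i h)) \<partial>M) \<longlonglongrightarrow> (\<integral>\<^sup>+\<omega>. ennreal (\<phi> (X \<omega> + R h)) \<partial>M)"
    proof (rule nn_integral_dominated_convergence[where w = "\<lambda>\<omega>. 1"])
      show "(\<lambda>\<omega>. ennreal (\<phi> (?Y i \<omega> + ?R i h))) \<in> borel_measurable M" for i
      proof -
        have "(\<lambda>\<omega>. ?Y i \<omega> + ?R i h) \<in> borel_measurable M"
          by (rule measurable_compose[OF W_sum_tensor_measurable])
             (auto intro!: borel_measurable_continuous_onI continuous_intros)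
        from measurable_compose[OF this \<phi>_meas] show ?thesis .
      qed
      show "(\<lambda>\<omega>. ennreal (\<phi> (X \<omega> + R h))) \<in> borel_measurable M"
        using measurable_compose[OF Xh_meas \<phi>_meas] .
      show "AE \<omega> in M. (\<lambda>i. ennreal (\<phi> (?Y i \<omega> + ?R i h))) \<longlonglongrightarrow> ennreal (\<phi> (X \<omega> + R h))"
        using AE_lim by eventually_elim (intro \<phi>_lim tendsto_intros lim)
    qed (simp_all add: emeasure_space_1 \<phi>(3))
    ultimately have "(\<integral>\<^sup>+\<omega>. ennreal (cm_density h \<omega>) * ennreal (\<phi> (X \<omega>)) \<partial>M) = (\<integral>\<^sup>+\<omega>. ennreal (\<phi> (X \<omega> + R h)) \<partial>M)"
      unfolding cameron_martin_tensor[OF \<phi>_meas] by (rule LIMSEQ_unique)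
    then show "(\<integral>\<^sup>+x. ennreal (\<phi> x) \<partial>distr (density M (\<lambda>\<omega>. ennreal (cm_density h \<omega>))) borel X) =
        (\<integral>\<^sup>+x. ennreal (\<phi> x) \<partial>distr M borel (\<lambda>\<omega>. X \<omega> + R h))"
      using measurable_compose[OF X_meas \<phi>_meas] \<phi>_meas X_meas' Xh_meas
      by (simp add: nn_integral_distr nn_integral_density)
  qed simp_all
qed

end

subsection \<open>The law of the stochastic integral\<close>

context isonormal
begin

lemma W_tendsto_zero_AE_subseq:
  assumes "k \<longlonglongrightarrow> 0"
  obtains r :: "nat \<Rightarrow> nat" where "strict_mono r" "AE \<omega> in M. (\<lambda>i. W (k (r i)) \<omega>) \<longlonglongrightarrow> 0"
proof (rule L2_norm_tendsto_AE_subseq)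
  have sq: "(\<integral>\<^sup>+\<omega>. ennreal ((norm (W h \<omega>))\<^sup>2) \<partial>M) = ennreal ((norm h)\<^sup>2)" for h
    using W_square_integrable[of h] by (simp add: nn_integral_eq_integral W_square)
  then show "(\<integral>\<^sup>+\<omega>. ennreal ((norm (W (k i) \<omega>))\<^sup>2) \<partial>M) < \<infinity>" for i by simp
  have "L2_norm M (W h) = norm h" for h unfolding L2_norm_def sq by simp
  then show "(\<lambda>i. L2_norm M (W (k i))) \<longlonglongrightarrow> 0" using assms by (simp add: tendsto_norm_zero)
qed auto

text \<open>True for tensors, and stable under limits: the adjoints at \<open>xs\<close> converge
  because \<open>norm xs * norm (?R i - R)\<close> tends to 0, and the isometry of \<open>W\<close>
  turns this into almost everywhere convergence along a subsequence.\<close>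

lemma functional_isonormal_extension:
  fixes R :: "'k \<Rightarrow>\<^sub>L 'e::banach"
  assumes R: "gamma_radonifying R"
  shows "AE \<omega> in M. blinfun_apply xs (isonormal_extension M W R \<omega>) = W (riesz_adjoint R xs) \<omega>"
proof -
  obtain N h x where lim: "(\<lambda>i. tensor_sum (N i) (h i) (x i)) \<longlonglongrightarrow> R"
    and AE_lim: "AE \<omega> in M. (\<lambda>i. W_sum_tensor (N i) (h i) (x i) \<omega>) \<longlonglongrightarrow> isonormal_extension M W R \<omega>"
    by (rule isonormal_extension_approx[OF R])
  let ?R = "\<lambda>i. tensor_sum (N i) (h i) (x i)"
  define k where "k i = riesz_adjoint (?R i) xs - riesz_adjoint R xs" for i
  have "k i = riesz_adjoint (?R i - R) xs" for i
    unfolding k_def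
    by (rule riesz_adjoint_eqI[symmetric])
       (simp add: inner_diff_left riesz_adjoint_inner blinfun.diff_left blinfun.diff_right)
  then have le: "norm (k i) \<le> norm xs * norm (?R i - R)" for i
    by (simp only: norm_riesz_adjoint_le)
  have "(\<lambda>i. norm (?R i - R)) \<longlonglongrightarrow> 0"
    using lim by (simp only: LIM_zero_iff tendsto_norm_zero_iff)
  then have "(\<lambda>i. norm xs * norm (?R i - R)) \<longlonglongrightarrow> 0" by (rule tendsto_mult_right_zero)
  moreover have "\<forall>\<^sub>F i in sequentially. norm (k i) \<le> norm xs * norm (?R i - R)"
    using le by (rule always_eventually[OF allI])
  ultimately have "k \<longlonglongrightarrow> 0" by (rule Lim_null_comparison[rotated])
  then obtain r :: "nat \<Rightarrow> nat" where r: "strict_mono r" and k0: "AE \<omega> in M. (\<lambda>i. W (k (r i)) \<omega>) \<longlonglongrightarrow> 0"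
    by (rule W_tendsto_zero_AE_subseq)
  have "AE \<omega> in M. \<forall>i. blinfun_apply xs (W_sum_tensor (N i) (h i) (x i) \<omega>) = W (riesz_adjoint (?R i) xs) \<omega>"
    unfolding AE_all_countable using functional_W_sum_tensor by blast
  moreover have "AE \<omega> in M. \<forall>i. W (k i) \<omega> = W (riesz_adjoint (?R i) xs) \<omega> - W (riesz_adjoint R xs) \<omega>"
    unfolding AE_all_countable k_def using W_diff by blast
  ultimately show ?thesis
    using k0 AE_lim
  proof eventually_elim
    case (elim \<omega>)
    have "(\<lambda>i. blinfun_apply xs (W_sum_tensor (N (r i)) (h (r i)) (x (r i)) \<omega>)) \<longlonglongrightarrow>
        blinfun_apply xs (isonormal_extension M W R \<omega>)"
      using LIMSEQ_subseq_LIMSEQ[OF elim(4) r] by (intro blinfun.tendsto tendsto_const) (simp add: o_def)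
    moreover have "(\<lambda>i. W (k (r i)) \<omega> + W (riesz_adjoint R xs) \<omega>) \<longlonglongrightarrow> 0 + W (riesz_adjoint R xs) \<omega>"
      using elim(3) by (intro tendsto_intros)
    ultimately show ?case using elim(1,2) LIMSEQ_unique by force
  qed
qed

lemma covariance_isonormal_extension:
  fixes R :: "'k \<Rightarrow>\<^sub>L 'e::banach"
  assumes R: "gamma_radonifying R"
  shows "covariance_operator M (isonormal_extension M W R) xs = R (riesz_adjoint R xs)"
proof -
  let ?X = "isonormal_extension M W R"
  define Q where "Q = Blinfun (\<lambda>xs. R (riesz_adjoint R xs))"
  have Q: "Q xs = R (riesz_adjoint R xs)" for xs
    unfolding Q_def by (simp add: bounded_linear_Blinfun_apply[OF bounded_linear_adjoint_square])
  have X: "?X \<in> borel_measurable M" using isonormal_extension_approx[OF R] by blast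
  have fX: "(\<lambda>\<omega>. blinfun_apply xs (?X \<omega>)) \<in> borel_measurable M" for xs :: "'e \<Rightarrow>\<^sub>L real"
    by (rule measurable_compose[OF X]) (auto intro!: borel_measurable_continuous_onI continuous_intros)
  have cov: "blinfun_apply ys (Q xs) = (\<integral>\<omega>. blinfun_apply xs (?X \<omega>) * blinfun_apply ys (?X \<omega>) \<partial>M)" for xs ys
  proof -
    have "(\<integral>\<omega>. blinfun_apply xs (?X \<omega>) * blinfun_apply ys (?X \<omega>) \<partial>M) =
        (\<integral>\<omega>. W (riesz_adjoint R xs) \<omega> * W (riesz_adjoint R ys) \<omega> \<partial>M)"
    proof (rule integral_cong_AE)
      show "AE \<omega> in M. blinfun_apply xs (?X \<omega>) * blinfun_apply ys (?X \<omega>) =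
          W (riesz_adjoint R xs) \<omega> * W (riesz_adjoint R ys) \<omega>"
        using functional_isonormal_extension[OF R, of xs] functional_isonormal_extension[OF R, of ys]
        by eventually_elim simp
    qed (use fX in auto)
    then show ?thesis by (simp add: W_inner inner_riesz_adjoint Q)
  qed
  have "covariance_operator M ?X = Q"
    unfolding covariance_operator_def
  proof (rule the_equality)
    show "\<forall>xs ys. blinfun_apply ys (Q xs) = (\<integral>\<omega>. blinfun_apply xs (?X \<omega>) * blinfun_apply ys (?X \<omega>) \<partial>M)"
      using cov by blast
    fix Q' :: "('e \<Rightarrow>\<^sub>L real) \<Rightarrow>\<^sub>L 'e"
    assume "\<forall>xs ys. blinfun_apply ys (Q' xs) = (\<integral>\<omega>. blinfun_apply xs (?X \<omega>) * blinfun_apply ys (?X \<omega>) \<partial>M)"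
    then have "blinfun_apply ys (Q' xs) = blinfun_apply ys (Q xs)" for xs and ys :: "'e \<Rightarrow>\<^sub>L real"
      using cov by simp
    then have "Q' xs = Q xs" for xs by (rule dual_separates_points)
    then show "Q' = Q" by (rule blinfun_eqI)
  qed
  then show ?thesis using Q by simp
qed

text \<open>By \<open>cameron_martin\<close> the law of \<open>b + X\<close> is the image under
  \<open>a + X\<close> of a measure with a density with respect to \<open>M\<close>, and passing to
  a density preserves null sets.\<close>

lemma absolutely_continuous_translates:
  fixes R :: "'k \<Rightarrow>\<^sub>L 'e::banach"
  assumes R: "gamma_radonifying R" and ba: "b - a \<in> range R"
  shows "absolutely_continuous (distr M borel (\<lambda>\<omega>. a + isonormal_extension M W R \<omega>))
    (distr M borel (\<lambda>\<omega>. b + isonormal_extension M W R \<omega>))"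
proof -
  let ?X = "isonormal_extension M W R"
  obtain h where h: "b = a + R h" using ba by (auto simp: algebra_simps)
  have X: "?X \<in> borel_measurable M" using isonormal_extension_approx[OF R] by blast
  have shift: "(\<lambda>x. c + x) \<in> borel_measurable borel" for c :: 'e
    by (intro borel_measurable_continuous_onI continuous_intros)
  have Xs: "(\<lambda>\<omega>. c + ?X \<omega>) \<in> borel_measurable M" for c
    by (rule measurable_compose[OF X shift])
  have shift_R: "(\<lambda>x. x + R h) \<in> borel_measurable borel"
    by (intro borel_measurable_continuous_onI continuous_intros)
  show ?thesis
    unfolding absolutely_continuous_def
  proof
    fix A assume "A \<in> null_sets (distr M borel (\<lambda>\<omega>. a + ?X \<omega>))"
    then have A: "A \<in> sets borel" and null: "emeasure M ((\<lambda>\<omega>. a + ?X \<omega>) -` A \<inter> space M) = 0"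
      using Xs by (auto simp: null_sets_def emeasure_distr)
    define B where "B = (\<lambda>x. a + x) -` A"
    have B: "B \<in> sets borel" unfolding B_def using measurable_sets[OF shift A] by simp
    have "?X -` B \<inter> space M \<in> null_sets M"
      using null measurable_sets[OF X B] by (simp add: null_sets_def B_def vimage_def)
    then have AE: "AE \<omega> in M. \<omega> \<notin> ?X -` B \<inter> space M" by (rule AE_not_in)
    have "(\<integral>\<^sup>+\<omega>. ennreal (cm_density h \<omega>) * indicator (?X -` B \<inter> space M) \<omega> \<partial>M) = (\<integral>\<^sup>+\<omega>. 0 \<partial>M)"
    proof (rule nn_integral_cong_AE)
      show "AE \<omega> in M. ennreal (cm_density h \<omega>) * indicator (?X -` B \<inter> space M) \<omega> = 0"
        using AE by eventually_elim (simp add: indicator_def)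
    qed
    then have "emeasure (density M (\<lambda>\<omega>. ennreal (cm_density h \<omega>))) (?X -` B \<inter> space M) = 0"
      using measurable_sets[OF X B] by (subst emeasure_density) auto
    then have "emeasure (distr (density M (\<lambda>\<omega>. ennreal (cm_density h \<omega>))) borel ?X) B = 0"
      using X B by (simp add: emeasure_distr)
    then have "emeasure (distr M borel (\<lambda>\<omega>. ?X \<omega> + R h)) B = 0"
      by (simp add: cameron_martin[OF R])
    then have "emeasure M ((\<lambda>\<omega>. ?X \<omega> + R h) -` B \<inter> space M) = 0"
      using measurable_compose[OF X shift_R] B by (simp add: emeasure_distr)
    also have "(\<lambda>\<omega>. ?X \<omega> + R h) -` B = (\<lambda>\<omega>. b + ?X \<omega>) -` A"
      by (auto simp: B_def h algebra_simps)
    finally show "A \<in> null_sets (distr M borel (\<lambda>\<omega>. b + ?X \<omega>))"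
      using A Xs by (simp add: null_sets_def emeasure_distr)
  qed
qed

text \<open>If \<open>a\<close> is not in the range of \<open>R\<close>, there are functionals with \<open>xs n a = 1\<close> and
  \<open>R\<^sup>* (xs n) \<rightarrow> 0\<close>; the set of points where they tend to \<open>0\<close> carries the law of
  \<open>W(R)\<close>, but is null for its translate by \<open>a\<close>.\<close>

lemma mem_range_if_absolutely_continuous:
  fixes R :: "'k \<Rightarrow>\<^sub>L 'e::banach"
  assumes R: "gamma_radonifying R"
    and ac: "absolutely_continuous (distr M borel (isonormal_extension M W R))
      (distr M borel (\<lambda>\<omega>. a + isonormal_extension M W R \<omega>))"
  shows "a \<in> range R"
proof (rule ccontr)
  assume a: "a \<notin> range R"
  let ?X = "isonormal_extension M W R"
  interpret adj: linear "riesz_adjoint R" by (rule linear_riesz_adjoint)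
  have X: "?X \<in> borel_measurable M" using isonormal_extension_approx[OF R] by blast
  have Xa: "(\<lambda>\<omega>. a + ?X \<omega>) \<in> borel_measurable M"
    by (rule measurable_compose[OF X]) (intro borel_measurable_continuous_onI continuous_intros)
  have "\<exists>ys :: 'e \<Rightarrow>\<^sub>L real. blinfun_apply ys a = 1 \<and> norm (riesz_adjoint R ys) \<le> 1 / real (Suc n)" for n
  proof -
    \<comment> \<open>Since \<open>a\<close> is outside the range, the bound of
      \<open>mem_range_if_adjoint_bounded\<close> must fail for each constant, here
      \<open>n + 1\<close>; dividing by \<open>xs a\<close> then normalises the value at
      \<open>a\<close> to 1.\<close>
    obtain xs where xs: "real (Suc n) * norm (riesz_adjoint R xs) < \<bar>blinfun_apply xs a\<bar>"
      using mem_range_if_adjoint_bounded[of a "real (Suc n)" R] a by (meson not_le)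
    define c where "c = blinfun_apply xs a"
    have "0 \<le> real (Suc n) * norm (riesz_adjoint R xs)" by simp
    then have "0 < \<bar>c\<bar>" using xs unfolding c_def by linarith
    then have c: "c \<noteq> 0" by simp
    have "blinfun_apply (xs /\<^sub>R c) a = 1" using c by (simp add: c_def blinfun.scaleR_left)
    moreover have "norm (riesz_adjoint R (xs /\<^sub>R c)) \<le> 1 / real (Suc n)"
      using xs c by (simp add: adj.scale c_def[symmetric] field_simps)
    ultimately show ?thesis by blast
  qed
  then obtain ys :: "nat \<Rightarrow> 'e \<Rightarrow>\<^sub>L real" where ya: "\<And>n. blinfun_apply (ys n) a = 1"
    and y0: "\<And>n. norm (riesz_adjoint R (ys n)) \<le> 1 / real (Suc n)"
    by metis
  have "\<forall>\<^sub>F n in sequentially. norm (riesz_adjoint R (ys n)) \<le> 1 / real (Suc n)"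
    using y0 by (rule always_eventually[OF allI])
  moreover have "(\<lambda>n. 1 / real (Suc n)) \<longlonglongrightarrow> 0"
    using LIMSEQ_inverse_real_of_nat by (simp add: inverse_eq_divide)
  ultimately have "(\<lambda>n. riesz_adjoint R (ys n)) \<longlonglongrightarrow> 0" by (rule Lim_null_comparison)
  then obtain r :: "nat \<Rightarrow> nat" where "strict_mono r"
    and r: "AE \<omega> in M. (\<lambda>i. W (riesz_adjoint R (ys (r i))) \<omega>) \<longlonglongrightarrow> 0"
    by (rule W_tendsto_zero_AE_subseq)
  define A where "A = {x. (\<lambda>i. blinfun_apply (ys (r i)) x) \<longlonglongrightarrow> 0}"
  have [measurable]: "blinfun_apply (ys i) \<in> borel_measurable borel" for i
    by (intro borel_measurable_continuous_onI continuous_intros)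
  have A: "A \<in> sets borel"
  proof -
    have "A = {x \<in> space borel. (\<lambda>i. blinfun_apply (ys (r i)) x) \<longlonglongrightarrow> 0}" by (simp add: A_def)
    also have "\<dots> \<in> sets borel" by measurable
    finally show ?thesis .
  qed
  have "AE \<omega> in M. \<forall>i. blinfun_apply (ys (r i)) (?X \<omega>) = W (riesz_adjoint R (ys (r i))) \<omega>"
    unfolding AE_all_countable using functional_isonormal_extension[OF R] by blast
  then have XA: "AE \<omega> in M. ?X \<omega> \<in> A"
    using r by eventually_elim (simp add: A_def)
  then have "AE x in distr M borel ?X. x \<notin> - A"
    using A X by (simp add: AE_distr_iff)
  then have "- A \<in> null_sets (distr M borel ?X)"
    using A by (simp add: AE_iff_null_sets)
  then have "- A \<in> null_sets (distr M borel (\<lambda>\<omega>. a + ?X \<omega>))"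
    using ac unfolding absolutely_continuous_def by blast
  then have "AE x in distr M borel (\<lambda>\<omega>. a + ?X \<omega>). x \<notin> - A" by (rule AE_not_in)
  then have "AE \<omega> in M. a + ?X \<omega> \<in> A"
    using A Xa by (simp add: AE_distr_iff)
  \<comment> \<open>Adding \<open>a\<close> raises each of these functionals by exactly 1, so both
    sequences could tend to 0 only if 1 were 0. Absolute continuity would provide points where both
    do.\<close>
  with XA have "AE \<omega> in M. False"
  proof eventually_elim
    case (elim \<omega>)
    then have 0: "(\<lambda>i. blinfun_apply (ys (r i)) (?X \<omega>)) \<longlonglongrightarrow> 0"
      and 1: "(\<lambda>i. 1 + blinfun_apply (ys (r i)) (?X \<omega>)) \<longlonglongrightarrow> 0"
      by (auto simp: A_def blinfun.add_right ya)
    from tendsto_diff[OF 1 0] have "(\<lambda>i::nat. 1::real) \<longlonglongrightarrow> 0" by simp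
    then show False by (simp add: LIMSEQ_const_iff)
  qed
  then show False by (simp add: AE_False)
qed

end

theorem theorem2p7:
  fixes M :: "'w measure"
    and j :: "'k::{real_inner,complete_space} \<Rightarrow> real \<Rightarrow> 'h::{real_inner,complete_space}"
    and W :: "'k \<Rightarrow> 'w \<Rightarrow> real"
    and D :: "'e::banach set" and A :: "'e \<Rightarrow> 'e"
    and S :: "real \<Rightarrow> 'e \<Rightarrow>\<^sub>L 'e"
    and B :: "'h \<Rightarrow>\<^sub>L 'e"
    and T :: real
    and \<Phi> :: "real \<Rightarrow> 'h \<Rightarrow>\<^sub>L 'e"
  defines "\<Phi> \<equiv> \<lambda>t. S (T - t) o\<^sub>L B"
  assumes "0 < T"
    and "continuous_dense_inclusion T j"
    and "prob_space M"
    and "isonormal_process M W"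
    and "generates_C0_semigroup D A S"
    and "\<And>xs. in_L2 (time_measure T) (\<lambda>t. riesz_adjoint (\<Phi> t) xs)"
    and "stochastically_integrable T j \<Phi>"
  shows
    "(range (blinfun_apply (S T)) \<subseteq> rkhs (covariance_operator M (stochastic_integral M W T j \<Phi>))
      \<longleftrightarrow> (\<forall>x0. \<exists>f :: 'k L2_dual. controlled_mild_solution S B T j x0 f = 0)) \<and>
     ((\<forall>x0. \<exists>f :: 'k L2_dual. controlled_mild_solution S B T j x0 f = 0)
      \<longleftrightarrow> (\<forall>x0 y0. absolutely_continuous
             (distr M borel (stochastic_mild_solution M W S B T j x0))
             (distr M borel (stochastic_mild_solution M W S B T j y0))))"
proof -
  interpret isonormal M W
    using assms by (simp add: isonormal_def isonormal_axioms_def)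
  obtain R where R: "represents T j \<Phi> R"
    using assms unfolding stochastically_integrable_def by blast
  then have \<gamma>: "gamma_radonifying R" and orbit: "\<And>xs. riesz_adjoint R xs = orbit T j \<Phi> xs"
    by (auto simp: represents_def)
  define X where "X = isonormal_extension M W R"
  have X: "stochastic_integral M W T j \<Phi> = X"
    unfolding stochastic_integral_def X_def the_represents[OF R] ..
  have rkhs: "rkhs (covariance_operator M (stochastic_integral M W T j \<Phi>)) = range R"
    unfolding X X_def by (intro rkhs_adjoint_square covariance_isonormal_extension \<gamma>)
  have sol: "stochastic_mild_solution M W S B T j x0 = (\<lambda>\<omega>. S T x0 + X \<omega>)" for x0
    using X unfolding stochastic_mild_solution_def \<Phi>_def by auto
  have control: "(\<exists>f :: 'k L2_dual. controlled_mild_solution S B T j x0 f = 0) \<longleftrightarrow> S T x0 \<in> range R" for x0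
  proof -
    have "(\<exists>f :: 'k L2_dual. controlled_mild_solution S B T j x0 f = 0) \<longleftrightarrow>
        (\<exists>f. control_operator T j \<Phi> f = - S T x0)"
      unfolding controlled_mild_solution_def \<Phi>_def by (simp add: add_eq_0_iff)
    also have "\<dots> \<longleftrightarrow> - S T x0 \<in> range (control_operator T j \<Phi>)" by (auto simp: image_iff eq_commute)
    also have "\<dots> \<longleftrightarrow> - S T x0 \<in> range R" by (simp add: range_control_operator[OF orbit])
    also have "\<dots> \<longleftrightarrow> S T x0 \<in> range R"
    proof
      assume "- S T x0 \<in> range R"
      then obtain k where "- S T x0 = R k" by blast
      then have "S T x0 = R (- k)" by (metis blinfun.minus_right minus_minus)
      then show "S T x0 \<in> range R" by simp
    next
      assume "S T x0 \<in> range R"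
      then obtain k where "S T x0 = R k" by blast
      then have "- S T x0 = R (- k)" by (simp add: blinfun.minus_right)
      then show "- S T x0 \<in> range R" by simp
    qed
    finally show ?thesis .
  qed
  have ac: "(\<forall>x0. S T x0 \<in> range R) \<longleftrightarrow> (\<forall>x0 y0. absolutely_continuous
      (distr M borel (\<lambda>\<omega>. S T x0 + X \<omega>)) (distr M borel (\<lambda>\<omega>. S T y0 + X \<omega>)))"
  proof (intro iffI allI)
    fix x0 y0
    assume "\<forall>x0. S T x0 \<in> range R"
    \<comment> \<open>The shift between the two solutions is \<open>S T (y0 - x0)\<close>. Both
      directions of mutual absolute continuity are covered because \<open>x0\<close> and
      \<open>y0\<close> range over all ordered pairs.\<close>
    then have "S T y0 - S T x0 \<in> range R"
      by (simp flip: blinfun.diff_right)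
    then show "absolutely_continuous (distr M borel (\<lambda>\<omega>. S T x0 + X \<omega>)) (distr M borel (\<lambda>\<omega>. S T y0 + X \<omega>))"
      unfolding X_def by (rule absolutely_continuous_translates[OF \<gamma>])
  next
    fix x0
    assume "\<forall>x0 y0. absolutely_continuous
      (distr M borel (\<lambda>\<omega>. S T x0 + X \<omega>)) (distr M borel (\<lambda>\<omega>. S T y0 + X \<omega>))"
    \<comment> \<open>Initial value 0 contributes no shift, so the law of \<open>X\<close> is
      compared with its translate by \<open>S T x0\<close>.\<close>
    then have "absolutely_continuous (distr M borel (\<lambda>\<omega>. S T 0 + X \<omega>)) (distr M borel (\<lambda>\<omega>. S T x0 + X \<omega>))"
      by blast
    then show "S T x0 \<in> range R"
      unfolding X_def by (intro mem_range_if_absolutely_continuous[OF \<gamma>]) (simp add: blinfun.zero_right)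
  qed
  have "range (S T) \<subseteq> range R \<longleftrightarrow> (\<forall>x0. S T x0 \<in> range R)" by auto
  then show ?thesis
    unfolding rkhs control sol ac[symmetric] by simp
qed

end
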